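(* Let $\Delta_*\mathfrak{gl}(n;\mathbb{R})=\left\{\begin{pmatrix}A&0\\0&A\end{pmatrix}: A\in\mathfrak{gl}(n;\mathbb{R})\right\}\subset\mathfrak{gl}(2n;\mathbb{R})$ be the Lie algebra of the Lie group $\Delta GL(n;\mathbb{R})=\left\{\begin{pmatrix}A&0\\0&A\end{pmatrix}: A\in GL(n;\mathbb{R})\right\}$. Then the first prolongation of $\Delta_*\mathfrak{gl}(n;\mathbb{R})$ vanishes, and $\Delta_*\mathfrak{gl}(n;\mathbb{R})$ is invariant under transposition of matrices. Consequently, the well-adapted connection exists for $\Delta GL(n;\mathbb{R})$-structures: for every $\Delta GL(n;\mathbb{R})$-structure $\mathcal{B}\to M$ on a $2n$-dimensional manifold $M$ there exists a unique linear connection $\nabla'$ adapted to $\mathcal{B}$ such that $$\mathrm{trace}(S\circ i_X\circ T')=0$$ for every endomorphism $S$ of $TM$ given by a section of the adjoint bundle $\mathrm{ad}\,\mathcal{B}$ and every vector field $X$ on $M$, where $T'$ is the torsion of $\nabla'$; moreover, this connection depends only on the first contact (first-order jet) of the $\Delta GL(n;\mathbb{R})$-structure.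
   Context: Manifolds are $C^\infty$. For a Lie subalgebra $\mathfrak{g}\subseteq\mathfrak{gl}(m;\mathbb{R})=\mathrm{Hom}(\mathbb{R}^m,\mathbb{R}^m)$, the first prolongation is $\mathfrak{g}^{(1)}=\{T\in\mathrm{Hom}(\mathbb{R}^m,\mathfrak{g}): T(u)v-T(v)u=0\ \ \forall u,v\in\mathbb{R}^m\}$. A $G$-structure on $M$ ($G\subseteq GL(m;\mathbb{R})$, $m=\dim M$) is a reduction $\mathcal{B}\to M$ of the linear frame bundle $FM$ to $G$; it corresponds to a section $s$ of $FM/G\to M$. A linear connection is adapted to $\mathcal{B}$ if it is reducible to $\mathcal{B}$. The adjoint bundle $\mathrm{ad}\,\mathcal{B}=(\mathcal{B}\times\mathfrak{g})/G$ (action $(u,a)\cdot g=(u\cdot g,g^{-1}ag)$) is regarded as a subbundle of $\mathrm{End}(TM)$ by sending the class of $(u,a)$ to $u\circ a\circ u^{-1}$, where a frame $u$ at $x$ is viewed as an isomorphism $\mathbb{R}^m\to T_xM$. For a vector field $X$, $i_X\circ T'$ is the endomorphism $Y\mapsto T'(X,Y)$, so $S\circ i_X\circ T'$ is $Y\mapsto S(T'(X,Y))$. "Depends only on the first contact" means that the value of the connection at $x\in M$ depends only on the 1-jet $j^1_xs$ of the section $s$ corresponding to $\mathcal{B}$. The connection $\nabla'$ is called the well-adapted connection of $\mathcal{B}$. *)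

theory Defs
  imports "HOL-Analysis.Analysis"
begin

section \<open>Smooth functions on open subsets of normed spaces\<close>

(* Intended for open S: the derivatives are the full ones, "at x". *)
primrec Ck_on :: "nat \<Rightarrow> 'a::real_normed_vector set \<Rightarrow> ('a \<Rightarrow> 'b::real_normed_vector) \<Rightarrow> bool" where
  "Ck_on 0 S f \<longleftrightarrow> continuous_on S f"
| "Ck_on (Suc k) S f \<longleftrightarrow> (\<forall>x\<in>S. f differentiable (at x)) \<and>
     (\<forall>v. Ck_on k S (\<lambda>x. frechet_derivative f (at x) v))"

definition smooth_on :: "'a::real_normed_vector set \<Rightarrow> ('a \<Rightarrow> 'b::real_normed_vector) \<Rightarrow> bool" where
  "smooth_on S f \<longleftrightarrow> (\<forall>k. Ck_on k S f)"

section \<open>Manifolds\<close>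

(* A manifold is given by a (not necessarily maximal) smooth atlas; a chart is its domain
   together with its coordinate map, whose values off the domain are irrelevant.  The underlying
   set is the union of the domains and the topology is the one making all charts
   homeomorphisms onto open subsets of the model space. *)
type_synonym ('a, 'e) chart = "'a set \<times> ('a \<Rightarrow> 'e)"

definition carrier :: "('a, 'e) chart set \<Rightarrow> 'a set" where
  "carrier A = (\<Union>c\<in>A. fst c)"

definition charts_at :: "('a, 'e) chart set \<Rightarrow> 'a \<Rightarrow> ('a, 'e) chart set" where
  "charts_at A p = {c \<in> A. p \<in> fst c}"

abbreviation chart_inv :: "('a, 'e) chart \<Rightarrow> 'e \<Rightarrow> 'a" where
  "chart_inv c \<equiv> inv_into (fst c) (snd c)"

definition atlas_topology :: "('a, 'e::euclidean_space) chart set \<Rightarrow> 'a topology" where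
  "atlas_topology A =
     topology (\<lambda>W. W \<subseteq> carrier A \<and> (\<forall>c\<in>A. open (snd c ` (fst c \<inter> W))))"

definition second_countable_space :: "'a topology \<Rightarrow> bool" where
  "second_countable_space X \<longleftrightarrow>
     (\<exists>\<B>. countable \<B> \<and> (\<forall>V\<in>\<B>. openin X V) \<and>
        (\<forall>U x. openin X U \<and> x \<in> U \<longrightarrow> (\<exists>V\<in>\<B>. x \<in> V \<and> V \<subseteq> U)))"

definition smooth_manifold :: "('a, 'e::euclidean_space) chart set \<Rightarrow> bool" where
  "smooth_manifold A \<longleftrightarrow>
     (\<forall>c\<in>A. inj_on (snd c) (fst c)) \<and>
     (\<forall>c\<in>A. \<forall>d\<in>A. open (snd c ` (fst c \<inter> fst d)) \<and>
        smooth_on (snd c ` (fst c \<inter> fst d)) (snd d \<circ> chart_inv c)) \<and>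
     Hausdorff_space (atlas_topology A) \<and> second_countable_space (atlas_topology A)"

definition smooth_fun ::
  "('a, 'e::euclidean_space) chart set \<Rightarrow> 'a set \<Rightarrow> ('a \<Rightarrow> 'b::real_normed_vector) \<Rightarrow> bool" where
  "smooth_fun A W f \<longleftrightarrow> openin (atlas_topology A) W \<and>
     (\<forall>c\<in>A. smooth_on (snd c ` (fst c \<inter> W)) (f \<circ> chart_inv c))"

definition smooth_map ::
  "('a, 'e::euclidean_space) chart set \<Rightarrow> ('b, 'f::euclidean_space) chart set
     \<Rightarrow> 'a set \<Rightarrow> ('a \<Rightarrow> 'b) \<Rightarrow> bool" where
  "smooth_map A B W f \<longleftrightarrow> openin (atlas_topology A) W \<and>
     continuous_map (subtopology (atlas_topology A) W) (atlas_topology B) f \<and>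
     (\<forall>c\<in>A. \<forall>d\<in>B.
        smooth_on (snd c ` (fst c \<inter> W \<inter> f -` fst d)) (snd d \<circ> f \<circ> chart_inv c))"

section \<open>Tangent vectors\<close>

(* A tangent vector at p is the family of its components in all the charts around p, these
   components being related by the derivatives of the coordinate changes; the entries at
   all other charts are normalised to 0.  The vector space operations are entrywise. *)
type_synonym ('a, 'e) tvec = "('a, 'e) chart \<Rightarrow> 'e"

definition tangent_space :: "('a, 'e::euclidean_space) chart set \<Rightarrow> 'a \<Rightarrow> ('a, 'e) tvec set" where
  "tangent_space A p = {v.
     (\<forall>c\<in>charts_at A p. \<forall>d\<in>charts_at A p.
        v d = frechet_derivative (snd d \<circ> chart_inv c) (at (snd c p)) (v c)) \<and>
     (\<forall>c. c \<notin> charts_at A p \<longrightarrow> v c = 0)}"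

(* The derivative of a vector-valued function in the direction of v at p, computed in some
   chart around p. *)
definition dir_deriv ::
  "('a, 'e::euclidean_space) chart set \<Rightarrow> ('a \<Rightarrow> 'b::real_normed_vector)
     \<Rightarrow> 'a \<Rightarrow> ('a, 'e) tvec \<Rightarrow> 'b" where
  "dir_deriv A f p v =
     (let c = (SOME c. c \<in> charts_at A p)
      in frechet_derivative (f \<circ> chart_inv c) (at (snd c p)) (v c))"

definition pushforward ::
  "('a, 'e::euclidean_space) chart set \<Rightarrow> ('b, 'f::euclidean_space) chart set
     \<Rightarrow> ('a \<Rightarrow> 'b) \<Rightarrow> 'a \<Rightarrow> ('a, 'e) tvec \<Rightarrow> ('b, 'f) tvec" where
  "pushforward A B f p v =
     (\<lambda>d. if d \<in> charts_at B (f p) then dir_deriv A (snd d \<circ> f) p v else 0)"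

definition smooth_vf ::
  "('a, 'e::euclidean_space) chart set \<Rightarrow> 'a set \<Rightarrow> ('a \<Rightarrow> ('a, 'e) tvec) \<Rightarrow> bool" where
  "smooth_vf A W X \<longleftrightarrow> openin (atlas_topology A) W \<and>
     (\<forall>p\<in>W. X p \<in> tangent_space A p) \<and>
     (\<forall>c\<in>A. smooth_on (snd c ` (fst c \<inter> W)) (\<lambda>q. X (chart_inv c q) c))"

definition lie_bracket ::
  "('a, 'e::euclidean_space) chart set \<Rightarrow> ('a \<Rightarrow> ('a, 'e) tvec) \<Rightarrow> ('a \<Rightarrow> ('a, 'e) tvec)
     \<Rightarrow> 'a \<Rightarrow> ('a, 'e) tvec" where
  "lie_bracket A X Y p = (\<lambda>c. if c \<in> charts_at A p then
       frechet_derivative (\<lambda>q. Y (chart_inv c q) c) (at (snd c p)) (X p c)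
     - frechet_derivative (\<lambda>q. X (chart_inv c q) c) (at (snd c p)) (Y p c)
     else 0)"

definition curve_velocity ::
  "('a, 'e::euclidean_space) chart set \<Rightarrow> (real \<Rightarrow> 'a) \<Rightarrow> real \<Rightarrow> ('a, 'e) tvec" where
  "curve_velocity A \<gamma> t =
     (\<lambda>d. if d \<in> charts_at A (\<gamma> t) then vector_derivative (snd d \<circ> \<gamma>) (at t) else 0)"

section \<open>The linear frame bundle\<close>

(* A frame at x is a linear isomorphism from the model space onto the tangent space at x; the
   manifold of all frames is referred to as FM below. *)
type_synonym ('a, 'm) frame = "'a \<times> (real^'m \<Rightarrow> ('a, real^'m) tvec)"

definition frames :: "('a, real^'m::finite) chart set \<Rightarrow> ('a, 'm) frame set" where
  "frames A = {(x, u). x \<in> carrier A \<and> (\<forall>c. linear (\<lambda>\<xi>. u \<xi> c)) \<and>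
     bij_betw u UNIV (tangent_space A x)}"

(* Coordinates of a frame: those of its base point, and the matrix of the frame in the chart. *)
definition frame_chart ::
  "('a, real^'m::finite) chart set \<Rightarrow> ('a, real^'m) chart
     \<Rightarrow> (('a, 'm) frame, (real^'m) \<times> (real^'m^'m)) chart" where
  "frame_chart A c =
     ({p \<in> frames A. fst p \<in> fst c}, \<lambda>p. (snd c (fst p), matrix (\<lambda>\<xi>. snd p \<xi> c)))"

definition frame_atlas ::
  "('a, real^'m::finite) chart set
     \<Rightarrow> (('a, 'm) frame, (real^'m) \<times> (real^'m^'m)) chart set" where
  "frame_atlas A = frame_chart A ` A"

type_synonym ('a, 'm) frame_tvec = "(('a, 'm) frame, (real^'m) \<times> (real^'m^'m)) tvec"

definition act :: "('a, 'm::finite) frame \<Rightarrow> real^'m^'m \<Rightarrow> ('a, 'm) frame" where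
  "act p g = (fst p, \<lambda>\<xi>. snd p (g *v \<xi>))"

definition orbit :: "(real^'m^'m) set \<Rightarrow> ('a, 'm::finite) frame \<Rightarrow> ('a, 'm) frame set" where
  "orbit G p = act p ` G"

section \<open>G-structures\<close>

definition fibre :: "('a, 'm) frame set \<Rightarrow> 'a \<Rightarrow> ('a, 'm) frame set" where
  "fibre B x = {p \<in> B. fst p = x}"

(* A principal G-subbundle of the frame bundle: around every point it is the set of
   all translates by G of a smooth local frame field. *)
definition G_structure ::
  "('a, real^'m::finite) chart set \<Rightarrow> (real^'m^'m) set \<Rightarrow> ('a, 'm) frame set \<Rightarrow> bool" where
  "G_structure A G B \<longleftrightarrow> B \<subseteq> frames A \<and>
     (\<forall>x\<in>carrier A. \<exists>W \<sigma>. x \<in> W \<and> smooth_map A (frame_atlas A) W \<sigma> \<and>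
        (\<forall>y\<in>W. fst (\<sigma> y) = y \<and> fibre B y = orbit G (\<sigma> y)))"

(* The points of FM/G are the G-orbits of frames, and the section of FM/G that corresponds to a
   G-structure B is "fibre B".  A subset of FM/G is open, and a function on it is smooth,
   iff its pull-back to FM is. *)
definition quotient_smooth_fun ::
  "('a, real^'m::finite) chart set \<Rightarrow> (real^'m^'m) set \<Rightarrow> ('a, 'm) frame set set
     \<Rightarrow> (('a, 'm) frame set \<Rightarrow> real) \<Rightarrow> bool" where
  "quotient_smooth_fun A G V F \<longleftrightarrow> V \<subseteq> orbit G ` frames A \<and>
     smooth_fun (frame_atlas A) {p \<in> frames A. orbit G p \<in> V} (F \<circ> orbit G)"

(* Equality of 1-jets at x of two sections of FM/G: equal values and equal differentials, the
   latter tested on the smooth functions defined near the common value. *)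
definition same_1jet ::
  "('a, real^'m::finite) chart set \<Rightarrow> (real^'m^'m) set
     \<Rightarrow> ('a \<Rightarrow> ('a, 'm) frame set) \<Rightarrow> ('a \<Rightarrow> ('a, 'm) frame set) \<Rightarrow> 'a \<Rightarrow> bool" where
  "same_1jet A G s s' x \<longleftrightarrow> s x = s' x \<and>
     (\<forall>V F. quotient_smooth_fun A G V F \<and> s x \<in> V \<longrightarrow>
        (\<forall>v\<in>tangent_space A x. dir_deriv A (F \<circ> s) x v = dir_deriv A (F \<circ> s') x v))"

section \<open>Linear connections\<close>

(* The value at p of the fundamental vector field of a: the differential at the
   identity matrix, applied to a, of the orbit map of p. *)
definition fundamental_vector ::
  "('a, real^'m::finite) chart set \<Rightarrow> ('a, 'm) frame \<Rightarrow> real^'m^'m \<Rightarrow> ('a, 'm) frame_tvec" where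
  "fundamental_vector A p a = (\<lambda>d. if d \<in> charts_at (frame_atlas A) p
     then frechet_derivative (\<lambda>g. snd d (act p g)) (at (mat 1)) a else 0)"

(* Connection forms of principal connections on the frame bundle.  The first clause only fixes
   the values off the tangent bundle of FM, so that distinct forms are distinct connections. *)
definition linear_connection ::
  "('a, real^'m::finite) chart set
     \<Rightarrow> (('a, 'm) frame \<Rightarrow> ('a, 'm) frame_tvec \<Rightarrow> real^'m^'m) \<Rightarrow> bool" where
  "linear_connection A \<omega> \<longleftrightarrow>
     (\<forall>p v. \<not> (p \<in> frames A \<and> v \<in> tangent_space (frame_atlas A) p) \<longrightarrow> \<omega> p v = 0) \<and>
     (\<forall>p\<in>frames A. \<forall>v\<in>tangent_space (frame_atlas A) p. \<forall>w\<in>tangent_space (frame_atlas A) p.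
        \<forall>a b. \<omega> p (\<lambda>d. a *\<^sub>R v d + b *\<^sub>R w d) = a *\<^sub>R \<omega> p v + b *\<^sub>R \<omega> p w) \<and>
     (\<forall>W Z. smooth_vf (frame_atlas A) W Z \<longrightarrow> smooth_fun (frame_atlas A) W (\<lambda>p. \<omega> p (Z p))) \<and>
     (\<forall>p\<in>frames A. \<forall>a. \<omega> p (fundamental_vector A p a) = a) \<and>
     (\<forall>p\<in>frames A. \<forall>v\<in>tangent_space (frame_atlas A) p. \<forall>g. invertible g \<longrightarrow>
        \<omega> (act p g) (pushforward (frame_atlas A) (frame_atlas A) (\<lambda>q. act q g) p v)
          = matrix_inv g ** \<omega> p v ** g)"

(* The tangent space at p of a subbundle B of the frame bundle, as the velocities
   of the smooth curves that lie in B. *)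
definition tangent_of ::
  "('a, real^'m::finite) chart set \<Rightarrow> ('a, 'm) frame set \<Rightarrow> ('a, 'm) frame
     \<Rightarrow> ('a, 'm) frame_tvec set" where
  "tangent_of A B p = {curve_velocity (frame_atlas A) \<gamma> 0 | \<gamma> \<epsilon>.
     \<epsilon> > 0 \<and> smooth_map {(UNIV, id :: real \<Rightarrow> real)} (frame_atlas A) {-\<epsilon><..<\<epsilon>} \<gamma> \<and>
     \<gamma> ` {-\<epsilon><..<\<epsilon>} \<subseteq> B \<and> \<gamma> 0 = p}"

(* The connection is reducible to B: its horizontal spaces at points of B are tangent to B. *)
definition adapted ::
  "('a, real^'m::finite) chart set \<Rightarrow> ('a, 'm) frame set
     \<Rightarrow> (('a, 'm) frame \<Rightarrow> ('a, 'm) frame_tvec \<Rightarrow> real^'m^'m) \<Rightarrow> bool" where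
  "adapted A B \<omega> \<longleftrightarrow>
     (\<forall>p\<in>B. {h \<in> tangent_space (frame_atlas A) p. \<omega> p h = 0} \<subseteq> tangent_of A B p)"

definition frame_at :: "('a, real^'m::finite) chart set \<Rightarrow> 'a \<Rightarrow> ('a, 'm) frame" where
  "frame_at A x = (SOME p. p \<in> frames A \<and> fst p = x)"

definition horizontal_lift ::
  "('a, real^'m::finite) chart set
     \<Rightarrow> (('a, 'm) frame \<Rightarrow> ('a, 'm) frame_tvec \<Rightarrow> real^'m^'m)
     \<Rightarrow> ('a, 'm) frame \<Rightarrow> ('a, real^'m) tvec \<Rightarrow> ('a, 'm) frame_tvec" where
  "horizontal_lift A \<omega> p v = (THE h. h \<in> tangent_space (frame_atlas A) p \<and> \<omega> p h = 0 \<and>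
     pushforward (frame_atlas A) A fst p h = v)"

(* A vector field Y corresponds to the equivariant function (y, w) \<mapsto> w^-1 (Y y) on FM; its
   covariant derivative in the direction v at x is u (h f), where u is any frame at x,
   h the horizontal lift of v to u, and f that function. *)
definition cov_deriv ::
  "('a, real^'m::finite) chart set
     \<Rightarrow> (('a, 'm) frame \<Rightarrow> ('a, 'm) frame_tvec \<Rightarrow> real^'m^'m)
     \<Rightarrow> 'a \<Rightarrow> ('a, real^'m) tvec \<Rightarrow> ('a \<Rightarrow> ('a, real^'m) tvec) \<Rightarrow> ('a, real^'m) tvec" where
  "cov_deriv A \<omega> x v Y = (let p = frame_at A x in
     snd p (dir_deriv (frame_atlas A) (\<lambda>q. inv (snd q) (Y (fst q))) p (horizontal_lift A \<omega> p v)))"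

(* The torsion tensor at x: the common value of
   cov_X Y - cov_Y X - [X, Y] at x for all smooth fields X, Y near x that extend v, w. *)
definition torsion ::
  "('a, real^'m::finite) chart set
     \<Rightarrow> (('a, 'm) frame \<Rightarrow> ('a, 'm) frame_tvec \<Rightarrow> real^'m^'m)
     \<Rightarrow> 'a \<Rightarrow> ('a, real^'m) tvec \<Rightarrow> ('a, real^'m) tvec \<Rightarrow> ('a, real^'m) tvec" where
  "torsion A \<omega> x v w = (THE t. \<forall>W X Y.
     x \<in> W \<and> smooth_vf A W X \<and> smooth_vf A W Y \<and> X x = v \<and> Y x = w \<longrightarrow>
     t = (\<lambda>c. cov_deriv A \<omega> x (X x) Y c - cov_deriv A \<omega> x (Y x) X c - lie_bracket A X Y x c))"

section \<open>Well-adapted connections\<close>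

(* Trace of an endomorphism E of the tangent space at x (computed in a frame). *)
definition end_trace ::
  "('a, real^'m::finite) chart set \<Rightarrow> 'a
     \<Rightarrow> (('a, real^'m) tvec \<Rightarrow> ('a, real^'m) tvec) \<Rightarrow> real" where
  "end_trace A x E =
     (let u = snd (frame_at A x) in trace (matrix (\<lambda>\<xi>. inv u (E (u \<xi>)))))"

(* Sections of ad B, as smooth fields of endomorphisms of the tangent spaces. *)
definition adjoint_section ::
  "('a, real^'m::finite) chart set \<Rightarrow> ('a, 'm) frame set \<Rightarrow> (real^'m^'m) set
     \<Rightarrow> ('a \<Rightarrow> ('a, real^'m) tvec \<Rightarrow> ('a, real^'m) tvec) \<Rightarrow> bool" where
  "adjoint_section A B \<gg> S \<longleftrightarrow>
     (\<forall>x\<in>carrier A. \<exists>u a. (x, u) \<in> B \<and> a \<in> \<gg> \<and>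
        (\<forall>v\<in>tangent_space A x. S x v = u (a *v inv u v))) \<and>
     (\<forall>W Y. smooth_vf A W Y \<longrightarrow> smooth_vf A W (\<lambda>x. S x (Y x)))"

definition well_adapted ::
  "('a, real^'m::finite) chart set \<Rightarrow> (real^'m^'m) set \<Rightarrow> ('a, 'm) frame set
     \<Rightarrow> (('a, 'm) frame \<Rightarrow> ('a, 'm) frame_tvec \<Rightarrow> real^'m^'m) \<Rightarrow> bool" where
  "well_adapted A \<gg> B \<omega> \<longleftrightarrow> linear_connection A \<omega> \<and> adapted A B \<omega> \<and>
     (\<forall>S X. adjoint_section A B \<gg> S \<and> smooth_vf A (carrier A) X \<longrightarrow>
        (\<forall>x\<in>carrier A. end_trace A x (\<lambda>v. S x (torsion A \<omega> x (X x) v)) = 0))"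

section \<open>Matrix Lie algebras\<close>

definition lie_algebra_of :: "(real^'m^'m) set \<Rightarrow> (real^'m::finite^'m) set" where
  "lie_algebra_of G = {vector_derivative \<gamma> (at 0) | \<gamma> \<epsilon>.
     \<epsilon> > 0 \<and> smooth_on {-\<epsilon><..<\<epsilon>} \<gamma> \<and> \<gamma> ` {-\<epsilon><..<\<epsilon>} \<subseteq> G \<and> \<gamma> 0 = mat 1}"

definition first_prolongation ::
  "(real^'m^'m) set \<Rightarrow> (real^'m::finite \<Rightarrow> real^'m^'m) set" where
  "first_prolongation \<gg> =
     {T. linear T \<and> range T \<subseteq> \<gg> \<and> (\<forall>u v. T u *v v - T v *v u = 0)}"

(* The coordinates of the 2n-dimensional space are indexed by the disjoint sum of two copies of
   the n-element index type. *)
definition block_diag :: "real^'n^'n \<Rightarrow> real^('n + 'n)^('n::finite + 'n)" where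
  "block_diag a = (\<chi> i j. case (i, j) of
       (Inl k, Inl l) \<Rightarrow> a $ k $ l
     | (Inr k, Inr l) \<Rightarrow> a $ k $ l
     | _ \<Rightarrow> 0)"

definition Delta_GL :: "(real^('n + 'n)^('n::finite + 'n)) set" where
  "Delta_GL = {block_diag a | a. invertible a}"

definition Delta_gl :: "(real^('n + 'n)^('n::finite + 'n)) set" where
  "Delta_gl = range block_diag"

end

theory Submission
  imports Defs
begin

text \<open>
  In a chart, a linear connection is an endomorphism-valued one-form \<open>\<Gamma>\<close>: its connection form at the frame with
  coordinates \<open>(y, M)\<close> is \<open>(\<xi>, N) \<mapsto> M\<^sup>-\<^sup>1 (N + \<Gamma> \<xi> M)\<close>.  A structure for the diagonal group is the same as the
  endomorphism fields \<open>J K = M K M\<^sup>-\<^sup>1\<close>, where \<open>M\<close> is a frame of the structure and \<open>K\<close> runs over the commutant of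
  the group, because the diagonal matrices are their own bicommutant.  The connection is adapted iff all
  \<open>J K\<close> are parallel, \<open>dJ + [\<Gamma>, J] = 0\<close>.  Together with the trace condition this is a linear system for \<open>\<Gamma>\<close> at each
  point, whose coefficients depend only on \<open>J\<close> and \<open>dJ\<close>, that is, on the 1-jet of the structure.  In a frame of the
  structure it becomes \<open>2 \<alpha> - swap \<alpha> = R\<close> for an operator \<open>swap\<close> with square 1, with the unique solution
  \<open>\<alpha> = (2 R + swap R) / 3\<close>.  Uniqueness makes the local solutions agree under changes of charts (by the symmetry of
  second derivatives), so they glue to a connection; bump functions reduce the trace condition for global sections to
  the pointwise one.
\<close>

section \<open>Smooth maps between normed spaces\<close>

text \<open>The definitions speak of forms on the frame bundle, curves inside a subbundle and
  functions on a quotient, while the equations to be solved are algebraic. The endomorphisms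
  \<open>J K\<close> link the two: being parallel is linear in \<Gamma> and mentions no chosen
  frame, so solutions found with different local frames can be compared. The origin of
  \<open>swap\<close>: identify the 2n-dimensional space with the tensor product of R^2 and R^n. A
  form with values in the diagonal algebra has two lower indices in R^n, one from its argument and
  one from its matrix. Exchanging the two arguments of \<Gamma> and then taking the partial trace
  over R^2 exchanges exactly these two indices. The 2 in the equation is the trace of the identity
  of R^2. As \<open>swap\<close> has only the eigenvalues 1 and -1, 2 - swap has only 1 and 3. With
  a single copy of R^n the operator would be 1 - swap, which is singular; that is the full linear
  group, whose prolongation does not vanish.\<close>

abbreviation FD :: "('a::real_normed_vector \<Rightarrow> 'b::real_normed_vector) \<Rightarrow> 'a \<Rightarrow> 'a \<Rightarrow> 'b" where
  "FD f x \<equiv> frechet_derivative f (at x)"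

lemma FD_eq: "(f has_derivative f') (at x) \<Longrightarrow> FD f x = f'"
  using frechet_derivative_at by metis

lemma FD_works: "f differentiable (at x) \<Longrightarrow> (f has_derivative FD f x) (at x)"
  by (simp add: frechet_derivative_works)

lemma has_derivative_cong_open:
  assumes "open S" "x \<in> S" "\<And>y. y \<in> S \<Longrightarrow> f y = g y"
  shows "(f has_derivative f') (at x) \<longleftrightarrow> (g has_derivative f') (at x)"
proof
  assume "(f has_derivative f') (at x)"
  then show "(g has_derivative f') (at x)"
    by (rule has_derivative_transform_within_open[OF _ assms(1,2)]) (simp add: assms(3))
next
  assume "(g has_derivative f') (at x)"
  then show "(f has_derivative f') (at x)"
    by (rule has_derivative_transform_within_open[OF _ assms(1,2)]) (simp add: assms(3))
qed

lemma FD_cong: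
  assumes "open S" "x \<in> S" "\<And>y. y \<in> S \<Longrightarrow> f y = g y"
  shows "FD f x = FD g x"
  unfolding frechet_derivative_def using has_derivative_cong_open[OF assms] by simp

lemma differentiable_cong:
  assumes "open S" "x \<in> S" "\<And>y. y \<in> S \<Longrightarrow> f y = g y"
  shows "f differentiable (at x) \<longleftrightarrow> g differentiable (at x)"
  unfolding differentiable_def using has_derivative_cong_open[OF assms] by simp

lemma FD_linear:
  assumes "f differentiable (at x)"
  shows "bounded_linear (FD f x)"
  using FD_works[OF assms] by (rule has_derivative_bounded_linear)

lemma FD_compose:
  assumes "f differentiable (at x)" "g differentiable (at (f x))"
  shows "FD (\<lambda>y. g (f y)) x v = FD g (f x) (FD f x v)"
  using FD_eq[OF diff_chain_at[OF FD_works[OF assms(1)] FD_works[OF assms(2)]]]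
  by (simp add: o_def)

lemma Ck_on_cong:
  assumes "open S" "\<And>x. x \<in> S \<Longrightarrow> f x = g x"
  shows "Ck_on k S f \<longleftrightarrow> Ck_on k S g"
  using assms(2)
proof (induction k arbitrary: f g)
  case 0 then show ?case by (simp cong: continuous_on_cong)
next
  case (Suc k)
  have "FD f x = FD g x" if "x \<in> S" for x using FD_cong[OF assms(1) that Suc.prems] .
  then have "Ck_on k S (\<lambda>x. FD f x v) \<longleftrightarrow> Ck_on k S (\<lambda>x. FD g x v)" for v
    by (intro Suc.IH) simp
  then show ?case using differentiable_cong[OF assms(1) _ Suc.prems] by simp
qed

lemma Ck_on_mono: "Ck_on k S f \<Longrightarrow> T \<subseteq> S \<Longrightarrow> Ck_on k T f"
  by (induction k arbitrary: f) (auto intro: continuous_on_subset)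

lemma Ck_on_imp_continuous_on: "Ck_on k S f \<Longrightarrow> continuous_on S f"
  by (cases k) (auto intro!: continuous_at_imp_continuous_on differentiable_imp_continuous_within)

lemma Ck_on_SucD: "Ck_on (Suc k) S f \<Longrightarrow> Ck_on k S f"
proof (induction k arbitrary: f)
  case 0 then show ?case using Ck_on_imp_continuous_on[of "Suc 0"] by simp
next
  case (Suc k) then show ?case by (metis Ck_on.simps(2))
qed

text \<open>The derivatives in \<open>Ck_on\<close> are taken in the whole space, so the condition
  can be checked near each point. This allows different formulas for one function on different parts
  of a chart.\<close>

lemma Ck_on_local:
  assumes "\<And>x. x \<in> S \<Longrightarrow> \<exists>T. open T \<and> x \<in> T \<and> Ck_on k T f"
  shows "Ck_on k S f"
  using assms
proof (induction k arbitrary: f)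
  case 0
  have "isCont f x" if "x \<in> S" for x
    using 0[OF that] by (auto simp: continuous_on_eq_continuous_at)
  then show ?case by (simp add: continuous_at_imp_continuous_on)
next
  case (Suc k)
  have "Ck_on k S (\<lambda>x. FD f x v)" for v
  proof (rule Suc.IH)
    fix x assume "x \<in> S"
    then obtain T where "open T" "x \<in> T" "Ck_on (Suc k) T f" using Suc.prems by blast
    then show "\<exists>T. open T \<and> x \<in> T \<and> Ck_on k T (\<lambda>x. FD f x v)" by auto
  qed
  moreover have "f differentiable (at x)" if "x \<in> S" for x
    using Suc.prems[OF that] by auto
  ultimately show ?case by simp
qed

lemma Ck_on_const: "Ck_on k S (\<lambda>x. c)"
  by (induction k arbitrary: c) auto

lemma Ck_on_bounded_linear: "bounded_linear f \<Longrightarrow> Ck_on k S f"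
  by (cases k)
    (auto simp: Ck_on_const bounded_linear_imp_differentiable
      FD_eq[OF bounded_linear_imp_has_derivative] intro: linear_continuous_on)

lemma Ck_on_add:
  assumes "open S" "Ck_on k S f" "Ck_on k S g"
  shows "Ck_on k S (\<lambda>x. f x + g x)"
  using assms(2,3)
proof (induction k arbitrary: f g)
  case 0 then show ?case by (auto intro: continuous_intros)
next
  case (Suc k)
  have "FD (\<lambda>x. f x + g x) x = (\<lambda>v. FD f x v + FD g x v)" if "x \<in> S" for x
    by (rule FD_eq) (use Suc.prems that in \<open>auto intro!: derivative_eq_intros FD_works\<close>)
  then have "Ck_on k S (\<lambda>x. FD (\<lambda>x. f x + g x) x v)" for v
    using Suc by (subst Ck_on_cong[OF assms(1), where g = "\<lambda>x. FD f x v + FD g x v"]) auto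
  then show ?case using Suc.prems by simp
qed

text \<open>The product rule gives two terms of the same bilinear shape with one derivative fewer,
  so the induction runs over all pairs of functions at once.\<close>

lemma Ck_on_bilinear:
  assumes "bounded_bilinear bil" "open S" "Ck_on k S f" "Ck_on k S g"
  shows "Ck_on k S (\<lambda>x. bil (f x) (g x))"
  using assms(3,4)
proof (induction k arbitrary: f g)
  case 0 then show ?case using bounded_bilinear.continuous_on[OF assms(1)] by auto
next
  case (Suc k)
  have hd: "((\<lambda>x. bil (f x) (g x)) has_derivative (\<lambda>v. bil (f x) (FD g x v) + bil (FD f x v) (g x))) (at x)"
    if "x \<in> S" for x
    using Suc.prems that by (intro bounded_bilinear.FDERIV[OF assms(1)] FD_works) auto
  have "Ck_on k S (\<lambda>x. bil (f x) (FD g x v) + bil (FD f x v) (g x))" for v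
    using Suc.prems Ck_on_SucD[OF Suc.prems(1)] Ck_on_SucD[OF Suc.prems(2)]
    by (intro Ck_on_add assms Suc.IH) auto
  then have "Ck_on k S (\<lambda>x. FD (\<lambda>x. bil (f x) (g x)) x v)" for v
    by (subst Ck_on_cong[OF assms(2)]) (auto simp: FD_eq[OF hd])
  then show ?case using hd by (auto simp: differentiable_def)
qed

lemma Ck_on_linear_compose:
  assumes "bounded_linear L" "open S" "Ck_on k S f"
  shows "Ck_on k S (\<lambda>x. L (f x))"
  using assms(3)
proof (induction k arbitrary: f)
  case 0 then show ?case using bounded_linear.continuous_on[OF assms(1)] by auto
next
  case (Suc k)
  have hd: "((\<lambda>x. L (f x)) has_derivative (\<lambda>v. L (FD f x v))) (at x)" if "x \<in> S" for x
    using Suc.prems that by (intro bounded_linear.has_derivative[OF assms(1)] FD_works) auto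
  have "Ck_on k S (\<lambda>x. FD (\<lambda>x. L (f x)) x v)" for v
    using Suc by (subst Ck_on_cong[OF assms(2)]) (auto simp: FD_eq[OF hd])
  then show ?case using hd by (auto simp: differentiable_def)
qed

lemma Ck_on_sum:
  assumes "open S" "\<And>i. i \<in> I \<Longrightarrow> Ck_on k S (f i)"
  shows "Ck_on k S (\<lambda>x. \<Sum>i\<in>I. f i x)"
  using assms(2)
  by (induction I rule: infinite_finite_induct) (auto simp: Ck_on_const Ck_on_add[OF assms(1)])

text \<open>\<open>Ck_on\<close> controls \<open>FD f x v\<close> only for a fixed direction v,
  whereas the chain rule inserts a direction that moves with the point. The expansion over a basis
  separates the two.\<close>

lemma FD_expand:
  fixes f :: "'a::euclidean_space \<Rightarrow> 'b::real_normed_vector"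
  assumes "f differentiable (at x)"
  shows "FD f x v = (\<Sum>i\<in>Basis. (v \<bullet> i) *\<^sub>R FD f x i)"
proof -
  interpret bounded_linear "FD f x" using FD_linear[OF assms] .
  have "FD f x v = FD f x (\<Sum>i\<in>Basis. (v \<bullet> i) *\<^sub>R i)" by (simp add: euclidean_representation)
  then show ?thesis by (simp add: sum scaleR)
qed

text \<open>By the chain rule and \<open>FD_expand\<close>, a derivative of the composition is a sum
  of components of the derivative of f times partial derivatives of g composed with f; the induction
  hypothesis applies to the latter.\<close>

lemma Ck_on_compose:
  fixes f :: "'a::real_normed_vector \<Rightarrow> 'b::euclidean_space" and g :: "'b \<Rightarrow> 'c::real_normed_vector"
  assumes "open S" "open T" "f ` S \<subseteq> T" "Ck_on k S f" "Ck_on k T g"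
  shows "Ck_on k S (\<lambda>x. g (f x))"
  using assms(4,5)
proof (induction k arbitrary: g)
  case 0 then show ?case using assms(3) by (auto intro: continuous_on_compose2)
next
  case (Suc k)
  have df: "f differentiable (at x)" "g differentiable (at (f x))" if "x \<in> S" for x
    using Suc.prems that assms(3) by auto
  have "FD (\<lambda>x. g (f x)) x v = (\<Sum>i\<in>Basis. (FD f x v \<bullet> i) *\<^sub>R FD g (f x) i)" if "x \<in> S" for x v
    unfolding FD_compose[OF df[OF that]] by (rule FD_expand[OF df(2)[OF that]])
  moreover have "Ck_on k S (\<lambda>x. \<Sum>i\<in>Basis. (FD f x v \<bullet> i) *\<^sub>R FD g (f x) i)" for v
  proof (intro Ck_on_sum assms(1) Ck_on_bilinear[OF bounded_bilinear_scaleR])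
    fix i :: 'b
    show "Ck_on k S (\<lambda>x. FD f x v \<bullet> i)"
      using Suc.prems(1) by (intro Ck_on_linear_compose[OF bounded_linear_inner_left] assms(1)) simp
    show "Ck_on k S (\<lambda>x. FD g (f x) i)"
      using Suc.prems(2) by (intro Suc.IH Ck_on_SucD[OF Suc.prems(1)]) simp
  qed
  ultimately have "Ck_on k S (\<lambda>x. FD (\<lambda>x. g (f x)) x v)" for v
    by (subst Ck_on_cong[OF assms(1)]) auto
  then show ?case using df differentiable_compose[of g f] by auto
qed

lemma smooth_on_cong:
  "open S \<Longrightarrow> (\<And>x. x \<in> S \<Longrightarrow> f x = g x) \<Longrightarrow> smooth_on S f \<longleftrightarrow> smooth_on S g"
  unfolding smooth_on_def using Ck_on_cong by blast

lemma smooth_on_mono: "smooth_on S f \<Longrightarrow> T \<subseteq> S \<Longrightarrow> smooth_on T f"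
  unfolding smooth_on_def using Ck_on_mono by blast

lemma smooth_on_continuous: "smooth_on S f \<Longrightarrow> continuous_on S f"
  unfolding smooth_on_def using Ck_on_imp_continuous_on by blast

lemma smooth_on_differentiable: "smooth_on S f \<Longrightarrow> x \<in> S \<Longrightarrow> f differentiable (at x)"
  unfolding smooth_on_def by (metis Ck_on.simps(2))

lemma smooth_on_local:
  assumes "\<And>x. x \<in> S \<Longrightarrow> \<exists>T. open T \<and> x \<in> T \<and> smooth_on T f"
  shows "smooth_on S f"
  using assms Ck_on_local unfolding smooth_on_def by metis

named_theorems smooth_intros

lemma smooth_on_const [smooth_intros]: "smooth_on S (\<lambda>x. c)"
  by (simp add: smooth_on_def Ck_on_const)

lemma smooth_on_bounded_linear: "bounded_linear f \<Longrightarrow> smooth_on S f"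
  by (simp add: smooth_on_def Ck_on_bounded_linear)

lemma smooth_on_ident [smooth_intros]: "smooth_on S (\<lambda>x. x)"
  by (rule smooth_on_bounded_linear) (rule bounded_linear_ident)

lemma smooth_on_fst_proj: "smooth_on S fst"
  by (rule smooth_on_bounded_linear) (rule bounded_linear_fst)

lemma smooth_on_snd_proj: "smooth_on S snd"
  by (rule smooth_on_bounded_linear) (rule bounded_linear_snd)

lemma smooth_on_add [smooth_intros]:
  "open S \<Longrightarrow> smooth_on S f \<Longrightarrow> smooth_on S g \<Longrightarrow> smooth_on S (\<lambda>x. f x + g x)"
  by (simp add: smooth_on_def Ck_on_add)

lemma smooth_on_bilinear:
  "bounded_bilinear p \<Longrightarrow> open S \<Longrightarrow> smooth_on S f \<Longrightarrow> smooth_on S g \<Longrightarrow> smooth_on S (\<lambda>x. p (f x) (g x))"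
  by (simp add: smooth_on_def Ck_on_bilinear)

lemma smooth_on_linear:
  "bounded_linear L \<Longrightarrow> open S \<Longrightarrow> smooth_on S f \<Longrightarrow> smooth_on S (\<lambda>x. L (f x))"
  by (simp add: smooth_on_def Ck_on_linear_compose)

lemmas smooth_on_scaleR [smooth_intros] = smooth_on_bilinear[OF bounded_bilinear_scaleR]
lemmas smooth_on_mult [smooth_intros] =
  smooth_on_bilinear[OF bounded_bilinear_mult[where 'a = "'c::real_normed_algebra"]] for f g
lemmas smooth_on_fst [smooth_intros] = smooth_on_linear[OF bounded_linear_fst]
lemmas smooth_on_snd [smooth_intros] = smooth_on_linear[OF bounded_linear_snd]
lemmas smooth_on_inner_left = smooth_on_linear[OF bounded_linear_inner_left]
lemmas smooth_on_nth [smooth_intros] = smooth_on_linear[OF bounded_linear_vec_nth]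

lemma smooth_on_minus [smooth_intros]: "open S \<Longrightarrow> smooth_on S f \<Longrightarrow> smooth_on S (\<lambda>x. - f x)"
  by (rule smooth_on_linear[OF bounded_linear_minus[OF bounded_linear_ident]])

lemma smooth_on_diff [smooth_intros]:
  "open S \<Longrightarrow> smooth_on S f \<Longrightarrow> smooth_on S g \<Longrightarrow> smooth_on S (\<lambda>x. f x - g x)"
  using smooth_on_add[of S f "\<lambda>x. - g x"] smooth_on_minus[of S g] by simp

lemma smooth_on_sum [smooth_intros]:
  "open S \<Longrightarrow> (\<And>i. i \<in> I \<Longrightarrow> smooth_on S (f i)) \<Longrightarrow> smooth_on S (\<lambda>x. \<Sum>i\<in>I. f i x)"
  by (simp add: smooth_on_def Ck_on_sum)

lemma smooth_on_prod [smooth_intros]: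
  fixes f :: "'i \<Rightarrow> 'a::real_normed_vector \<Rightarrow> real"
  assumes "open S" "\<And>i. i \<in> I \<Longrightarrow> smooth_on S (f i)"
  shows "smooth_on S (\<lambda>x. \<Prod>i\<in>I. f i x)"
  using assms(2)
  by (induction I rule: infinite_finite_induct) (auto intro!: smooth_intros assms(1))

lemma smooth_on_compose:
  fixes f :: "'a::real_normed_vector \<Rightarrow> 'b::euclidean_space"
  shows "open S \<Longrightarrow> open T \<Longrightarrow> f ` S \<subseteq> T \<Longrightarrow> smooth_on S f \<Longrightarrow> smooth_on T g \<Longrightarrow> smooth_on S (\<lambda>x. g (f x))"
  by (simp add: smooth_on_def Ck_on_compose)

lemma smooth_on_euclidean:
  fixes f :: "'a::real_normed_vector \<Rightarrow> 'b::euclidean_space"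
  assumes "open S" "\<And>i. i \<in> Basis \<Longrightarrow> smooth_on S (\<lambda>x. f x \<bullet> i)"
  shows "smooth_on S f"
proof -
  have "smooth_on S (\<lambda>x. \<Sum>i\<in>Basis. (f x \<bullet> i) *\<^sub>R i)"
    by (intro smooth_intros assms)
  then show ?thesis by (simp add: euclidean_representation)
qed

lemma smooth_on_vec [smooth_intros]:
  fixes f :: "'i::finite \<Rightarrow> 'a::real_normed_vector \<Rightarrow> 'b::euclidean_space"
  assumes "open S" "\<And>i. smooth_on S (f i)"
  shows "smooth_on S (\<lambda>x. \<chi> i. f i x)"
  by (rule smooth_on_euclidean[OF assms(1)])
    (auto simp: Basis_vec_def inner_axis smooth_on_inner_left[OF assms(1)] assms(2))

lemma smooth_on_Pair [smooth_intros]: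
  fixes f :: "'a::real_normed_vector \<Rightarrow> 'b::euclidean_space" and g :: "'a \<Rightarrow> 'c::euclidean_space"
  assumes "open S" "smooth_on S f" "smooth_on S g"
  shows "smooth_on S (\<lambda>x. (f x, g x))"
  by (rule smooth_on_euclidean[OF assms(1)])
    (auto simp: Basis_prod_def smooth_on_inner_left[OF assms(1)] assms(2,3))

lemma smooth_on_FD_const: "smooth_on S f \<Longrightarrow> smooth_on S (\<lambda>x. FD f x v)"
  unfolding smooth_on_def by (metis Ck_on.simps(2))

text \<open>The derivative of 1/f is built from 1/f and a derivative of f, so each order of
  differentiability of 1/f yields the next.\<close>

lemma smooth_on_inverse [smooth_intros]:
  fixes f :: "'a::real_normed_vector \<Rightarrow> real"
  assumes "open S" "smooth_on S f" "\<And>x. x \<in> S \<Longrightarrow> f x \<noteq> 0"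
  shows "smooth_on S (\<lambda>x. inverse (f x))"
proof -
  have "Ck_on k S (\<lambda>x. inverse (f x))" for k
  proof (induction k)
    case 0
    then show ?case using assms smooth_on_continuous by (auto intro!: continuous_intros)
  next
    case (Suc k)
    have hd: "((\<lambda>x. inverse (f x)) has_derivative (\<lambda>v. - (inverse (f x) * FD f x v * inverse (f x)))) (at x)"
      if "x \<in> S" for x
      by (rule Deriv.has_derivative_inverse[where f = f, OF assms(3)[OF that]])
        (use assms(2) smooth_on_differentiable that FD_works in blast)
    have "Ck_on k S (\<lambda>x. (-1) *\<^sub>R (inverse (f x) * FD f x v * inverse (f x)))" for v
      using Suc smooth_on_FD_const[OF assms(2), of v]
      by (intro Ck_on_bilinear[OF bounded_bilinear_mult] Ck_on_linear_compose[OF bounded_linear_scaleR_right] assms(1))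
        (auto simp: smooth_on_def)
    then have "Ck_on k S (\<lambda>x. FD (\<lambda>x. inverse (f x)) x v)" for v
      by (subst Ck_on_cong[OF assms(1)]) (auto simp: FD_eq[OF hd])
    then show ?case using hd by (auto simp: differentiable_def)
  qed
  then show ?thesis by (simp add: smooth_on_def)
qed

section \<open>Symmetry of second derivatives\<close>

text \<open>Both mixed derivatives are limits of the same second difference quotient.\<close>

lemma second_difference:
  fixes f :: "'a::real_normed_vector \<Rightarrow> real"
  assumes "open S" "Ck_on 2 S f" "h > 0"
    and sub: "\<And>s t. 0 \<le> s \<Longrightarrow> s \<le> h \<Longrightarrow> 0 \<le> t \<Longrightarrow> t \<le> h \<Longrightarrow> x + s *\<^sub>R v + t *\<^sub>R w \<in> S"
  shows "\<exists>s t. 0 < s \<and> s < h \<and> 0 < t \<and> t < h \<and>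
     f (x + h *\<^sub>R v + h *\<^sub>R w) - f (x + h *\<^sub>R v) - f (x + h *\<^sub>R w) + f x
       = h * h * FD (\<lambda>y. FD f y v) (x + s *\<^sub>R v + t *\<^sub>R w) w"
proof -
  have d1: "f differentiable (at y)" "(\<lambda>y. FD f y v) differentiable (at y)" if "y \<in> S" for y
    using assms(2) that by (auto simp: numeral_2_eq_2)
  have hd: "((\<lambda>s. F (a + s *\<^sub>R u)) has_real_derivative FD F (a + s *\<^sub>R u) u) (at s)"
    if "F differentiable (at (a + s *\<^sub>R u))" for F :: "'a \<Rightarrow> real" and a u s
  proof -
    have "((\<lambda>s. a + s *\<^sub>R u) has_derivative (\<lambda>t. t *\<^sub>R u)) (at s)"
      by (auto intro!: derivative_eq_intros)
    from diff_chain_at[OF this FD_works[OF that]]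
    have "((\<lambda>s. F (a + s *\<^sub>R u)) has_derivative (\<lambda>t. FD F (a + s *\<^sub>R u) (t *\<^sub>R u))) (at s)"
      by (simp add: o_def)
    moreover have "(\<lambda>t. FD F (a + s *\<^sub>R u) (t *\<^sub>R u)) = (*) (FD F (a + s *\<^sub>R u) u)"
      using linear_cmul[OF bounded_linear.linear[OF FD_linear[OF that]]] by (auto simp: mult.commute)
    ultimately show ?thesis by (simp add: has_field_derivative_def)
  qed
  \<comment> \<open>The second difference is the increment of p over [0, h]. The mean value theorem
    is applied once to p, in direction v, and once to the resulting first derivative, in direction
    w.\<close>
  define p where "p s = f ((x + h *\<^sub>R w) + s *\<^sub>R v) - f (x + s *\<^sub>R v)" for s
  define p' where "p' s = FD f ((x + h *\<^sub>R w) + s *\<^sub>R v) v - FD f (x + s *\<^sub>R v) v" for s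
  have "(p has_real_derivative p' s) (at s)" if "0 \<le> s" "s \<le> h" for s
    unfolding p_def p'_def using sub[of s h] sub[of s 0] that assms(3)
    by (intro DERIV_diff hd d1) (auto simp: add_ac)
  then obtain s where s: "0 < s" "s < h" "p h - p 0 = (h - 0) * p' s"
    using MVT2[of 0 h p p'] assms(3) by auto
  have "((\<lambda>t. FD f ((x + s *\<^sub>R v) + t *\<^sub>R w) v) has_real_derivative
      FD (\<lambda>y. FD f y v) ((x + s *\<^sub>R v) + t *\<^sub>R w) w) (at t)" if "0 \<le> t" "t \<le> h" for t
    using sub[of s t] that s by (intro hd d1) auto
  then obtain t where t: "0 < t" "t < h"
    "FD f ((x + s *\<^sub>R v) + h *\<^sub>R w) v - FD f ((x + s *\<^sub>R v) + 0 *\<^sub>R w) v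
      = (h - 0) * FD (\<lambda>y. FD f y v) ((x + s *\<^sub>R v) + t *\<^sub>R w) w"
    using MVT2[of 0 h "\<lambda>t. FD f ((x + s *\<^sub>R v) + t *\<^sub>R w) v"
        "\<lambda>t. FD (\<lambda>y. FD f y v) ((x + s *\<^sub>R v) + t *\<^sub>R w) w"] assms(3) by blast
  have "p' s = h * FD (\<lambda>y. FD f y v) ((x + s *\<^sub>R v) + t *\<^sub>R w) w"
    using t(3) by (simp add: p'_def add_ac)
  then have "p h - p 0 = h * h * FD (\<lambda>y. FD f y v) ((x + s *\<^sub>R v) + t *\<^sub>R w) w"
    using s by simp
  then show ?thesis
    using s t by (intro exI[of _ s] exI[of _ t]) (simp add: p_def add_ac)
qed

lemma FD_symmetric_real:
  fixes f :: "'a::real_normed_vector \<Rightarrow> real"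
  assumes "open S" "Ck_on 2 S f" "x \<in> S"
  shows "FD (\<lambda>y. FD f y v) x w = FD (\<lambda>y. FD f y w) x v"
proof (rule ccontr)
  define A where "A = (\<lambda>y. FD (\<lambda>y. FD f y v) y w)"
  define B where "B = (\<lambda>y. FD (\<lambda>y. FD f y w) y v)"
  assume "\<not> ?thesis"
  then have ne: "A x \<noteq> B x" by (simp add: A_def B_def)
  \<comment> \<open>Half the gap: two errors below e cannot bridge the distance between the two
    values.\<close>
  define e where "e = \<bar>A x - B x\<bar> / 2"
  have e: "e > 0" using ne by (simp add: e_def)
  have "continuous_on S A" "continuous_on S B"
    using assms(2) unfolding A_def B_def numeral_2_eq_2 by auto
  then have "isCont A x" "isCont B x" using assms continuous_on_eq_continuous_at by auto
  then obtain d1 d2 where d12: "d1 > 0" "\<And>y. dist y x < d1 \<Longrightarrow> dist (A y) (A x) < e"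
    "d2 > 0" "\<And>y. dist y x < d2 \<Longrightarrow> dist (B y) (B x) < e"
    unfolding continuous_at_eps_delta using e by metis
  obtain d3 where d3: "d3 > 0" "ball x d3 \<subseteq> S" using assms open_contains_ball by blast
  define r where "r = min d1 (min d2 d3)"
  have r: "r > 0" using d12 d3 by (simp add: r_def)
  \<comment> \<open>With this step all points of the parallelogram lie within r/2 of x. The summand
    1 keeps the denominator positive when v and w vanish.\<close>
  define h where "h = r / (2 * (norm v + norm w + 1))"
  have nn: "norm v + norm w + 1 > 0"
    using norm_ge_zero[of v] norm_ge_zero[of w] by linarith
  have h: "h > 0" using r nn by (simp add: h_def)
  have near: "dist (x + s *\<^sub>R v + t *\<^sub>R w) x < r" if "0 \<le> s" "s \<le> h" "0 \<le> t" "t \<le> h" for s t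
  proof -
    have "norm (s *\<^sub>R v + t *\<^sub>R w) \<le> s * norm v + t * norm w"
      using that norm_triangle_ineq[of "s *\<^sub>R v" "t *\<^sub>R w"] by simp
    also have "\<dots> \<le> h * norm v + h * norm w"
      using that by (intro add_mono mult_right_mono) auto
    also have "\<dots> \<le> h * (norm v + norm w + 1)" using h by (simp add: algebra_simps)
    also have "\<dots> = r / 2" using nn by (simp add: h_def divide_simps)
    also have "\<dots> < r" using r by simp
    finally show ?thesis by (simp add: dist_norm add.assoc)
  qed
  have sub: "x + s *\<^sub>R v + t *\<^sub>R w \<in> S" if "0 \<le> s" "s \<le> h" "0 \<le> t" "t \<le> h" for s t
  proof -
    have "dist x (x + s *\<^sub>R v + t *\<^sub>R w) < d3"
      using near[OF that] by (simp add: r_def dist_commute)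
    then show ?thesis using d3(2) by (auto simp: subset_eq)
  qed
  obtain s t where st: "0 < s" "s < h" "0 < t" "t < h"
    "f (x + h *\<^sub>R v + h *\<^sub>R w) - f (x + h *\<^sub>R v) - f (x + h *\<^sub>R w) + f x = h * h * A (x + s *\<^sub>R v + t *\<^sub>R w)"
    using second_difference[OF assms(1,2) h sub] unfolding A_def by blast
  have sub': "x + s *\<^sub>R w + t *\<^sub>R v \<in> S" if "0 \<le> s" "s \<le> h" "0 \<le> t" "t \<le> h" for s t
    using sub[of t s] that by (simp add: add_ac)
  obtain s' t' where st': "0 < s'" "s' < h" "0 < t'" "t' < h"
    "f (x + h *\<^sub>R w + h *\<^sub>R v) - f (x + h *\<^sub>R w) - f (x + h *\<^sub>R v) + f x = h * h * B (x + s' *\<^sub>R w + t' *\<^sub>R v)"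
    using second_difference[OF assms(1,2) h sub'] unfolding B_def by blast
  have "h * h * A (x + s *\<^sub>R v + t *\<^sub>R w) = h * h * B (x + s' *\<^sub>R w + t' *\<^sub>R v)"
  proof -
    have e: "x + h *\<^sub>R w + h *\<^sub>R v = x + h *\<^sub>R v + h *\<^sub>R w" by (simp add: add_ac)
    show ?thesis using st(5) st'(5)[unfolded e] by linarith
  qed
  then have "A (x + s *\<^sub>R v + t *\<^sub>R w) = B (x + s' *\<^sub>R w + t' *\<^sub>R v)"
    using h by simp
  then have eq: "A (x + s *\<^sub>R v + t *\<^sub>R w) = B (x + t' *\<^sub>R v + s' *\<^sub>R w)"
    by (simp add: add_ac)
  have "dist (A (x + s *\<^sub>R v + t *\<^sub>R w)) (A x) < e"
    using near[of s t] st by (intro d12) (simp add: r_def)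
  moreover have "dist (B (x + t' *\<^sub>R v + s' *\<^sub>R w)) (B x) < e"
    using near[of t' s'] st' by (intro d12) (simp add: r_def)
  ultimately have "\<bar>A x - B x\<bar> < 2 * e" using eq unfolding dist_real_def by linarith
  then show False by (simp add: e_def)
qed

lemma FD_inner:
  assumes "f differentiable (at x)"
  shows "FD (\<lambda>y. f y \<bullet> i) x v = FD f x v \<bullet> i"
  using FD_eq[OF bounded_linear.has_derivative[OF bounded_linear_inner_left FD_works[OF assms], of i]] by simp

lemma FD_symmetric:
  fixes f :: "'a::real_normed_vector \<Rightarrow> 'b::euclidean_space"
  assumes "open S" "smooth_on S f" "x \<in> S"
  shows "FD (\<lambda>y. FD f y v) x w = FD (\<lambda>y. FD f y w) x v"
proof (rule euclidean_eqI)
  fix i :: 'b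
  have "FD (\<lambda>y. FD f y v) x w \<bullet> i = FD (\<lambda>y. FD (\<lambda>z. f z \<bullet> i) y v) x w" for v w
  proof -
    have "FD (\<lambda>y. FD f y v) x w \<bullet> i = FD (\<lambda>y. FD f y v \<bullet> i) x w"
      by (rule FD_inner[symmetric]) (use smooth_on_differentiable smooth_on_FD_const assms in blast)
    also have "\<dots> = FD (\<lambda>y. FD (\<lambda>z. f z \<bullet> i) y v) x w"
      by (subst FD_cong[OF assms(1,3)]) (auto simp: FD_inner smooth_on_differentiable[OF assms(2)])
    finally show ?thesis .
  qed
  moreover have "Ck_on 2 S (\<lambda>z. f z \<bullet> i)"
    using smooth_on_inner_left[OF assms(1,2), of i] by (simp add: smooth_on_def)
  ultimately show "FD (\<lambda>y. FD f y v) x w \<bullet> i = FD (\<lambda>y. FD f y w) x v \<bullet> i"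
    using FD_symmetric_real[OF assms(1) _ assms(3)] by metis
qed

section \<open>Matrices\<close>

lemma bounded_bilinear_matrix_mult:
  "bounded_bilinear ((**) :: real^'n::finite^'m::finite \<Rightarrow> real^'p::finite^'n \<Rightarrow> real^'p^'m)"
  unfolding bilinear_conv_bounded_bilinear[symmetric] bilinear_def
  by (auto intro!: linearI simp: matrix_matrix_mult_def vec_eq_iff sum.distrib sum_distrib_left algebra_simps)

lemma bounded_bilinear_matrix_vector_mult:
  "bounded_bilinear ((*v) :: real^'n::finite^'m::finite \<Rightarrow> real^'n \<Rightarrow> real^'m)"
  unfolding bilinear_conv_bounded_bilinear[symmetric] bilinear_def
  by (auto intro!: linearI simp: matrix_vector_mult_def vec_eq_iff sum.distrib sum_distrib_left algebra_simps)

interpretation mm: bounded_bilinear "(**) :: real^'n::finite^'m::finite \<Rightarrow> real^'p::finite^'n \<Rightarrow> real^'p^'m"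
  by (rule bounded_bilinear_matrix_mult)

interpretation mv: bounded_bilinear "(*v) :: real^'n::finite^'m::finite \<Rightarrow> real^'n \<Rightarrow> real^'m"
  by (rule bounded_bilinear_matrix_vector_mult)

lemmas mm_distrib = mm.add_left mm.add_right mm.diff_left mm.diff_right mm.minus_left mm.minus_right
lemmas mv_distrib = mv.add_left mv.add_right mv.diff_left mv.diff_right mv.minus_left mv.minus_right

lemmas smooth_on_matrix_mult [smooth_intros] = smooth_on_bilinear[OF bounded_bilinear_matrix_mult]
lemmas smooth_on_matrix_vector_mult [smooth_intros] = smooth_on_bilinear[OF bounded_bilinear_matrix_vector_mult]

lemma matrix_inv:
  fixes A :: "real^'n::finite^'n"
  assumes "invertible A"
  shows "A ** matrix_inv A = mat 1" "matrix_inv A ** A = mat 1"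
  using someI_ex[OF assms[unfolded invertible_def]] unfolding matrix_inv_def by auto

lemma matrix_inv_cancel:
  fixes A :: "real^'n::finite^'n" and B :: "real^'m::finite^'n" and C :: "real^'n^'m"
  assumes "invertible A"
  shows "A ** (matrix_inv A ** B) = B" "matrix_inv A ** (A ** B) = B"
    "C ** A ** matrix_inv A = C" "C ** matrix_inv A ** A = C"
  by (simp_all add: matrix_mul_assoc matrix_inv[OF assms])
    (simp_all add: matrix_mul_assoc[symmetric] matrix_inv[OF assms])

lemma matrix_inv_vector_cancel:
  fixes A :: "real^'n::finite^'n"
  assumes "invertible A"
  shows "A *v (matrix_inv A *v x) = x" "matrix_inv A *v (A *v x) = x"
  by (simp_all add: matrix_vector_mul_assoc matrix_inv[OF assms])

lemma matrix_inv_unique: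
  fixes A :: "real^'n::finite^'n"
  assumes "A ** B = mat 1"
  shows "invertible A" "matrix_inv A = B"
proof -
  show inv: "invertible A"
    using assms matrix_left_right_inverse unfolding invertible_def by blast
  have "matrix_inv A ** (A ** B) = matrix_inv A" using assms by simp
  then show "matrix_inv A = B" by (simp add: matrix_inv_cancel[OF inv])
qed

lemma invertible_mat_1: "invertible (mat 1 :: real^'n::finite^'n)"
  by (rule matrix_inv_unique(1)[of _ "mat 1"]) simp

lemma matrix_inv_mult:
  fixes A B :: "real^'n::finite^'n"
  assumes "invertible A" "invertible B"
  shows "matrix_inv (A ** B) = matrix_inv B ** matrix_inv A"
  by (rule matrix_inv_unique)
    (simp add: matrix_mul_assoc matrix_inv_cancel[OF assms(2)] matrix_inv[OF assms(1)])

lemma matrix_inv_mat_1: "matrix_inv (mat 1 :: real^'n::finite^'n) = mat 1"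
  by (rule matrix_inv_unique) simp

lemma matrix_ext: "(\<And>x. A *v x = B *v x) \<Longrightarrow> A = (B :: real^'n::finite^'m::finite)"
  using matrix_eq by blast

lemma open_invertible: "open {A :: real^'n::finite^'n. invertible A}"
proof -
  have "continuous_on UNIV (det :: real^'n^'n \<Rightarrow> real)"
    unfolding det_def by (intro continuous_intros)
  then have "open (det -` (- {0}) :: (real^'n^'n) set)"
    by (intro open_vimage) auto
  moreover have "det -` (- {0}) = {A :: real^'n^'n. invertible A}"
    by (auto simp: invertible_det_nz)
  ultimately show ?thesis by simp
qed

lemma smooth_on_det:
  fixes f :: "'a::real_normed_vector \<Rightarrow> real^'n::finite^'n"
  assumes "open S" "smooth_on S f"
  shows "smooth_on S (\<lambda>x. det (f x))"
  unfolding det_def by (intro smooth_intros assms)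

text \<open>Cramer's rule with the coordinate axes as right-hand sides. Every entry is a polynomial
  in the entries of A divided by the determinant, which makes inversion smooth.\<close>

lemma matrix_inv_cramer:
  fixes A :: "real^'n::finite^'n"
  assumes "invertible A"
  shows "matrix_inv A = (\<chi> k l. det (\<chi> i j. if j = k then axis l 1 $ i else A $ i $ j) * inverse (det A))"
proof -
  have "matrix_inv A $ k $ l = (matrix_inv A *v axis l 1) $ k" for k l
    by (simp add: matrix_vector_mul_component inner_axis)
  moreover have "matrix_inv A *v axis l 1 = (\<chi> k. det (\<chi> i j. if j = k then axis l 1 $ i else A $ i $ j) / det A)" for l
    using cramer[of A "matrix_inv A *v axis l 1" "axis l 1"] assms
    by (simp add: invertible_det_nz[symmetric] matrix_inv_vector_cancel)
  ultimately show ?thesis by (simp add: vec_eq_iff divide_inverse)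
qed

lemma smooth_on_matrix_inv [smooth_intros]:
  fixes f :: "'a::real_normed_vector \<Rightarrow> real^'n::finite^'n"
  assumes "open S" "smooth_on S f" "\<And>x. x \<in> S \<Longrightarrow> invertible (f x)"
  shows "smooth_on S (\<lambda>x. matrix_inv (f x))"
proof -
  have "smooth_on S (\<lambda>x. if j = k then axis l 1 $ i else f x $ i $ j)" for i j k l
    by (cases "j = k") (auto intro!: smooth_intros assms)
  then have "smooth_on S (\<lambda>x. \<chi> k l. det (\<chi> i j. if j = k then axis l 1 $ i else f x $ i $ j) * inverse (det (f x)))"
    using assms by (intro smooth_intros smooth_on_det) (auto simp: invertible_det_nz[symmetric])
  then show ?thesis
    using assms by (subst smooth_on_cong[OF assms(1)]) (auto simp: matrix_inv_cramer)
qed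

section \<open>Exchange of the two arguments of an endomorphism-valued form\<close>

text \<open>For Christoffel symbols this is the exchange of the two lower indices.\<close>

definition flip :: "(real^'n::finite \<Rightarrow> real^'n^'n) \<Rightarrow> real^'n \<Rightarrow> real^'n^'n" where
  "flip \<Gamma> \<xi> = matrix (\<lambda>\<eta>. \<Gamma> \<eta> *v \<xi>)"

lemma linear_apply: "linear \<Gamma> \<Longrightarrow> linear (\<lambda>\<eta>. \<Gamma> \<eta> *v \<xi>)"
  for \<Gamma> :: "real^'n::finite \<Rightarrow> real^'n^'n"
  by (rule linearI) (simp_all add: linear_add linear_cmul mv_distrib mv.scaleR_left)

lemma flip_apply: "linear \<Gamma> \<Longrightarrow> flip \<Gamma> \<xi> *v \<eta> = \<Gamma> \<eta> *v \<xi>"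
  unfolding flip_def by (simp add: matrix_works linear_apply)

lemma flip_nth: "flip \<Gamma> \<xi> $ i $ j = (\<Gamma> (axis j 1) *v \<xi>) $ i"
  by (simp add: flip_def matrix_def)

lemma linear_flip: "linear (flip \<Gamma>)"
  by (rule linearI) (simp_all add: vec_eq_iff flip_nth mv_distrib mv.scaleR_right)

lemma flip_diff: "flip (\<lambda>u. A u - B u) \<xi> = flip A \<xi> - flip B \<xi>"
  by (simp add: vec_eq_iff flip_nth mv_distrib)

text \<open>A change of basis acts in the same way on both lower indices and therefore commutes with
  their exchange.\<close>

lemma flip_conj:
  assumes "linear \<Gamma>" "invertible s"
  shows "flip (\<lambda>u. matrix_inv s ** \<Gamma> (s *v u) ** s) u = matrix_inv s ** flip \<Gamma> (s *v u) ** s"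
proof (rule matrix_ext)
  fix x
  have "linear (\<lambda>u. matrix_inv s ** \<Gamma> (s *v u) ** s)"
    by (rule linearI) (simp_all add: linear_add[OF assms(1)] linear_cmul[OF assms(1)] mv_distrib mm_distrib
        mv.scaleR_right mm.scaleR_right mm.scaleR_left)
  then show "flip (\<lambda>u. matrix_inv s ** \<Gamma> (s *v u) ** s) u *v x = (matrix_inv s ** flip \<Gamma> (s *v u) ** s) *v x"
    by (simp add: flip_apply assms(1) matrix_vector_mul_assoc[symmetric])
qed

lemma trace_conj:
  fixes s X :: "real^'n::finite^'n"
  assumes "invertible s"
  shows "trace (matrix_inv s ** X ** s) = trace X"
  using trace_mul_sym[of "matrix_inv s ** X" s] by (simp add: matrix_inv_cancel[OF assms])

lemma linear_expand_axis:
  fixes f :: "real^'n::finite \<Rightarrow> 'b::real_vector"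
  assumes "linear f"
  shows "f u = (\<Sum>i\<in>UNIV. (u $ i) *\<^sub>R f (axis i 1))"
proof -
  have "f u = f (\<Sum>i\<in>UNIV. (u $ i) *\<^sub>R axis i 1)"
    using basis_expansion[of u] by (simp add: scalar_mult_eq_scaleR)
  then show ?thesis by (simp add: linear_sum[OF assms] linear_cmul[OF assms])
qed

section \<open>The diagonal group and its commutant\<close>

lemma sum_UNIV_plus:
  "(\<Sum>i\<in>(UNIV :: ('a::finite + 'b::finite) set). f i) = (\<Sum>i\<in>UNIV. f (Inl i)) + (\<Sum>i\<in>UNIV. f (Inr i))"
  for f :: "_ \<Rightarrow> 'c::comm_monoid_add"
  unfolding UNIV_Plus_UNIV[symmetric] by (subst sum.Plus) auto

lemma block_diag_nth [simp]:
  "block_diag a $ Inl k $ Inl l = a $ k $ l" "block_diag a $ Inr k $ Inr l = a $ k $ l"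
  "block_diag a $ Inl k $ Inr l = 0" "block_diag a $ Inr k $ Inl l = 0"
  by (simp_all add: block_diag_def)

lemma plus_mat_eqI:
  fixes A B :: "real^('n::finite + 'n)^('n + 'n)"
  assumes "\<And>k l. A $ Inl k $ Inl l = B $ Inl k $ Inl l" "\<And>k l. A $ Inl k $ Inr l = B $ Inl k $ Inr l"
    "\<And>k l. A $ Inr k $ Inl l = B $ Inr k $ Inl l" "\<And>k l. A $ Inr k $ Inr l = B $ Inr k $ Inr l"
  shows "A = B"
  unfolding vec_eq_iff using assms by (metis sum.exhaust)

lemma linear_block_diag: "linear block_diag"
  by (rule linearI; rule plus_mat_eqI) auto

lemma block_diag_mult: "block_diag a ** block_diag b = block_diag (a ** b)"
  by (rule plus_mat_eqI) (simp_all add: matrix_matrix_mult_def sum_UNIV_plus)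

lemma block_diag_mat_1: "block_diag (mat 1) = mat 1"
  by (rule plus_mat_eqI) (simp_all add: mat_def)

lemma block_diag_inverse:
  assumes "invertible a"
  shows "invertible (block_diag a)" "matrix_inv (block_diag a) = block_diag (matrix_inv a)"
proof -
  have "block_diag a ** block_diag (matrix_inv a) = mat 1"
    by (simp add: block_diag_mult matrix_inv[OF assms] block_diag_mat_1)
  then show "invertible (block_diag a)" "matrix_inv (block_diag a) = block_diag (matrix_inv a)"
    by (rule matrix_inv_unique)+
qed

lemma Delta_GL_invertible: "g \<in> Delta_GL \<Longrightarrow> invertible g"
  unfolding Delta_GL_def using block_diag_inverse by auto

lemma Delta_GL_one: "mat 1 \<in> Delta_GL"
  unfolding Delta_GL_def
  by (rule CollectI, rule exI[of _ "mat 1"]) (simp add: block_diag_mat_1 invertible_mat_1)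

text \<open>With the 2n-dimensional space written as the tensor product of R^2 and R^n, these are
  the 2 by 2 matrices acting on the first factor.\<close>

definition commutant :: "(real^('n + 'n)^('n::finite + 'n)) set" where
  "commutant = {K. \<forall>a. K ** block_diag a = block_diag a ** K}"

lemma commutant_commutes:
  "K \<in> commutant \<Longrightarrow> a \<in> Delta_gl \<Longrightarrow> K ** a = a ** K"
  "K \<in> commutant \<Longrightarrow> g \<in> Delta_GL \<Longrightarrow> K ** g = g ** K"
  unfolding commutant_def Delta_gl_def Delta_GL_def by auto

text \<open>Two elements of the commutant suffice. Commuting with the projection P onto the first
  copy of R^n kills the off-diagonal blocks; commuting with the exchange Q of the two copies makes
  the diagonal blocks equal.\<close>

lemma Delta_gl_bicommutant:
  fixes a :: "real^('n::finite + 'n)^('n + 'n)"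
  assumes "\<And>K. K \<in> commutant \<Longrightarrow> K ** a = a ** K"
  shows "a \<in> Delta_gl"
proof -
  define P :: "real^('n + 'n)^('n + 'n)" where
    "P = (\<chi> i j. case (i, j) of (Inl k, Inl l) \<Rightarrow> if k = l then 1 else 0 | _ \<Rightarrow> 0)"
  define Q :: "real^('n + 'n)^('n + 'n)" where
    "Q = (\<chi> i j. case (i, j) of (Inl k, Inr l) \<Rightarrow> if k = l then 1 else 0
       | (Inr k, Inl l) \<Rightarrow> if k = l then 1 else 0 | _ \<Rightarrow> 0)"
  have delta: "(\<Sum>i\<in>UNIV. (if k = i then 1 else 0) * f i) = f k"
    "(\<Sum>i\<in>UNIV. f i * (if i = k then 1 else 0)) = f k" for f :: "'n \<Rightarrow> real" and k
    by (simp_all add: if_distrib if_distribR cong: if_cong)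
  have "P ** block_diag b = block_diag b ** P" "Q ** block_diag b = block_diag b ** Q" for b
    by (rule plus_mat_eqI; simp add: matrix_matrix_mult_def sum_UNIV_plus delta P_def Q_def)+
  then have "P \<in> commutant" "Q \<in> commutant"
    unfolding commutant_def by auto
  then have P: "P ** a = a ** P" and Q: "Q ** a = a ** Q" using assms by auto
  have "a $ Inl k $ Inr l = 0" "a $ Inr k $ Inl l = 0" for k l
    using arg_cong[OF P, of "\<lambda>m. m $ Inl k $ Inr l"] arg_cong[OF P, of "\<lambda>m. m $ Inr k $ Inl l"]
    by (simp_all add: P_def matrix_matrix_mult_def sum_UNIV_plus delta)
  moreover have "a $ Inl k $ Inl l = a $ Inr k $ Inr l" for k l
    using arg_cong[OF Q, of "\<lambda>m. m $ Inl k $ Inr l"]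
    by (simp add: Q_def matrix_matrix_mult_def sum_UNIV_plus delta)
  ultimately have "a = block_diag (\<chi> k l. a $ Inl k $ Inl l)"
    by (intro plus_mat_eqI) auto
  then show ?thesis unfolding Delta_gl_def by blast
qed

lemma Delta_gl_iff: "a \<in> Delta_gl \<longleftrightarrow> (\<forall>K\<in>commutant. a ** K = K ** a)"
  using Delta_gl_bicommutant[of a] commutant_commutes(1)[of _ a] by auto

section \<open>The partial trace and the involution behind the trace condition\<close>

text \<open>The partial trace over the factor R^2; it is the adjoint of \<open>block_diag\<close>
  for the trace pairing.\<close>

definition block_trace :: "real^('n + 'n)^('n::finite + 'n) \<Rightarrow> real^'n^'n" where
  "block_trace X = (\<chi> a b. X $ Inl a $ Inl b + X $ Inr a $ Inr b)"

lemma linear_block_trace: "linear block_trace"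
  by (rule linearI) (simp_all add: block_trace_def vec_eq_iff algebra_simps)

lemma trace_block_diag_mult:
  "trace (block_diag S ** X) = (\<Sum>i\<in>UNIV. \<Sum>j\<in>UNIV. S $ i $ j * block_trace X $ j $ i)"
  by (simp add: trace_def matrix_matrix_mult_def sum_UNIV_plus block_trace_def sum.distrib algebra_simps)

text \<open>Pairing with the diagonal algebra sees only the partial trace of X, and the trace form
  on n by n matrices is nondegenerate.\<close>

lemma trace_Delta_gl_eq_0_iff:
  "(\<forall>S\<in>Delta_gl. trace (S ** X) = 0) \<longleftrightarrow> block_trace X = 0"
proof
  assume *: "\<forall>S\<in>Delta_gl. trace (S ** X) = 0"
  have "block_trace X $ a $ b = 0" for a b
  proof -
    \<comment> \<open>The matrix unit with its 1 in row b and column a reads off the entry (a,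
      b).\<close>
    let ?S = "\<chi> i j. (if i = b then 1 else 0) * (if j = a then 1 else 0) :: real^'a^'a"
    have "0 = trace (block_diag ?S ** X)" using * by (simp add: Delta_gl_def)
    also have "\<dots> = (\<Sum>i\<in>UNIV. \<Sum>j\<in>UNIV. if i = b then (if j = a then block_trace X $ j $ i else 0) else 0)"
      unfolding trace_block_diag_mult by (intro sum.cong) auto
    also have "\<dots> = (\<Sum>i\<in>UNIV. if i = b then block_trace X $ a $ i else 0)"
      by (rule sum.cong) auto
    also have "\<dots> = block_trace X $ a $ b"
      by simp
    finally show ?thesis by simp
  qed
  then show "block_trace X = 0" by (simp add: vec_eq_iff)
qed (auto simp: Delta_gl_def trace_block_diag_mult)

lemma block_trace_block_diag: "block_trace (block_diag a) = 2 *\<^sub>R a"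
  by (simp add: block_trace_def vec_eq_iff)

text \<open>Index form: the R^n-part of the argument of \<alpha> and the column of its matrix value
  trade places, while the copy (\<open>Inl\<close> or \<open>Inr\<close>) of the argument
  stays.\<close>

definition swap :: "(real^('n + 'n) \<Rightarrow> real^'n^'n) \<Rightarrow> real^('n + 'n) \<Rightarrow> real^'n::finite^'n" where
  "swap \<alpha> u = (\<chi> a b. (\<Sum>k\<in>UNIV. u $ Inl k * \<alpha> (axis (Inl b) 1) $ a $ k)
      + (\<Sum>k\<in>UNIV. u $ Inr k * \<alpha> (axis (Inr b) 1) $ a $ k))"

lemma block_trace_flip: "block_trace (flip (\<lambda>u. block_diag (\<alpha> u)) u) = swap \<alpha> u"
  by (simp add: block_trace_def flip_nth swap_def vec_eq_iff matrix_vector_mult_def sum_UNIV_plus mult.commute)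

text \<open>Exchanging two indices twice changes nothing; linearity recovers
  \<open>\<alpha> u\<close> from its values on the coordinate axes.\<close>

lemma swap_swap:
  assumes "linear \<alpha>"
  shows "swap (swap \<alpha>) u = \<alpha> u"
proof -
  have "swap (swap \<alpha>) u $ a $ b = \<alpha> u $ a $ b" for a b
  proof -
    have "swap \<alpha> (axis (Inl b) 1) $ a $ k = \<alpha> (axis (Inl k) 1) $ a $ b"
      "swap \<alpha> (axis (Inr b) 1) $ a $ k = \<alpha> (axis (Inr k) 1) $ a $ b" for k
      by (simp_all add: swap_def axis_def if_distrib if_distribR cong: if_cong)
    then have "swap (swap \<alpha>) u $ a $ b = (\<Sum>k\<in>UNIV. u $ Inl k * \<alpha> (axis (Inl k) 1) $ a $ b)
      + (\<Sum>k\<in>UNIV. u $ Inr k * \<alpha> (axis (Inr k) 1) $ a $ b)"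
      by (simp add: swap_def[of "swap \<alpha>"])
    also have "\<dots> = \<alpha> u $ a $ b"
      by (subst (3) linear_expand_axis[OF assms]) (simp add: sum_UNIV_plus)
    finally show ?thesis .
  qed
  then show ?thesis by (simp add: vec_eq_iff)
qed

lemma swap_add: "swap (\<lambda>u. A u + B u) u = swap A u + swap B u"
  by (simp add: swap_def vec_eq_iff sum.distrib algebra_simps)

lemma swap_scaleR: "swap (\<lambda>u. c *\<^sub>R A u) u = c *\<^sub>R swap A u"
  by (simp add: swap_def vec_eq_iff sum_distrib_left algebra_simps)

lemma linear_swap: "linear (swap \<alpha>)"
  by (rule linearI) (simp_all add: swap_def vec_eq_iff sum.distrib sum_distrib_left algebra_simps)

text \<open>The right-hand side of the trace equation. It is applied to the logarithmic derivative D
  of a local frame field, with the argument expressed in that frame.\<close>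

definition defect :: "(real^('n + 'n) \<Rightarrow> real^('n + 'n)^('n + 'n)) \<Rightarrow> real^('n + 'n) \<Rightarrow> real^'n::finite^'n" where
  "defect D u = block_trace (D u - flip D u)"

text \<open>The operator (2 + swap)/3 applied to the defect. The 3 is (2 - swap)(2 + swap) = 4 -
  1.\<close>

definition compensator :: "(real^('n + 'n) \<Rightarrow> real^('n + 'n)^('n + 'n)) \<Rightarrow> real^('n + 'n) \<Rightarrow> real^'n::finite^'n" where
  "compensator D u = (2/3) *\<^sub>R defect D u + (1/3) *\<^sub>R swap (defect D) u"

lemma linear_defect: "linear D \<Longrightarrow> linear (defect D)"
  unfolding defect_def
  using linear_compose[OF linear_compose_sub[OF _ linear_flip[of D]] linear_block_trace]
  by (auto simp: o_def)

lemma linear_compensator: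
  assumes "linear D" shows "linear (compensator D)"
  unfolding compensator_def
  by (intro linear_compose_add linear_compose_scale_right linear_defect linear_swap assms)

text \<open>Since the operator \<^term>\<open>swap\<close> squares to the identity, the trace equation
  \<open>2 \<alpha> - swap \<alpha> = defect D\<close> is solved by multiplying with \<open>2 + swap\<close>.\<close>

lemma trace_equation:
  assumes "linear \<alpha>" "linear D"
  shows "(\<forall>u. block_trace ((block_diag (\<alpha> u) - D u) - flip (\<lambda>u. block_diag (\<alpha> u) - D u) u) = 0)
    \<longleftrightarrow> \<alpha> = compensator D"
proof -
  have "block_trace ((block_diag (\<alpha> u) - D u) - flip (\<lambda>u. block_diag (\<alpha> u) - D u) u)
      = 2 *\<^sub>R \<alpha> u - swap \<alpha> u - defect D u" for u
    by (simp add: flip_diff linear_diff[OF linear_block_trace] block_trace_block_diag block_trace_flip defect_def)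
  moreover have "(\<forall>u. 2 *\<^sub>R \<alpha> u - swap \<alpha> u - defect D u = 0) \<longleftrightarrow> \<alpha> = compensator D"
  proof
    assume *: "\<forall>u. 2 *\<^sub>R \<alpha> u - swap \<alpha> u - defect D u = 0"
    then have "defect D = (\<lambda>u. 2 *\<^sub>R \<alpha> u + (-1) *\<^sub>R swap \<alpha> u)" by (auto simp: fun_eq_iff)
    then have "swap (defect D) u = 2 *\<^sub>R swap \<alpha> u - \<alpha> u" for u
      using swap_add[of "\<lambda>u. 2 *\<^sub>R \<alpha> u" "\<lambda>u. (-1) *\<^sub>R swap \<alpha> u"] swap_scaleR[of 2 \<alpha>] swap_scaleR[of "-1" "swap \<alpha>"]
      by (simp add: swap_swap[OF assms(1)])
    moreover have "defect D u = 2 *\<^sub>R \<alpha> u - swap \<alpha> u" for u using * by (simp add: algebra_simps)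
    ultimately have "compensator D u = (2/3) *\<^sub>R (2 *\<^sub>R \<alpha> u - swap \<alpha> u) + (1/3) *\<^sub>R (2 *\<^sub>R swap \<alpha> u - \<alpha> u)" for u
      by (simp add: compensator_def)
    then have "compensator D u = \<alpha> u" for u
      by (simp add: vec_eq_iff field_simps)
    then show "\<alpha> = compensator D" by auto
  next
    assume *: "\<alpha> = compensator D"
    \<comment> \<open>Applying the involution exchanges the weights 2/3 and 1/3. Hence in 2 \<alpha>
      - swap \<alpha> the defect gets the weight 4/3 - 1/3 = 1 and its swap the weight 2/3 - 2/3 =
      0.\<close>
    have "swap \<alpha> u = (2/3) *\<^sub>R swap (defect D) u + (1/3) *\<^sub>R defect D u" for u
      unfolding * compensator_def[abs_def]
      by (simp add: swap_add swap_scaleR swap_swap linear_defect assms)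
    then show "\<forall>u. 2 *\<^sub>R \<alpha> u - swap \<alpha> u - defect D u = 0"
      by (simp add: * compensator_def vec_eq_iff algebra_simps)
  qed
  ultimately show ?thesis by simp
qed


section \<open>The pointwise linear system and its solution\<close>

text \<open>In a chart, an endomorphism-valued one-form \<open>\<Gamma>\<close> represents a linear connection, \<open>J K\<close> is the
  endomorphism that has the matrix \<open>K\<close> in the frames of the structure, and \<open>L K\<close> is the derivative of \<open>J K\<close>.
  The second clause says that \<open>J K\<close> is parallel. The third one is the trace condition: \<open>\<Gamma> \<xi> - flip \<Gamma> \<xi>\<close>
  represents the contraction of the torsion with \<open>\<xi>\<close>.\<close>

definition well_adapted_coeff ::
  "(real^('n + 'n)^('n + 'n) \<Rightarrow> real^('n + 'n)^('n + 'n))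
    \<Rightarrow> (real^('n + 'n)^('n + 'n) \<Rightarrow> real^('n + 'n) \<Rightarrow> real^('n + 'n)^('n + 'n))
    \<Rightarrow> (real^('n + 'n) \<Rightarrow> real^('n + 'n)^('n::finite + 'n)) \<Rightarrow> bool" where
  "well_adapted_coeff J L \<Gamma> \<longleftrightarrow> linear \<Gamma> \<and>
     (\<forall>\<xi>. \<forall>K\<in>commutant. L K \<xi> + \<Gamma> \<xi> ** J K = J K ** \<Gamma> \<xi>) \<and>
     (\<forall>E \<xi>. (\<forall>K\<in>commutant. E ** J K = J K ** E) \<longrightarrow> trace (E ** (\<Gamma> \<xi> - flip \<Gamma> \<xi>)) = 0)"

text \<open>The argument of the form is moved to the frame s as well as its value. This is why D is
  taken at \<open>s *v u\<close> and the compensator at the coordinates of \<xi> in the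
  frame.\<close>

definition coeff_solution ::
  "real^('n + 'n)^('n + 'n) \<Rightarrow> (real^('n + 'n) \<Rightarrow> real^('n + 'n)^('n + 'n))
    \<Rightarrow> real^('n + 'n) \<Rightarrow> real^('n + 'n)^('n::finite + 'n)" where
  "coeff_solution s D \<xi> =
     s ** (block_diag (compensator (\<lambda>u. D (s *v u)) (matrix_inv s *v \<xi>)) - D \<xi>) ** matrix_inv s"

lemma commutes_conj_iff:
  fixes s a K :: "real^'m::finite^'m"
  assumes "invertible s"
  shows "(s ** a ** matrix_inv s) ** (s ** K ** matrix_inv s) = (s ** K ** matrix_inv s) ** (s ** a ** matrix_inv s)
    \<longleftrightarrow> a ** K = K ** a"
proof -
  have *: "(s ** a ** matrix_inv s) ** (s ** b ** matrix_inv s) = s ** (a ** b) ** matrix_inv s" for a b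
    by (simp add: matrix_mul_assoc matrix_inv_cancel[OF assms])
  have "s ** a ** matrix_inv s = s ** b ** matrix_inv s \<longleftrightarrow> a = b" for a b
    by (metis assms matrix_inv_cancel(4) matrix_inv_cancel(2) matrix_mul_assoc)
  then show ?thesis by (simp add: *)
qed

text \<open>In the frame \<open>s\<close>, with \<open>D\<close> its logarithmic derivative, \<open>\<Gamma>\<close> becomes \<open>A - D\<close> with \<open>A\<close> valued in
  \<^term>\<open>Delta_gl\<close>.\<close>

lemma well_adapted_coeff_iff:
  fixes s :: "real^('n::finite + 'n)^('n + 'n)"
  assumes s: "invertible s" and D: "linear D"
    and J: "\<And>K. K \<in> commutant \<Longrightarrow> J K = s ** K ** matrix_inv s"
    and L: "\<And>K \<xi>. K \<in> commutant \<Longrightarrow> L K \<xi> = s ** (D \<xi> ** K - K ** D \<xi>) ** matrix_inv s"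
  shows "well_adapted_coeff J L \<Gamma> \<longleftrightarrow> \<Gamma> = coeff_solution s D"
proof -
  define D' where "D' u = D (s *v u)" for u
  define A where "A u = matrix_inv s ** \<Gamma> (s *v u) ** s + D' u" for u
  have \<Gamma>: "\<Gamma> \<xi> = s ** (A (matrix_inv s *v \<xi>) - D \<xi>) ** matrix_inv s" for \<xi>
    by (simp add: A_def D'_def matrix_inv_vector_cancel[OF s] matrix_mul_assoc matrix_inv_cancel[OF s] matrix_inv[OF s])
  have D': "linear D'"
    unfolding D'_def using linear_compose[OF matrix_vector_mul_linear D] by (simp add: o_def)
  have linA: "linear \<Gamma> \<longleftrightarrow> linear A"
  proof
    assume "linear \<Gamma>"
    then show "linear A"
      unfolding A_def by (intro linear_compose_add D')
        (rule linearI; simp add: linear_add linear_cmul mv_distrib mm_distrib mv.scaleR_right mm.scaleR_left mm.scaleR_right)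
  next
    assume "linear A"
    then show "linear \<Gamma>"
      by (intro linearI) (simp_all add: \<Gamma> linear_add D linear_cmul mv_distrib mm_distrib mv.scaleR_right
          mm.scaleR_left mm.scaleR_right algebra_simps)
  qed
  have par: "(\<forall>\<xi>. \<forall>K\<in>commutant. L K \<xi> + \<Gamma> \<xi> ** J K = J K ** \<Gamma> \<xi>) \<longleftrightarrow> range A \<subseteq> Delta_gl"
  proof -
    have "L K \<xi> + \<Gamma> \<xi> ** J K = J K ** \<Gamma> \<xi> \<longleftrightarrow>
        A (matrix_inv s *v \<xi>) ** K = K ** A (matrix_inv s *v \<xi>)" if "K \<in> commutant" for \<xi> K
    proof -
      let ?c = "\<lambda>a. s ** a ** matrix_inv s" and ?a = "A (matrix_inv s *v \<xi>)"
      \<comment> \<open>\<open>L K \<xi>\<close> is a conjugated commutator of D with K. It cancels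
        the contribution of - D in \<Gamma>, so that only the commutator of A with K
        remains.\<close>
      have "?c (D \<xi>) ** ?c K - ?c K ** ?c (D \<xi>) = L K \<xi>"
        using that by (simp add: L matrix_mul_assoc matrix_inv_cancel[OF s] mm_distrib)
      moreover have "\<Gamma> \<xi> = ?c ?a - ?c (D \<xi>)" by (simp add: \<Gamma> mm_distrib)
      moreover have "Y ** Z - Z ** Y + (X - Y) ** Z = Z ** (X - Y) \<longleftrightarrow> X ** Z = Z ** X"
        for X Y Z :: "real^('n + 'n)^('n + 'n)"
        by (simp add: mm_distrib)
      ultimately have "L K \<xi> + \<Gamma> \<xi> ** J K = J K ** \<Gamma> \<xi> \<longleftrightarrow> ?c ?a ** ?c K = ?c K ** ?c ?a"
        unfolding J[OF that] by metis
      then show ?thesis by (simp only: commutes_conj_iff[OF s])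
    qed
    moreover have "(\<forall>\<xi>. \<forall>K\<in>commutant. A (matrix_inv s *v \<xi>) ** K = K ** A (matrix_inv s *v \<xi>))
        \<longleftrightarrow> (\<forall>u. \<forall>K\<in>commutant. A u ** K = K ** A u)"
      by (metis matrix_inv_vector_cancel(2)[OF s])
    ultimately have "(\<forall>\<xi>. \<forall>K\<in>commutant. L K \<xi> + \<Gamma> \<xi> ** J K = J K ** \<Gamma> \<xi>) \<longleftrightarrow>
        (\<forall>u. \<forall>K\<in>commutant. A u ** K = K ** A u)" by auto
    also have "\<dots> \<longleftrightarrow> range A \<subseteq> Delta_gl"
      by (simp add: image_subset_iff Delta_gl_iff)
    finally show ?thesis .
  qed
  have comm: "(\<forall>K\<in>commutant. E ** J K = J K ** E) \<longleftrightarrow> matrix_inv s ** E ** s \<in> Delta_gl" for E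
  proof -
    have E: "E = s ** (matrix_inv s ** E ** s) ** matrix_inv s"
      by (simp add: matrix_mul_assoc matrix_inv_cancel[OF s] matrix_inv[OF s])
    have "E ** J K = J K ** E \<longleftrightarrow> (matrix_inv s ** E ** s) ** K = K ** (matrix_inv s ** E ** s)"
      if "K \<in> commutant" for K
      unfolding J[OF that] by (subst (1 2) E) (rule commutes_conj_iff[OF s])
    then show ?thesis by (simp add: Delta_gl_iff)
  qed
  have tr: "(\<forall>E \<xi>. (\<forall>K\<in>commutant. E ** J K = J K ** E) \<longrightarrow> trace (E ** (\<Gamma> \<xi> - flip \<Gamma> \<xi>)) = 0)
      \<longleftrightarrow> (\<forall>u. block_trace ((A u - D' u) - flip (\<lambda>u. A u - D' u) u) = 0)" if lin: "linear \<Gamma>"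
  proof -
    have AD: "A u - D' u = matrix_inv s ** \<Gamma> (s *v u) ** s" for u by (simp add: A_def)
    have conj: "matrix_inv s ** (\<Gamma> (s *v u) - flip \<Gamma> (s *v u)) ** s = (A u - D' u) - flip (\<lambda>u. A u - D' u) u" for u
      unfolding AD by (simp add: flip_conj[OF lin s] mm_distrib)
    have tc: "trace (E ** X) = trace ((matrix_inv s ** E ** s) ** (matrix_inv s ** X ** s))" for E X
      using trace_conj[OF s, of "E ** X"] by (simp add: matrix_mul_assoc matrix_inv_cancel[OF s])
    define t where "t u S = trace (S ** ((A u - D' u) - flip (\<lambda>u. A u - D' u) u))" for u S
    have "trace (E ** (\<Gamma> (s *v u) - flip \<Gamma> (s *v u))) = t u (matrix_inv s ** E ** s)" for E u
      using tc[of E "\<Gamma> (s *v u) - flip \<Gamma> (s *v u)"] unfolding conj t_def .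
    then have "(\<forall>\<xi>. trace (E ** (\<Gamma> \<xi> - flip \<Gamma> \<xi>)) = 0) \<longleftrightarrow> (\<forall>u. t u (matrix_inv s ** E ** s) = 0)" for E
      by (metis matrix_inv_vector_cancel(1)[OF s])
    then have "(\<forall>E \<xi>. (\<forall>K\<in>commutant. E ** J K = J K ** E) \<longrightarrow> trace (E ** (\<Gamma> \<xi> - flip \<Gamma> \<xi>)) = 0)
      \<longleftrightarrow> (\<forall>E. matrix_inv s ** E ** s \<in> Delta_gl \<longrightarrow> (\<forall>u. t u (matrix_inv s ** E ** s) = 0))"
      unfolding comm by blast
    also have "\<dots> \<longleftrightarrow> (\<forall>S\<in>Delta_gl. \<forall>u. t u S = 0)"
    proof -
      \<comment> \<open>Every S is the conjugate of some E, so the quantifier over the endomorphisms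
        E can be traded for one over the fixed algebra.\<close>
      have "S = matrix_inv s ** (s ** S ** matrix_inv s) ** s" for S
        by (simp add: matrix_mul_assoc matrix_inv_cancel[OF s] matrix_inv[OF s])
      then show ?thesis by metis
    qed
    also have "\<dots> \<longleftrightarrow> (\<forall>u. \<forall>S\<in>Delta_gl. trace (S ** ((A u - D' u) - flip (\<lambda>u. A u - D' u) u)) = 0)"
      unfolding t_def by blast
    finally show ?thesis by (simp add: trace_Delta_gl_eq_0_iff)
  qed
  show ?thesis
  proof
    assume "well_adapted_coeff J L \<Gamma>"
    then have lin: "linear \<Gamma>" "linear A" and A: "range A \<subseteq> Delta_gl"
      and t: "\<forall>u. block_trace ((A u - D' u) - flip (\<lambda>u. A u - D' u) u) = 0"
      unfolding well_adapted_coeff_def using linA par tr by auto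
    \<comment> \<open>The partial trace of \<open>block_diag a\<close> is twice a, so half of it
      recovers the repeated block.\<close>
    define \<alpha> where "\<alpha> u = (1/2) *\<^sub>R block_trace (A u)" for u
    have A\<alpha>: "A u = block_diag (\<alpha> u)" for u
    proof -
      have "A u \<in> Delta_gl" using A by auto
      then show ?thesis by (auto simp: \<alpha>_def Delta_gl_def block_trace_block_diag)
    qed
    have "linear \<alpha>"
      unfolding \<alpha>_def using linear_compose[OF lin(2) linear_block_trace]
      by (intro linear_compose_scale_right) (simp add: o_def)
    then have "\<alpha> = compensator D'" using trace_equation[OF _ D'] t unfolding A\<alpha> by blast
    then show "\<Gamma> = coeff_solution s D"
      unfolding fun_eq_iff coeff_solution_def D'_def[symmetric] \<Gamma> A\<alpha> by (simp add: D'_def[abs_def])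
  next
    assume *: "\<Gamma> = coeff_solution s D"
    have A: "A u = block_diag (compensator D' u)" for u
      by (simp add: A_def * coeff_solution_def matrix_inv_vector_cancel[OF s] matrix_mul_assoc
          matrix_inv_cancel[OF s] matrix_inv[OF s] D'_def[abs_def])
    have "linear A"
      unfolding A using linear_compose[OF linear_compensator[OF D'] linear_block_diag] by (simp add: o_def)
    then show "well_adapted_coeff J L \<Gamma>"
      unfolding well_adapted_coeff_def using linA par tr trace_equation[OF linear_compensator[OF D'] D']
      by (auto simp: A Delta_gl_def)
  qed
qed

text \<open>Smoothness is known for each fixed vector only; expanding the moving vector over the
  coordinate axes reduces to that case.\<close>

lemma smooth_on_linear_field:
  fixes D :: "'a::real_normed_vector \<Rightarrow> real^'m::finite \<Rightarrow> 'b::real_normed_vector"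
  assumes "open U" "\<And>y. y \<in> U \<Longrightarrow> linear (D y)" "\<And>\<xi>. smooth_on U (\<lambda>y. D y \<xi>)" "smooth_on U w"
  shows "smooth_on U (\<lambda>y. D y (w y))"
  by (subst smooth_on_cong[OF assms(1) linear_expand_axis[OF assms(2)]])
    (auto intro!: smooth_intros assms)

text \<open>The operators \<open>flip\<close> and \<open>swap\<close> evaluate their form only at
  fixed coordinate axes, so pointwise solving preserves smoothness. The one moving argument, the
  inverse of s applied to \<xi>, is handled by \<open>smooth_on_linear_field\<close>.\<close>

lemma smooth_on_coeff_solution:
  fixes s :: "'a::real_normed_vector \<Rightarrow> real^('n::finite + 'n)^('n + 'n)"
  assumes U: "open U" and s: "smooth_on U s" "\<And>y. y \<in> U \<Longrightarrow> invertible (s y)"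
    and D: "\<And>y. y \<in> U \<Longrightarrow> linear (D y)" "\<And>\<xi>. smooth_on U (\<lambda>y. D y \<xi>)"
  shows "smooth_on U (\<lambda>y. coeff_solution (s y) (D y) \<xi>)"
proof -
  have D': "smooth_on U (\<lambda>y. D y (s y *v u))" for u
    by (intro smooth_on_linear_field[OF U D] smooth_intros U s)
  have lD': "linear (\<lambda>u. D y (s y *v u))" if "y \<in> U" for y
    using linear_compose[OF matrix_vector_mul_linear D(1)[OF that]] by (simp add: o_def)
  have def: "smooth_on U (\<lambda>y. defect (\<lambda>u. D y (s y *v u)) u)" for u
    unfolding defect_def block_trace_def vector_minus_component flip_nth
    by (intro smooth_intros U D')
  have "smooth_on U (\<lambda>y. compensator (\<lambda>u. D y (s y *v u)) u)" for u
    unfolding compensator_def swap_def by (intro smooth_intros U def)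
  moreover have "smooth_on U (\<lambda>y. matrix_inv (s y) *v \<xi>)" by (intro smooth_intros U s)
  ultimately have "smooth_on U (\<lambda>y. compensator (\<lambda>u. D y (s y *v u)) (matrix_inv (s y) *v \<xi>))"
    using smooth_on_linear_field[where D = "\<lambda>y. compensator (\<lambda>u. D y (s y *v u))"] U
      linear_compensator[OF lD'] by blast
  then have *: "smooth_on U (\<lambda>y. block_diag (compensator (\<lambda>u. D y (s y *v u)) (matrix_inv (s y) *v \<xi>)))"
    by (rule smooth_on_linear[OF linear_conv_bounded_linear[THEN iffD1, OF linear_block_diag] U])
  show ?thesis unfolding coeff_solution_def by (intro smooth_intros U s D *)
qed

section \<open>Bump functions\<close>

text \<open>The linear span of the functions \<open>flat n\<close> is closed under differentiation.\<close>

definition flat :: "nat \<Rightarrow> real \<Rightarrow> real" where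
  "flat n t = (if t > 0 then inverse t ^ n / exp (inverse t) else 0)"

lemma flat_tendsto_0: "(flat n \<longlongrightarrow> 0) (at 0)"
proof -
  have "((\<lambda>t::real. inverse t ^ n / exp (inverse t)) \<longlongrightarrow> 0) (at_right 0)"
    by (rule filterlim_compose[OF tendsto_power_div_exp_0 filterlim_inverse_at_top_right])
  then have "(flat n \<longlongrightarrow> 0) (at_right 0)"
    by (rule Lim_transform_eventually) (auto simp: flat_def eventually_at_filter)
  moreover have "(flat n \<longlongrightarrow> 0) (at_left 0)"
    by (rule tendsto_eventually) (auto simp: flat_def eventually_at_filter)
  ultimately show ?thesis by (simp add: filterlim_split_at)
qed

lemma flat_has_derivative:
  "(flat n has_real_derivative flat (n + 2) t - real n * flat (n + 1) t) (at t)"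
proof -
  consider "t > 0" | "t < 0" | "t = 0" by linarith
  then show ?thesis
  proof cases
    case 1
    have "((\<lambda>t. inverse t ^ n / exp (inverse t)) has_real_derivative
        flat (n + 2) t - real n * flat (n + 1) t) (at t)"
      using 1 by (auto intro!: derivative_eq_intros simp: flat_def divide_simps power2_eq_square)
        (cases n; auto simp: field_simps power2_eq_square)
    then show ?thesis
      by (rule has_field_derivative_transform_within_open[where S = "{0<..}"]) (use 1 in \<open>auto simp: flat_def\<close>)
  next
    case 2
    have "((\<lambda>t. 0) has_real_derivative flat (n + 2) t - real n * flat (n + 1) t) (at t)"
      using 2 by (simp add: flat_def)
    then show ?thesis
      by (rule has_field_derivative_transform_within_open[where S = "{..<0}"]) (use 2 in \<open>auto simp: flat_def\<close>)
  next
    case 3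
    \<comment> \<open>The difference quotient at 0 is \<open>flat (Suc n)\<close> on both sides, and
      this tends to 0.\<close>
    have "((\<lambda>h. (flat n (0 + h) - flat n 0) / h) \<longlongrightarrow> 0) (at 0)"
      by (rule Lim_transform_eventually[OF flat_tendsto_0[of "Suc n"]])
        (auto simp: flat_def eventually_at_filter divide_simps)
    then show ?thesis by (simp add: 3 DERIV_def flat_def)
  qed
qed

lemma smooth_on_flat: "smooth_on UNIV (flat n)"
proof -
  have "Ck_on k UNIV (flat n)" for k n
  proof (induction k arbitrary: n)
    case 0
    show ?case using DERIV_isCont[OF flat_has_derivative] by (simp add: continuous_on_eq_continuous_at)
  next
    case (Suc k)
    have hd: "(flat n has_derivative (*) (flat (n + 2) t - real n * flat (n + 1) t)) (at t)" for t
      using flat_has_derivative by (simp add: has_field_derivative_def)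
    have "Ck_on k UNIV (\<lambda>t. (flat (n + 2) t + (- real n) * flat (n + 1) t) * v)" for v
      by (intro Ck_on_bilinear[OF bounded_bilinear_mult] Ck_on_add Ck_on_const Suc open_UNIV)
    then have "Ck_on k UNIV (\<lambda>t. FD (flat n) t v)" for v
      by (simp add: FD_eq[OF hd])
    then show ?case using hd by (auto simp: differentiable_def)
  qed
  then show ?thesis by (simp add: smooth_on_def)
qed

lemma bump_exists:
  fixes x0 :: "'e::euclidean_space"
  assumes "r > 0"
  obtains \<beta> :: "'e \<Rightarrow> real"
    where "smooth_on UNIV \<beta>" "\<beta> x0 = 1" "\<And>y. r \<le> dist x0 y \<Longrightarrow> \<beta> y = 0"
proof
  \<comment> \<open>The argument of \<open>flat 0\<close> is positive exactly inside the ball of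
    radius r; the exponential factor normalises the value at the centre to 1.\<close>
  let ?\<beta> = "\<lambda>y. flat 0 (r\<^sup>2 - (y - x0) \<bullet> (y - x0)) * exp (inverse (r\<^sup>2))"
  show "smooth_on UNIV ?\<beta>"
    by (intro smooth_intros open_UNIV smooth_on_compose[OF open_UNIV open_UNIV _ _ smooth_on_flat]
        smooth_on_bilinear[OF bounded_bilinear_inner]) auto
  show "?\<beta> x0 = 1" using assms by (simp add: flat_def)
  show "?\<beta> y = 0" if "r \<le> dist x0 y" for y
  proof -
    have "r\<^sup>2 \<le> (norm (y - x0))\<^sup>2"
      using that assms by (intro power_mono) (auto simp: dist_norm norm_minus_commute)
    then show ?thesis by (simp add: flat_def dot_square_norm)
  qed
qed

section \<open>Charts and tangent vectors\<close>

abbreviation transition :: "('a, 'e) chart \<Rightarrow> ('a, 'e) chart \<Rightarrow> 'e \<Rightarrow> 'e" where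
  "transition c d \<equiv> snd d \<circ> chart_inv c"

text \<open>For a chart around x this inverts the map that sends v to \<open>v c\<close>, and so
  identifies the tangent space with the model space.\<close>

definition tvec_of ::
  "('a, 'e::euclidean_space) chart set \<Rightarrow> 'a \<Rightarrow> ('a, 'e) chart \<Rightarrow> 'e \<Rightarrow> ('a, 'e) tvec" where
  "tvec_of A x c \<xi> = (\<lambda>d. if d \<in> charts_at A x then FD (transition c d) (snd c x) \<xi> else 0)"

text \<open>Restricted to the compatibility of charts, so that the frame atlas and the real line can
  serve as instances as well.\<close>

locale smooth_atlas =
  fixes A :: "('a, 'e::euclidean_space) chart set"
  assumes inj_chart: "c \<in> A \<Longrightarrow> inj_on (snd c) (fst c)"
    and open_overlap: "c \<in> A \<Longrightarrow> d \<in> A \<Longrightarrow> open (snd c ` (fst c \<inter> fst d))"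
    and smooth_transition: "c \<in> A \<Longrightarrow> d \<in> A \<Longrightarrow> smooth_on (snd c ` (fst c \<inter> fst d)) (transition c d)"
begin

lemma chart_inv_left: "c \<in> A \<Longrightarrow> x \<in> fst c \<Longrightarrow> chart_inv c (snd c x) = x"
  by (simp add: inj_chart)

lemma snd_in_image_iff: "c \<in> A \<Longrightarrow> x \<in> fst c \<Longrightarrow> snd c x \<in> snd c ` (fst c \<inter> S) \<longleftrightarrow> x \<in> S"
  using inj_chart[of c] by (auto simp: inj_on_def)

lemma charts_atD: "c \<in> charts_at A x \<Longrightarrow> c \<in> A" "c \<in> charts_at A x \<Longrightarrow> x \<in> fst c"
  by (auto simp: charts_at_def)

lemma charts_at_nonempty: "x \<in> carrier A \<Longrightarrow> \<exists>c. c \<in> charts_at A x"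
  by (auto simp: carrier_def charts_at_def)

text \<open>Charts are injective, so their images commute with intersections; hence the sets in
  \<open>atlas_topology\<close> really form a topology.\<close>

lemma openin_atlas:
  "openin (atlas_topology A) W \<longleftrightarrow> W \<subseteq> carrier A \<and> (\<forall>c\<in>A. open (snd c ` (fst c \<inter> W)))"
proof -
  have "istopology (\<lambda>W. W \<subseteq> carrier A \<and> (\<forall>c\<in>A. open (snd c ` (fst c \<inter> W))))"
    unfolding istopology_def
  proof (intro conjI allI impI ballI)
    fix S T c
    assume *: "S \<subseteq> carrier A \<and> (\<forall>c\<in>A. open (snd c ` (fst c \<inter> S)))"
      "T \<subseteq> carrier A \<and> (\<forall>c\<in>A. open (snd c ` (fst c \<inter> T)))" "c \<in> A"
    then have "snd c ` (fst c \<inter> (S \<inter> T)) = snd c ` (fst c \<inter> S) \<inter> snd c ` (fst c \<inter> T)"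
      using inj_chart[of c] by (auto simp: inj_on_def)
    then show "open (snd c ` (fst c \<inter> (S \<inter> T)))" using * by auto
  next
    fix K c
    assume *: "\<forall>S\<in>K. S \<subseteq> carrier A \<and> (\<forall>c\<in>A. open (snd c ` (fst c \<inter> S)))" "c \<in> A"
    have "snd c ` (fst c \<inter> \<Union> K) = (\<Union>S\<in>K. snd c ` (fst c \<inter> S))" by auto
    then show "open (snd c ` (fst c \<inter> \<Union> K))" using * by auto
  qed auto
  then show ?thesis unfolding atlas_topology_def by (simp add: topology_inverse')
qed

lemma openin_open: "openin (atlas_topology A) W \<Longrightarrow> c \<in> A \<Longrightarrow> open (snd c ` (fst c \<inter> W))"
  by (simp add: openin_atlas)

lemma chart_subset_carrier: "c \<in> A \<Longrightarrow> fst c \<subseteq> carrier A"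
  by (auto simp: carrier_def)

lemma openin_chart: "c \<in> A \<Longrightarrow> openin (atlas_topology A) (fst c)"
  unfolding openin_atlas using open_overlap chart_subset_carrier by blast

lemma openin_carrier: "openin (atlas_topology A) (carrier A)"
  unfolding openin_atlas
proof (intro conjI ballI)
  fix c assume "c \<in> A"
  then have "fst c \<inter> carrier A = fst c \<inter> fst c" using chart_subset_carrier by blast
  then show "open (snd c ` (fst c \<inter> carrier A))" using open_overlap[of c c] \<open>c \<in> A\<close> by simp
qed auto

lemma topspace_atlas: "topspace (atlas_topology A) = carrier A"
  using openin_carrier openin_atlas by (metis openin_subset openin_topspace subset_antisym)

lemma open_chart_image: "c \<in> A \<Longrightarrow> open (snd c ` fst c)"
  using open_overlap[of c c] by simp

lemma openin_coords:
  assumes "c \<in> A" "open V"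
  shows "openin (atlas_topology A) {x \<in> fst c. snd c x \<in> V}"
  unfolding openin_atlas
proof (intro conjI ballI)
  fix d assume d: "d \<in> A"
  have "snd d ` (fst d \<inter> {x \<in> fst c. snd c x \<in> V})
      = snd d ` (fst d \<inter> fst c) \<inter> transition d c -` V"
    using chart_inv_left[OF d] by auto
  moreover have "open (snd d ` (fst d \<inter> fst c) \<inter> transition d c -` V)"
    using smooth_on_continuous[OF smooth_transition[OF d assms(1)]] open_overlap[OF d assms(1)] assms(2)
    by (rule continuous_open_preimage)
  ultimately show "open (snd d ` (fst d \<inter> {x \<in> fst c. snd c x \<in> V}))" by simp
qed (use chart_subset_carrier[OF assms(1)] in auto)

lemma differentiable_transition:
  "c \<in> charts_at A x \<Longrightarrow> d \<in> charts_at A x \<Longrightarrow> transition c d differentiable (at (snd c x))"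
  using smooth_transition[of c d] by (auto simp: charts_at_def intro: smooth_on_differentiable)

lemma FD_chart_change:
  assumes c: "c \<in> charts_at A x" and d: "d \<in> charts_at A x"
    and f: "(f \<circ> chart_inv d) differentiable (at (snd d x))"
  shows "(f \<circ> chart_inv c) differentiable (at (snd c x))"
    "FD (f \<circ> chart_inv c) (snd c x) \<xi> = FD (f \<circ> chart_inv d) (snd d x) (FD (transition c d) (snd c x) \<xi>)"
proof -
  let ?S = "snd c ` (fst c \<inter> fst d)"
  have S: "open ?S" "snd c x \<in> ?S" using c d open_overlap by (auto simp: charts_at_def)
  have cc: "chart_inv c (snd c x) = x" "c \<in> A" "d \<in> A" using c d chart_inv_left by (auto simp: charts_at_def)
  have eq: "(f \<circ> chart_inv c) y = (f \<circ> chart_inv d) (transition c d y)" if "y \<in> ?S" for y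
    using that chart_inv_left cc by auto
  have f': "(f \<circ> chart_inv d) differentiable (at (transition c d (snd c x)))" using f cc by simp
  have *: "(\<lambda>y. (f \<circ> chart_inv d) (transition c d y)) differentiable (at (snd c x))"
    using differentiable_chain_at[OF differentiable_transition[OF c d] f'] unfolding o_def .
  show "(f \<circ> chart_inv c) differentiable (at (snd c x))"
    using differentiable_cong[OF S, of "f \<circ> chart_inv c" "\<lambda>y. (f \<circ> chart_inv d) (transition c d y)"] eq * by simp
  show "FD (f \<circ> chart_inv c) (snd c x) \<xi> = FD (f \<circ> chart_inv d) (snd d x) (FD (transition c d) (snd c x) \<xi>)"
    using FD_cong[OF S, of "f \<circ> chart_inv c" "\<lambda>y. (f \<circ> chart_inv d) (transition c d y)"] eq
      FD_compose[OF differentiable_transition[OF c d] f', of \<xi>] cc(1) by (simp add: comp_def)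
qed

lemma FD_transition_self: "c \<in> charts_at A x \<Longrightarrow> FD (transition c c) (snd c x) \<xi> = \<xi>"
proof -
  assume c: "c \<in> charts_at A x"
  then have "FD (transition c c) (snd c x) = FD (\<lambda>y. y) (snd c x)"
    using open_overlap[of c c] chart_inv_left
    by (intro FD_cong[of "snd c ` (fst c \<inter> fst c)"]) (auto simp: charts_at_def)
  then show ?thesis by simp
qed

lemma FD_transition_inverse:
  "c \<in> charts_at A x \<Longrightarrow> d \<in> charts_at A x \<Longrightarrow>
    FD (transition d c) (snd d x) (FD (transition c d) (snd c x) \<xi>) = \<xi>"
  using FD_chart_change(2)[of c x d "snd c" \<xi>] differentiable_transition[of d x c] FD_transition_self[of c x]
  by simp

lemma tvec_of_tangent:
  assumes c: "c \<in> charts_at A x"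
  shows "tvec_of A x c \<xi> \<in> tangent_space A x"
  unfolding tangent_space_def
proof (intro CollectI conjI ballI allI impI)
  fix d e assume "d \<in> charts_at A x" "e \<in> charts_at A x"
  then show "tvec_of A x c \<xi> e = FD (transition d e) (snd d x) (tvec_of A x c \<xi> d)"
    using FD_chart_change(2)[OF c, of d "snd e"] differentiable_transition by (simp add: tvec_of_def)
qed (simp add: tvec_of_def)

lemma tvec_of_self: "c \<in> charts_at A x \<Longrightarrow> tvec_of A x c \<xi> c = \<xi>"
  by (simp add: tvec_of_def FD_transition_self)

lemma tangent_component:
  assumes "v \<in> tangent_space A x" "c \<in> charts_at A x" "d \<in> charts_at A x"
  shows "v d = FD (transition c d) (snd c x) (v c)"
  using assms unfolding tangent_space_def by blast

lemma tangent_outside: "v \<in> tangent_space A x \<Longrightarrow> c \<notin> charts_at A x \<Longrightarrow> v c = 0"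
  unfolding tangent_space_def by blast

lemma tangent_eq_tvec_of: "v \<in> tangent_space A x \<Longrightarrow> c \<in> charts_at A x \<Longrightarrow> tvec_of A x c (v c) = v"
  by (rule ext) (metis tvec_of_def tangent_component tangent_outside)

lemma tangent_eqI:
  assumes "v \<in> tangent_space A x" "w \<in> tangent_space A x" "c \<in> charts_at A x" "v c = w c"
  shows "v = w"
  using assms tangent_eq_tvec_of by metis

lemma tvec_of_linear:
  assumes "c \<in> charts_at A x" shows "linear (\<lambda>\<xi>. tvec_of A x c \<xi> d)"
proof (cases "d \<in> charts_at A x")
  case True
  then show ?thesis
    using bounded_linear.linear[OF FD_linear[OF differentiable_transition[OF assms True]]]
    by (simp add: tvec_of_def)
next
  case False
  then show ?thesis by (auto simp: tvec_of_def intro: linearI)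
qed

lemma tangent_lincomb:
  assumes "v \<in> tangent_space A x" "w \<in> tangent_space A x"
  shows "(\<lambda>d. a *\<^sub>R v d + b *\<^sub>R w d) \<in> tangent_space A x"
  unfolding tangent_space_def
proof (intro CollectI conjI ballI allI impI)
  fix c d assume cd: "c \<in> charts_at A x" "d \<in> charts_at A x"
  have lin: "linear (FD (transition c d) (snd c x))"
    using FD_linear[OF differentiable_transition[OF cd]] by (rule bounded_linear.linear)
  show "a *\<^sub>R v d + b *\<^sub>R w d = FD (transition c d) (snd c x) (a *\<^sub>R v c + b *\<^sub>R w c)"
    using tangent_component[OF assms(1) cd] tangent_component[OF assms(2) cd]
    by (simp add: linear_add[OF lin] linear_cmul[OF lin])
qed (simp_all add: tangent_outside[OF assms(1)] tangent_outside[OF assms(2)])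

lemma tangent_scaleR: "v \<in> tangent_space A x \<Longrightarrow> (\<lambda>d. a *\<^sub>R v d) \<in> tangent_space A x"
  using tangent_lincomb[of v x v a 0] by simp

lemma tangent_zero: "x \<in> carrier A \<Longrightarrow> (\<lambda>_. 0) \<in> tangent_space A x"
  using tangent_scaleR[of _ x 0] tvec_of_tangent charts_at_nonempty by fastforce

text \<open>The chart picked in \<open>dir_deriv\<close> is arbitrary; the chain rule for
  transitions together with the transformation of v allows any other chart.\<close>

lemma dir_deriv_chart:
  assumes "c \<in> charts_at A x" "v \<in> tangent_space A x" "(f \<circ> chart_inv c) differentiable (at (snd c x))"
  shows "dir_deriv A f x v = FD (f \<circ> chart_inv c) (snd c x) (v c)"
proof -
  define d where "d = (SOME c. c \<in> charts_at A x)"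
  have d: "d \<in> charts_at A x" unfolding d_def using assms(1) by (rule someI)
  have "dir_deriv A f x v = FD (f \<circ> chart_inv d) (snd d x) (v d)"
    by (simp add: dir_deriv_def d_def Let_def)
  also have "\<dots> = FD (f \<circ> chart_inv c) (snd c x) (v c)"
    using FD_chart_change(2)[OF d assms(1,3)] tangent_component[OF assms(2) d assms(1)] by simp
  finally show ?thesis .
qed

lemma smooth_chart_change:
  assumes "c \<in> A" "d \<in> A" "openin (atlas_topology A) W" "smooth_on (snd c ` (fst c \<inter> W)) (f \<circ> chart_inv c)"
  shows "smooth_on (snd d ` (fst d \<inter> (fst c \<inter> W))) (f \<circ> chart_inv d)"
proof -
  have o: "open (snd d ` (fst d \<inter> (fst c \<inter> W)))" "open (snd c ` (fst c \<inter> W))"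
    using assms openin_chart openin_open openin_Int by metis+
  have "smooth_on (snd d ` (fst d \<inter> (fst c \<inter> W))) (transition d c)"
    by (rule smooth_on_mono[OF smooth_transition[OF assms(2,1)]]) auto
  then have "smooth_on (snd d ` (fst d \<inter> (fst c \<inter> W))) (\<lambda>y. (f \<circ> chart_inv c) (transition d c y))"
    using chart_inv_left[OF assms(2)]
    by (intro smooth_on_compose[of _ _ "transition d c" "f \<circ> chart_inv c", OF o _ _ assms(4)]) auto
  then show ?thesis
    by (subst smooth_on_cong[OF o(1)]) (use chart_inv_left assms(1,2) in auto)
qed

lemma smooth_fun_from_chart:
  assumes "c \<in> A" "openin (atlas_topology A) W" "W \<subseteq> fst c" "smooth_on (snd c ` W) (f \<circ> chart_inv c)"
  shows "smooth_fun A W f"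
  unfolding smooth_fun_def
proof (intro conjI ballI)
  fix d assume "d \<in> A"
  moreover have "fst c \<inter> W = W" using assms(3) by auto
  ultimately show "smooth_on (snd d ` (fst d \<inter> W)) (f \<circ> chart_inv d)"
    using smooth_chart_change[OF assms(1) _ assms(2)] assms(4) by metis
qed (rule assms)

lemma smooth_vf_from_chart:
  assumes c: "c \<in> A" and W: "openin (atlas_topology A) W" "W \<subseteq> fst c"
    and X: "\<And>p. p \<in> W \<Longrightarrow> X p \<in> tangent_space A p"
    and smooth: "smooth_on (snd c ` W) (\<lambda>y. X (chart_inv c y) c)"
  shows "smooth_vf A W X"
  unfolding smooth_vf_def
proof (intro conjI ballI)
  fix d assume d: "d \<in> A"
  let ?S = "snd d ` (fst d \<inter> W)"
  have S: "open ?S" using openin_open[OF W(1) d] .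
  have Wc: "fst c \<inter> W = W" using W(2) by auto
  have "smooth_on ?S ((\<lambda>p. X p c) \<circ> chart_inv d)"
    using smooth_chart_change[OF c d W(1), of "\<lambda>p. X p c"] smooth unfolding Wc by (simp add: o_def)
  moreover have "smooth_on ?S (\<lambda>y. FD (transition c d) (transition d c y) \<xi>)" for \<xi>
  proof (rule smooth_on_compose[of _ _ "transition d c" "\<lambda>z. FD (transition c d) z \<xi>", OF S open_overlap[OF c d]])
    show "transition d c ` ?S \<subseteq> snd c ` (fst c \<inter> fst d)" using W(2) chart_inv_left[OF d] by auto
    show "smooth_on ?S (transition d c)"
      by (rule smooth_on_mono[OF smooth_transition[OF d c]]) (use W(2) in auto)
    show "smooth_on (snd c ` (fst c \<inter> fst d)) (\<lambda>z. FD (transition c d) z \<xi>)"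
      by (rule smooth_on_FD_const[OF smooth_transition[OF c d]])
  qed
  moreover have "transition c d differentiable (at (transition d c y))" if "y \<in> ?S" for y
    using that W(2) smooth_on_differentiable[OF smooth_transition[OF c d]] chart_inv_left[OF d] by auto
  ultimately have "smooth_on ?S (\<lambda>y. \<Sum>i\<in>Basis. (X (chart_inv d y) c \<bullet> i) *\<^sub>R FD (transition c d) (transition d c y) i)"
    by (intro smooth_intros S smooth_on_inner_left) (simp_all add: o_def)
  then show "smooth_on ?S (\<lambda>y. X (chart_inv d y) d)"
  proof (subst smooth_on_cong[OF S])
    fix y assume y: "y \<in> ?S"
    then obtain p where p: "p \<in> W" "p \<in> fst d" "y = snd d p" by auto
    then have "c \<in> charts_at A p" "d \<in> charts_at A p" using c d W(2) by (auto simp: charts_at_def)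
    then show "X (chart_inv d y) d = (\<Sum>i\<in>Basis. (X (chart_inv d y) c \<bullet> i) *\<^sub>R FD (transition c d) (transition d c y) i)"
      using tangent_component[OF X[OF p(1)], of c d] FD_expand[OF differentiable_transition, of c p d "X p c"] p d
      by (simp add: chart_inv_left)
  qed
qed (use W X in auto)

text \<open>The field with constant components in c extends a given vector. It supplies the test
  fields that pin down the torsion.\<close>

lemma vf_extension:
  assumes c: "c \<in> charts_at A x" and v: "v \<in> tangent_space A x"
  shows "smooth_vf A (fst c) (\<lambda>p. tvec_of A p c (v c))" "tvec_of A x c (v c) = v"
proof -
  have cA: "c \<in> A" using c charts_atD by blast
  show "tvec_of A x c (v c) = v" using tangent_eq_tvec_of[OF v c] .
  have *: "c \<in> charts_at A p" if "p \<in> fst c" for p using that cA by (simp add: charts_at_def)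
  show "smooth_vf A (fst c) (\<lambda>p. tvec_of A p c (v c))"
  proof (rule smooth_vf_from_chart[OF cA openin_chart[OF cA] order_refl tvec_of_tangent[OF *]])
    have "smooth_on (snd c ` fst c) (\<lambda>y. v c)" by (rule smooth_on_const)
    then show "smooth_on (snd c ` fst c) (\<lambda>y. tvec_of A (chart_inv c y) c (v c) c)"
      by (subst smooth_on_cong[OF open_chart_image[OF cA]])
        (auto simp: chart_inv_left[OF cA] tvec_of_self[OF *])
  qed
qed

section \<open>Cutting off functions and vector fields on a manifold\<close>

text \<open>A Euclidean bump in a chart is extended by zero. The set K is the image of a closed
  coordinate ball, hence compact, hence closed by the Hausdorff property; so the extension is smooth
  also at points outside the chart.\<close>

lemma bump_function:
  assumes haus: "Hausdorff_space (atlas_topology A)" and W: "openin (atlas_topology A) W" and x: "x \<in> W"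
  obtains \<beta> :: "'a \<Rightarrow> real" and K where "K \<subseteq> W" "openin (atlas_topology A) (carrier A - K)" "\<beta> x = 1"
    "\<And>y. y \<notin> K \<Longrightarrow> \<beta> y = 0" "smooth_fun A (carrier A) \<beta>"
proof -
  have "x \<in> carrier A" using x W by (auto simp: openin_atlas)
  then obtain c where c: "c \<in> A" "x \<in> fst c" by (auto simp: carrier_def)
  let ?V = "snd c ` (fst c \<inter> W)"
  have "open ?V" "snd c x \<in> ?V" using openin_open[OF W c(1)] c x by auto
  then obtain r where r: "r > 0" "cball (snd c x) r \<subseteq> ?V" using open_contains_cball by blast
  obtain b :: "'e \<Rightarrow> real" where b: "smooth_on UNIV b" "b (snd c x) = 1" "\<And>y. r \<le> dist (snd c x) y \<Longrightarrow> b y = 0"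
    using bump_exists[OF r(1)] by blast
  define K where "K = chart_inv c ` cball (snd c x) r"
  define \<beta> where "\<beta> y = (if y \<in> fst c then b (snd c y) else 0)" for y
  have KW: "K \<subseteq> W \<inter> fst c" unfolding K_def using r(2) chart_inv_left[OF c(1)] by force
  have zero: "\<beta> y = 0" if "y \<notin> K" for y
  proof (cases "y \<in> fst c")
    case True
    then have "snd c y \<notin> cball (snd c x) r"
      using that chart_inv_left[OF c(1) True] unfolding K_def by (metis imageI)
    then show ?thesis using b(3) by (simp add: \<beta>_def)
  qed (simp add: \<beta>_def)
  have "continuous_map (top_of_set (snd c ` fst c)) (atlas_topology A) (chart_inv c)"
    unfolding continuous_map_def
  proof (intro conjI allI impI)
    show "chart_inv c \<in> topspace (top_of_set (snd c ` fst c)) \<rightarrow> topspace (atlas_topology A)"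
      using chart_inv_left[OF c(1)] chart_subset_carrier[OF c(1)] by (auto simp: topspace_atlas)
    fix U assume U: "openin (atlas_topology A) U"
    have "{y \<in> topspace (top_of_set (snd c ` fst c)). chart_inv c y \<in> U} = snd c ` (fst c \<inter> U)"
      using chart_inv_left[OF c(1)] by auto
    then show "openin (top_of_set (snd c ` fst c)) {y \<in> topspace (top_of_set (snd c ` fst c)). chart_inv c y \<in> U}"
      using openin_open[OF U c(1)] by (auto intro!: open_subset)
  qed
  moreover have "compactin (top_of_set (snd c ` fst c)) (cball (snd c x) r)"
    using r(2) by (auto simp: compactin_subtopology)
  ultimately have "compactin (atlas_topology A) K" unfolding K_def by (rule image_compactin[rotated])
  then have K: "openin (atlas_topology A) (carrier A - K)"
    using compactin_imp_closedin[OF haus] by (simp add: closedin_def topspace_atlas)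
  have "smooth_on (snd d ` (fst d \<inter> carrier A)) (\<beta> \<circ> chart_inv d)" if d: "d \<in> A" for d
  proof (rule smooth_on_local)
    fix z assume "z \<in> snd d ` (fst d \<inter> carrier A)"
    then obtain p where p: "p \<in> fst d" "z = snd d p" by auto
    show "\<exists>T. open T \<and> z \<in> T \<and> smooth_on T (\<beta> \<circ> chart_inv d)"
    proof (cases "p \<in> fst c")
      case True
      let ?T = "snd d ` (fst d \<inter> fst c)"
      have "smooth_on ?T (\<lambda>y. b (transition d c y))"
        by (rule smooth_on_compose[of _ _ "transition d c" b, OF open_overlap[OF d c(1)] open_UNIV
              _ smooth_transition[OF d c(1)] b(1)]) simp
      then have "smooth_on ?T (\<beta> \<circ> chart_inv d)"
        by (subst smooth_on_cong[OF open_overlap[OF d c(1)]]) (auto simp: \<beta>_def chart_inv_left[OF d])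
      then show ?thesis using open_overlap[OF d c(1)] p True by blast
    next
      case False
      let ?T = "snd d ` (fst d \<inter> (carrier A - K))"
      have T: "open ?T" using openin_open[OF K d] .
      have "smooth_on ?T (\<lambda>y. 0 :: real)" by (rule smooth_on_const)
      then have "smooth_on ?T (\<beta> \<circ> chart_inv d)"
        by (subst smooth_on_cong[OF T]) (auto simp: zero chart_inv_left[OF d])
      moreover have "p \<in> carrier A - K" using False KW p chart_subset_carrier[OF d] by auto
      ultimately show ?thesis using T p by blast
    qed
  qed
  then have "smooth_fun A (carrier A) \<beta>" using openin_carrier by (simp add: smooth_fun_def)
  then show ?thesis using that[of K \<beta>] KW K zero b(2) c by (auto simp: \<beta>_def)
qed

text \<open>The field is a smooth product on W and zero on the open complement of K, and these two
  sets cover the manifold. The domain W' is kept general because sections of the adjoint bundle are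
  tested on locally defined vector fields.\<close>

lemma smooth_vf_cutoff:
  assumes W: "openin (atlas_topology A) W" and W': "openin (atlas_topology A) W'"
    and K: "K \<subseteq> W" "openin (atlas_topology A) (carrier A - K)" "\<And>y. y \<notin> K \<Longrightarrow> \<beta> y = (0::real)"
    and \<beta>: "smooth_fun A (carrier A) \<beta>" and Y: "smooth_vf A (W \<inter> W') Y"
  shows "smooth_vf A W' (\<lambda>y. if y \<in> W then (\<lambda>d. \<beta> y *\<^sub>R Y y d) else (\<lambda>_. 0))" (is "smooth_vf A W' ?Z")
  unfolding smooth_vf_def
proof (intro conjI ballI)
  fix p assume "p \<in> W'"
  then show "?Z p \<in> tangent_space A p"
    using Y W' tangent_zero tangent_scaleR by (auto simp: smooth_vf_def openin_atlas)
next
  fix d assume d: "d \<in> A"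
  show "smooth_on (snd d ` (fst d \<inter> W')) (\<lambda>q. ?Z (chart_inv d q) d)"
  proof (rule smooth_on_local)
    fix z assume "z \<in> snd d ` (fst d \<inter> W')"
    then obtain p where p: "p \<in> fst d" "p \<in> W'" "z = snd d p" by auto
    show "\<exists>T. open T \<and> z \<in> T \<and> smooth_on T (\<lambda>q. ?Z (chart_inv d q) d)"
    proof (cases "p \<in> W")
      case True
      let ?T = "snd d ` (fst d \<inter> (W \<inter> W'))"
      have T: "open ?T" using openin_open[OF _ d] W W' by blast
      have "smooth_on ?T (\<beta> \<circ> chart_inv d)"
      proof (rule smooth_on_mono)
        show "smooth_on (snd d ` (fst d \<inter> carrier A)) (\<beta> \<circ> chart_inv d)"
          using \<beta> d by (simp add: smooth_fun_def)
        show "?T \<subseteq> snd d ` (fst d \<inter> carrier A)" using W openin_atlas by blast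
      qed
      then have "smooth_on ?T (\<lambda>q. \<beta> (chart_inv d q) *\<^sub>R Y (chart_inv d q) d)"
        using Y d by (intro smooth_intros T) (auto simp: smooth_vf_def o_def)
      then have "smooth_on ?T (\<lambda>q. ?Z (chart_inv d q) d)"
        by (subst smooth_on_cong[OF T]) (auto simp: chart_inv_left[OF d])
      then show ?thesis using T p True by blast
    next
      case False
      let ?T = "snd d ` (fst d \<inter> (carrier A - K))"
      have T: "open ?T" using openin_open[OF K(2) d] .
      have "smooth_on ?T (\<lambda>y. 0 :: 'e)" by (rule smooth_on_const)
      then have "smooth_on ?T (\<lambda>q. ?Z (chart_inv d q) d)"
        by (subst smooth_on_cong[OF T]) (auto simp: K(3) chart_inv_left[OF d])
      moreover have "p \<in> carrier A - K" using False K(1) p chart_subset_carrier[OF d] by auto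
      ultimately show ?thesis using T p by blast
    qed
  qed
qed (rule W')

end

text \<open>Since the map lands in one chart d, preimages of open sets can be computed in the
  coordinates of d, which yields continuity. The lemma serves to recognise smooth curves in the
  frame bundle.\<close>

lemma smooth_map_into_chart:
  assumes A: "smooth_atlas A" and B: "smooth_atlas B" and d: "d \<in> B"
    and W: "openin (atlas_topology A) W" and f: "f ` W \<subseteq> fst d"
    and smooth: "\<And>c. c \<in> A \<Longrightarrow> smooth_on (snd c ` (fst c \<inter> W)) (snd d \<circ> f \<circ> chart_inv c)"
  shows "smooth_map A B W f"
proof -
  interpret A: smooth_atlas A by (rule A)
  interpret B: smooth_atlas B by (rule B)
  have Wsub: "W \<subseteq> carrier A" using W A.openin_atlas by blast
  have pre: "open (snd c ` (fst c \<inter> W \<inter> f -` V))" if c: "c \<in> A" and V: "openin (atlas_topology B) V" for c V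
  proof -
    have "snd c ` (fst c \<inter> W \<inter> f -` V)
        = snd c ` (fst c \<inter> W) \<inter> (snd d \<circ> f \<circ> chart_inv c) -` (snd d ` (fst d \<inter> V))"
    proof (intro equalityI subsetI)
      fix y assume "y \<in> snd c ` (fst c \<inter> W \<inter> f -` V)"
      then show "y \<in> snd c ` (fst c \<inter> W) \<inter> (snd d \<circ> f \<circ> chart_inv c) -` (snd d ` (fst d \<inter> V))"
        using f A.chart_inv_left[OF c] by (auto simp: image_subset_iff)
    next
      fix y assume "y \<in> snd c ` (fst c \<inter> W) \<inter> (snd d \<circ> f \<circ> chart_inv c) -` (snd d ` (fst d \<inter> V))"
      then obtain x where x: "x \<in> fst c" "x \<in> W" "y = snd c x" "snd d (f x) \<in> snd d ` (fst d \<inter> V)"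
        using A.chart_inv_left[OF c] by auto
      then have "f x \<in> V" using f B.snd_in_image_iff[OF d, of "f x" V] by auto
      then show "y \<in> snd c ` (fst c \<inter> W \<inter> f -` V)" using x by auto
    qed
    moreover have "open \<dots>"
      using smooth_on_continuous[OF smooth[OF c]] A.openin_open[OF W c] B.openin_open[OF V d]
      by (rule continuous_open_preimage)
    ultimately show ?thesis by simp
  qed
  have "continuous_map (subtopology (atlas_topology A) W) (atlas_topology B) f"
    unfolding continuous_map_def
  proof (intro conjI allI impI)
    show "f \<in> topspace (subtopology (atlas_topology A) W) \<rightarrow> topspace (atlas_topology B)"
      using f B.chart_subset_carrier[OF d] by (auto simp: B.topspace_atlas)
    fix V assume V: "openin (atlas_topology B) V"
    have "openin (atlas_topology A) (W \<inter> f -` V)"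
      unfolding A.openin_atlas using pre[OF _ V] Wsub by (auto simp: Int_assoc)
    moreover have "{x \<in> topspace (subtopology (atlas_topology A) W). f x \<in> V} = W \<inter> f -` V"
      using Wsub by (auto simp: A.topspace_atlas)
    ultimately show "openin (subtopology (atlas_topology A) W)
        {x \<in> topspace (subtopology (atlas_topology A) W). f x \<in> V}"
      by (auto simp: openin_subtopology)
  qed
  moreover have "smooth_on (snd c ` (fst c \<inter> W \<inter> f -` fst d')) (snd d' \<circ> f \<circ> chart_inv c)"
    if c: "c \<in> A" and d': "d' \<in> B" for c d'
  proof -
    let ?S = "snd c ` (fst c \<inter> W \<inter> f -` fst d')"
    have S: "open ?S" using pre[OF c B.openin_chart[OF d']] .
    have "smooth_on ?S (\<lambda>y. transition d d' ((snd d \<circ> f \<circ> chart_inv c) y))"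
    proof (rule smooth_on_compose[of _ _ "snd d \<circ> f \<circ> chart_inv c" "transition d d'",
          OF S B.open_overlap[OF d d'] _ _ B.smooth_transition[OF d d']])
      show "(snd d \<circ> f \<circ> chart_inv c) ` ?S \<subseteq> snd d ` (fst d \<inter> fst d')"
        using f A.chart_inv_left[OF c] by (auto simp: image_subset_iff)
      show "smooth_on ?S (snd d \<circ> f \<circ> chart_inv c)"
        by (rule smooth_on_mono[OF smooth[OF c]]) auto
    qed
    then show ?thesis
      using f A.chart_inv_left[OF c] B.chart_inv_left[OF d]
      by (subst smooth_on_cong[OF S]) (auto simp: image_subset_iff)
  qed
  ultimately show ?thesis using W by (simp add: smooth_map_def)
qed

lemma smooth_manifold_atlas: "smooth_manifold A \<Longrightarrow> smooth_atlas A"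
  by (simp add: smooth_manifold_def smooth_atlas_def)

section \<open>The frame bundle\<close>

definition fmat :: "('a, real^'m) chart \<Rightarrow> ('a, 'm::finite) frame \<Rightarrow> real^'m^'m" where
  "fmat c p = matrix (\<lambda>\<xi>. snd p \<xi> c)"

definition frame_of ::
  "('a, real^'m::finite) chart set \<Rightarrow> ('a, real^'m) chart \<Rightarrow> 'a \<Rightarrow> real^'m^'m \<Rightarrow> ('a, 'm) frame" where
  "frame_of A c x M = (x, \<lambda>\<xi>. tvec_of A x c (M *v \<xi>))"

definition jac :: "('a, real^'m::finite) chart \<Rightarrow> ('a, real^'m) chart \<Rightarrow> real^'m \<Rightarrow> real^'m^'m" where
  "jac c d y = matrix (FD (transition c d) y)"

abbreviation hess ::
  "('a, real^'m::finite) chart \<Rightarrow> ('a, real^'m) chart \<Rightarrow> 'a \<Rightarrow> real^'m \<Rightarrow> real^'m^'m" where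
  "hess c d x \<equiv> FD (jac c d) (snd c x)"

lemma framesD:
  assumes "p \<in> frames A"
  shows "fst p \<in> carrier A" "linear (\<lambda>\<xi>. snd p \<xi> c)" "bij_betw (snd p) UNIV (tangent_space A (fst p))"
    "snd p \<xi> \<in> tangent_space A (fst p)"
proof -
  show "fst p \<in> carrier A" and b: "bij_betw (snd p) UNIV (tangent_space A (fst p))"
    using assms by (auto simp: frames_def)
  show "linear (\<lambda>\<xi>. snd p \<xi> c)" using assms unfolding frames_def by (cases c) (simp add: case_prod_beta)
  show "snd p \<xi> \<in> tangent_space A (fst p)" using b by (auto simp: bij_betw_def)
qed

lemma fmat_apply: "p \<in> frames A \<Longrightarrow> fmat c p *v \<xi> = snd p \<xi> c"
  by (simp add: fmat_def matrix_works framesD(2))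

lemma fst_frame_of [simp]: "fst (frame_of A c x M) = x"
  by (simp add: frame_of_def)

lemma fst_frame_chart: "fst (frame_chart A c) = {p \<in> frames A. fst p \<in> fst c}"
  by (simp add: frame_chart_def)

lemma snd_frame_chart: "snd (frame_chart A c) p = (snd c (fst p), fmat c p)"
  by (simp add: frame_chart_def fmat_def)

lemma fst_act [simp]: "fst (act p g) = fst p"
  by (simp add: act_def)

lemma act_one: "act p (mat 1) = p"
  by (simp add: act_def)

lemma act_frames:
  assumes p: "p \<in> frames A" and g: "invertible g"
  shows "act p g \<in> frames A"
proof -
  have "bij ((*v) g)"
    by (rule bijI') (use matrix_inv_vector_cancel[OF g] in metis)+
  then have "bij_betw (snd p \<circ> (*v) g) UNIV (tangent_space A (fst p))"
    using framesD(3)[OF p] by (rule bij_betw_trans)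
  moreover have "linear (\<lambda>\<xi>. snd p (g *v \<xi>) c)" for c
    using linear_compose[OF matrix_vector_mul_linear framesD(2)[OF p]] by (simp add: o_def)
  ultimately show ?thesis using framesD(1)[OF p] by (simp add: frames_def act_def o_def split: prod.splits)
qed

lemma fmat_act: "p \<in> frames A \<Longrightarrow> fmat c (act p g) = fmat c p ** g"
proof (rule matrix_ext)
  fix x assume p: "p \<in> frames A"
  have "linear (\<lambda>\<xi>. snd p (g *v \<xi>) c)"
    using linear_compose[OF matrix_vector_mul_linear framesD(2)[OF p]] by (simp add: o_def)
  then show "fmat c (act p g) *v x = (fmat c p ** g) *v x"
    unfolding fmat_def[of c "act p g"]
    by (simp add: act_def matrix_works fmat_apply[OF p] matrix_vector_mul_assoc[symmetric])
qed

locale smooth_atlas_vec = smooth_atlas A for A :: "('a, real^'m::finite) chart set"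
begin

lemma fmat_invertible:
  assumes p: "p \<in> frames A" and c: "c \<in> charts_at A (fst p)"
  shows "invertible (fmat c p)"
proof -
  have "surj ((*v) (fmat c p))"
  proof (rule surjI)
    fix \<eta>
    have "tvec_of A (fst p) c \<eta> \<in> range (snd p)"
      using tvec_of_tangent[OF c] framesD(3)[OF p] by (simp add: bij_betw_def)
    then have "snd p (inv (snd p) (tvec_of A (fst p) c \<eta>)) = tvec_of A (fst p) c \<eta>" by (rule f_inv_into_f)
    then show "fmat c p *v inv (snd p) (tvec_of A (fst p) c \<eta>) = \<eta>"
      by (simp add: fmat_apply[OF p] tvec_of_self[OF c])
  qed
  then show ?thesis
    by (simp add: invertible_right_inverse matrix_right_invertible_surjective)
qed

lemma inv_frame:
  assumes p: "p \<in> frames A" and c: "c \<in> charts_at A (fst p)" and w: "w \<in> tangent_space A (fst p)"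
  shows "inv (snd p) w = matrix_inv (fmat c p) *v w c" "snd p (inv (snd p) w) = w"
proof -
  have "w \<in> range (snd p)" using framesD(3)[OF p] w by (simp add: bij_betw_def)
  then show *: "snd p (inv (snd p) w) = w" by (rule f_inv_into_f)
  have "fmat c p *v inv (snd p) w = w c" by (simp add: fmat_apply[OF p] *)
  then show "inv (snd p) w = matrix_inv (fmat c p) *v w c"
    using matrix_inv_vector_cancel(2)[OF fmat_invertible[OF p c]] by metis
qed

lemma frame_of_frame:
  assumes c: "c \<in> charts_at A x" and M: "invertible M"
  shows "frame_of A c x M \<in> frames A" "fmat c (frame_of A c x M) = M"
proof -
  have lin: "linear (\<lambda>\<xi>. tvec_of A x c (M *v \<xi>) d)" for d
    using linear_compose[OF matrix_vector_mul_linear tvec_of_linear[OF c]] by (simp add: o_def)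
  have "bij_betw (\<lambda>\<xi>. tvec_of A x c (M *v \<xi>)) UNIV (tangent_space A x)"
    by (rule bij_betw_byWitness[where f' = "\<lambda>v. matrix_inv M *v v c"])
      (auto simp: tvec_of_self[OF c] matrix_inv_vector_cancel[OF M] tangent_eq_tvec_of[OF _ c] tvec_of_tangent[OF c])
  then show "frame_of A c x M \<in> frames A"
    using lin charts_atD[OF c] chart_subset_carrier[of c] by (auto simp: frames_def frame_of_def)
  show "fmat c (frame_of A c x M) = M"
    by (rule matrix_ext) (simp add: fmat_def frame_of_def matrix_works lin[of c] tvec_of_self[OF c])
qed

lemma frame_eqI:
  assumes "p \<in> frames A" "q \<in> frames A" "fst p = fst q" "c \<in> charts_at A (fst p)" "fmat c p = fmat c q"
  shows "p = q"
proof -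
  have "snd p \<xi> = snd q \<xi>" for \<xi>
    using tangent_eqI[of "snd p \<xi>" "fst p" "snd q \<xi>" c] assms framesD(4) fmat_apply by metis
  then show ?thesis using assms(3) by (auto simp: prod_eq_iff)
qed

lemma frame_of_fmat:
  assumes "p \<in> frames A" "c \<in> charts_at A (fst p)"
  shows "frame_of A c (fst p) (fmat c p) = p"
  using frame_of_frame[OF assms(2) fmat_invertible[OF assms]] assms
  by (intro frame_eqI[of _ p c]) auto

lemma jac_apply: "c \<in> charts_at A x \<Longrightarrow> d \<in> charts_at A x \<Longrightarrow> jac c d (snd c x) *v \<xi> = FD (transition c d) (snd c x) \<xi>"
  using bounded_linear.linear[OF FD_linear[OF differentiable_transition[of c x d]]]
  by (simp add: jac_def matrix_works)

lemma jac_inverse: "c \<in> charts_at A x \<Longrightarrow> d \<in> charts_at A x \<Longrightarrow> jac d c (snd d x) ** jac c d (snd c x) = mat 1"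
  by (rule matrix_ext) (simp add: matrix_vector_mul_assoc[symmetric] jac_apply FD_transition_inverse)

lemma jac_invertible: "c \<in> charts_at A x \<Longrightarrow> d \<in> charts_at A x \<Longrightarrow> invertible (jac c d (snd c x))"
  using jac_inverse unfolding invertible_def by blast

lemma tangent_jac:
  "v \<in> tangent_space A x \<Longrightarrow> c \<in> charts_at A x \<Longrightarrow> d \<in> charts_at A x \<Longrightarrow> v d = jac c d (snd c x) *v v c"
  using tangent_component jac_apply by metis

lemma fmat_change:
  assumes "p \<in> frames A" "c \<in> charts_at A (fst p)" "d \<in> charts_at A (fst p)"
  shows "fmat d p = jac c d (snd c (fst p)) ** fmat c p"
  by (rule matrix_ext)
    (simp add: matrix_vector_mul_assoc[symmetric] fmat_apply[OF assms(1)]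
      tangent_jac[OF framesD(4)[OF assms(1)] assms(2,3)])

lemma smooth_jac:
  assumes "c \<in> A" "d \<in> A"
  shows "smooth_on (snd c ` (fst c \<inter> fst d)) (jac c d)"
proof -
  have "smooth_on (snd c ` (fst c \<inter> fst d)) (\<lambda>y. \<chi> i j. FD (transition c d) y (axis j 1) $ i)"
    by (intro smooth_intros open_overlap smooth_on_FD_const smooth_transition assms)
  then show ?thesis by (simp add: jac_def[abs_def] matrix_def)
qed

lemma overlap_point:
  assumes "c \<in> charts_at A x" "d \<in> charts_at A x"
  shows "open (snd c ` (fst c \<inter> fst d))" "snd c x \<in> snd c ` (fst c \<inter> fst d)"
  using assms open_overlap by (auto simp: charts_at_def)

lemma differentiable_jac:
  "c \<in> charts_at A x \<Longrightarrow> d \<in> charts_at A x \<Longrightarrow> jac c d differentiable (at (snd c x))"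
  using overlap_point smooth_jac charts_atD by (blast intro: smooth_on_differentiable)

lemma jac_has_derivative:
  "c \<in> charts_at A x \<Longrightarrow> d \<in> charts_at A x \<Longrightarrow> (jac c d has_derivative hess c d x) (at (snd c x))"
  by (rule FD_works[OF differentiable_jac])

lemma linear_hess: "c \<in> charts_at A x \<Longrightarrow> d \<in> charts_at A x \<Longrightarrow> linear (hess c d x)"
  using FD_linear[OF differentiable_jac] by (rule bounded_linear.linear)

text \<open>Schwarz's theorem for the transition map. This symmetry makes the coordinate expression
  of the torsion tensorial and the trace condition independent of the chart.\<close>

lemma hess_symmetric:
  assumes c: "c \<in> charts_at A x" and d: "d \<in> charts_at A x"
  shows "hess c d x \<xi> *v \<eta> = hess c d x \<eta> *v \<xi>"
proof -
  let ?S = "snd c ` (fst c \<inter> fst d)"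
  note S = overlap_point[OF c d]
  have cd: "c \<in> A" "d \<in> A" using c d charts_atD by auto
  have "FD (\<lambda>y. FD (transition c d) y \<eta>) (snd c x) \<xi> = hess c d x \<xi> *v \<eta>" for \<xi> \<eta>
  proof -
    have "FD (\<lambda>y. FD (transition c d) y \<eta>) (snd c x) = FD (\<lambda>y. jac c d y *v \<eta>) (snd c x)"
    proof (rule FD_cong[OF S])
      fix y assume "y \<in> ?S"
      then obtain p where "p \<in> fst c" "p \<in> fst d" "y = snd c p" by auto
      then show "FD (transition c d) y \<eta> = jac c d y *v \<eta>"
        using jac_apply[of c p d \<eta>] cd by (simp add: charts_at_def)
    qed
    moreover have "FD (\<lambda>y. jac c d y *v \<eta>) (snd c x) \<xi> = hess c d x \<xi> *v \<eta>"
      by (subst FD_eq[OF bounded_linear.has_derivative[OF mv.bounded_linear_left jac_has_derivative[OF c d]]]) simp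
    ultimately show ?thesis by simp
  qed
  then show ?thesis using FD_symmetric[OF S(1) smooth_transition[OF cd] S(2), of \<eta> \<xi>] by metis
qed

abbreviation "FA \<equiv> frame_atlas A"
abbreviation "fc \<equiv> frame_chart A"

lemma frame_charts_at: "p \<in> frames A \<Longrightarrow> charts_at FA p = fc ` charts_at A (fst p)"
  by (auto simp: charts_at_def frame_atlas_def fst_frame_chart)

lemma frame_charts_atI: "p \<in> frames A \<Longrightarrow> c \<in> charts_at A (fst p) \<Longrightarrow> fc c \<in> charts_at FA p"
  by (simp add: frame_charts_at)

lemma frame_chart_image:
  assumes c: "c \<in> A"
  shows "snd (fc c) ` {p \<in> frames A. fst p \<in> fst c \<inter> W} = snd c ` (fst c \<inter> W) \<times> {M :: real^'m^'m. invertible M}"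
proof (intro equalityI subsetI)
  fix z assume "z \<in> snd (fc c) ` {p \<in> frames A. fst p \<in> fst c \<inter> W}"
  then obtain p where "p \<in> frames A" "fst p \<in> fst c \<inter> W" "z = (snd c (fst p), fmat c p)"
    by (auto simp: snd_frame_chart)
  then show "z \<in> snd c ` (fst c \<inter> W) \<times> {M :: real^'m^'m. invertible M}"
    using fmat_invertible[of p c] c by (auto simp: charts_at_def)
next
  fix z assume "z \<in> snd c ` (fst c \<inter> W) \<times> {M :: real^'m^'m. invertible M}"
  then obtain x M where z: "x \<in> fst c \<inter> W" "invertible M" "z = (snd c x, M)" by auto
  then have "c \<in> charts_at A x" using c by (simp add: charts_at_def)
  then show "z \<in> snd (fc c) ` {p \<in> frames A. fst p \<in> fst c \<inter> W}"
    using frame_of_frame[of c x M] z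
    by (intro image_eqI[of _ _ "frame_of A c x M"]) (auto simp: snd_frame_chart)
qed

lemma frame_chart_inj: "c \<in> A \<Longrightarrow> inj_on (snd (fc c)) (fst (fc c))"
proof (rule inj_onI)
  fix p q assume *: "c \<in> A" "p \<in> fst (fc c)" "q \<in> fst (fc c)" "snd (fc c) p = snd (fc c) q"
  then have "fst p = fst q" using inj_chart[of c] by (auto simp: fst_frame_chart snd_frame_chart inj_on_def)
  then show "p = q"
    using * by (intro frame_eqI[of p q c]) (auto simp: fst_frame_chart snd_frame_chart charts_at_def)
qed

lemma frame_chart_inv:
  assumes c: "c \<in> charts_at A x" and N: "invertible N"
  shows "chart_inv (fc c) (snd c x, N) = frame_of A c x N"
proof -
  have "snd (fc c) (frame_of A c x N) = (snd c x, N)"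
    by (simp add: snd_frame_chart frame_of_frame[OF assms])
  moreover have "frame_of A c x N \<in> fst (fc c)"
    using frame_of_frame[OF assms] c by (auto simp: fst_frame_chart charts_at_def)
  ultimately show ?thesis
    using inv_into_f_f[OF frame_chart_inj] c charts_atD by metis
qed

lemma frame_transition:
  assumes c: "c \<in> charts_at A x" and d: "d \<in> charts_at A x" and N: "invertible N"
  shows "transition (fc c) (fc d) (snd c x, N) = (transition c d (snd c x), jac c d (snd c x) ** N)"
  using fmat_change[of "frame_of A c x N" c d] frame_of_frame[OF c N] c d charts_atD chart_inv_left
  by (simp add: frame_chart_inv[OF c N] snd_frame_chart)

lemma overlap_fc: "fst (fc c) \<inter> fst (fc d) = {p \<in> frames A. fst p \<in> fst c \<inter> fst d}"
  by (auto simp: fst_frame_chart)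

lemma smooth_frame_transition:
  assumes "c \<in> A" "d \<in> A"
  shows "smooth_on (snd c ` (fst c \<inter> fst d) \<times> {M :: real^'m^'m. invertible M})
    (\<lambda>z. (transition c d (fst z), jac c d (fst z) ** snd z))"
proof -
  let ?T = "snd c ` (fst c \<inter> fst d)"
  let ?S = "?T \<times> {M :: real^'m^'m. invertible M}"
  have S: "open ?S" using open_overlap[OF assms] open_invertible by (rule open_Times)
  have "smooth_on ?S (\<lambda>z. F (fst z))" if "smooth_on ?T F" for F :: "_ \<Rightarrow> 'z::euclidean_space"
    by (rule smooth_on_compose[of _ _ fst F, OF S open_overlap[OF assms] _ smooth_on_fst_proj that]) auto
  from this[OF smooth_transition[OF assms]] this[OF smooth_jac[OF assms]] show ?thesis
    by (intro smooth_on_Pair smooth_on_matrix_mult S smooth_on_snd_proj)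
qed

text \<open>Frame charts change by the transition of base points together with left multiplication
  of the frame matrix by the Jacobian, on the product of an open set with the open set of invertible
  matrices.\<close>

lemma smooth_atlas_frame: "smooth_atlas FA"
proof
  fix C assume "C \<in> FA"
  then show "inj_on (snd C) (fst C)" using frame_chart_inj by (auto simp: frame_atlas_def)
next
  fix C D assume "C \<in> FA" "D \<in> FA"
  then obtain c d where cd: "c \<in> A" "d \<in> A" "C = fc c" "D = fc d" by (auto simp: frame_atlas_def)
  have im: "snd C ` (fst C \<inter> fst D) = snd c ` (fst c \<inter> fst d) \<times> {M :: real^'m^'m. invertible M}"
    unfolding cd overlap_fc by (rule frame_chart_image[OF cd(1)])
  show op: "open (snd C ` (fst C \<inter> fst D))"
    unfolding im using open_overlap[OF cd(1,2)] open_invertible by (rule open_Times)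
  show "smooth_on (snd C ` (fst C \<inter> fst D)) (transition C D)"
    unfolding im
  proof (subst smooth_on_cong)
    show "open (snd c ` (fst c \<inter> fst d) \<times> {M :: real^'m^'m. invertible M})" using op im by simp
    show "smooth_on (snd c ` (fst c \<inter> fst d) \<times> {M :: real^'m^'m. invertible M})
        (\<lambda>z. (transition c d (fst z), jac c d (fst z) ** snd z))"
      by (rule smooth_frame_transition[OF cd(1,2)])
    fix z assume "z \<in> snd c ` (fst c \<inter> fst d) \<times> {M :: real^'m^'m. invertible M}"
    then obtain x N where x: "x \<in> fst c" "x \<in> fst d" "invertible N" "z = (snd c x, N)" by auto
    then have "c \<in> charts_at A x" "d \<in> charts_at A x" using cd by (auto simp: charts_at_def)
    then show "transition C D z = (transition c d (fst z), jac c d (fst z) ** snd z)"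
      using frame_transition[of c x d N] x cd(3,4) by simp
  qed
qed

sublocale FA: smooth_atlas FA by (rule smooth_atlas_frame)

text \<open>Differentiating the frame matrix \<open>jac ** M\<close> also hits the Jacobian. The
  resulting Hessian term is the source of the inhomogeneous transformation law of connection
  coefficients.\<close>

lemma FD_frame_transition:
  assumes p: "p \<in> frames A" and c: "c \<in> charts_at A (fst p)" and d: "d \<in> charts_at A (fst p)"
  shows "FD (transition (fc c) (fc d)) (snd (fc c) p) \<zeta> =
    (jac c d (snd c (fst p)) *v fst \<zeta>,
     hess c d (fst p) (fst \<zeta>) ** fmat c p + jac c d (snd c (fst p)) ** snd \<zeta>)"
proof -
  let ?S = "snd c ` (fst c \<inter> fst d) \<times> {M :: real^'m^'m. invertible M}"
  let ?F = "\<lambda>z. (transition c d (fst z), jac c d (fst z) ** snd z)"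
  have S: "open ?S" using overlap_point(1)[OF c d] open_invertible by (rule open_Times)
  have mem: "snd (fc c) p \<in> ?S"
    using overlap_point(2)[OF c d] fmat_invertible[OF p c] by (simp add: snd_frame_chart)
  have eq: "transition (fc c) (fc d) z = ?F z" if "z \<in> ?S" for z
  proof -
    obtain x N where x: "x \<in> fst c" "x \<in> fst d" "invertible N" "z = (snd c x, N)" using \<open>z \<in> ?S\<close> by auto
    then have "c \<in> charts_at A x" "d \<in> charts_at A x" using c d by (auto simp: charts_at_def)
    then show ?thesis using frame_transition[of c x d N] x by simp
  qed
  let ?y = "snd c (fst p)" and ?M = "fmat c p"
  have t: "((\<lambda>z. transition c d (fst z)) has_derivative (\<lambda>\<zeta>. FD (transition c d) ?y (fst \<zeta>))) (at (?y, ?M))"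
    using diff_chain_at[OF bounded_linear_imp_has_derivative[OF bounded_linear_fst], of "transition c d" "FD (transition c d) ?y" "(?y, ?M)"]
      FD_works[OF differentiable_transition[OF c d]] by (simp add: o_def)
  have j: "((\<lambda>z. jac c d (fst z)) has_derivative (\<lambda>\<zeta>. hess c d (fst p) (fst \<zeta>))) (at (?y, ?M))"
    using diff_chain_at[OF bounded_linear_imp_has_derivative[OF bounded_linear_fst], of "jac c d" "hess c d (fst p)" "(?y, ?M)"]
      jac_has_derivative[OF c d] by (simp add: o_def)
  have "(?F has_derivative (\<lambda>\<zeta>. (FD (transition c d) ?y (fst \<zeta>),
      jac c d (fst (?y, ?M)) ** snd \<zeta> + hess c d (fst p) (fst \<zeta>) ** snd (?y, ?M)))) (at (?y, ?M))"
    by (intro has_derivative_Pair t mm.FDERIV[OF j]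
        bounded_linear_imp_has_derivative[OF bounded_linear_snd])
  then have "FD ?F (?y, ?M) \<zeta> = (FD (transition c d) ?y (fst \<zeta>), jac c d ?y ** snd \<zeta> + hess c d (fst p) (fst \<zeta>) ** ?M)"
    by (rule FD_eq[THEN fun_cong, THEN trans]) simp
  moreover have "FD (transition (fc c) (fc d)) (snd (fc c) p) = FD ?F (snd (fc c) p)"
    by (rule FD_cong[OF S mem eq])
  ultimately show ?thesis
    by (simp add: snd_frame_chart jac_apply[OF c d] add.commute)
qed

abbreviation "ftvec p c \<equiv> tvec_of FA p (fc c)"

lemma ftvec_component:
  assumes p: "p \<in> frames A" and c: "c \<in> charts_at A (fst p)" and d: "d \<in> charts_at A (fst p)"
  shows "ftvec p c \<zeta> (fc d) = (jac c d (snd c (fst p)) *v fst \<zeta>,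
     hess c d (fst p) (fst \<zeta>) ** fmat c p + jac c d (snd c (fst p)) ** snd \<zeta>)"
  unfolding tvec_of_def using frame_charts_atI[OF p d] by (simp only: FD_frame_transition[OF assms] if_True)

lemma ftvec_eqI:
  assumes p: "p \<in> frames A" and c: "c \<in> charts_at A (fst p)"
    and "\<And>D. D \<notin> charts_at FA p \<Longrightarrow> w D = 0"
    and "\<And>d. d \<in> charts_at A (fst p) \<Longrightarrow> w (fc d) = (jac c d (snd c (fst p)) *v fst \<zeta>,
     hess c d (fst p) (fst \<zeta>) ** fmat c p + jac c d (snd c (fst p)) ** snd \<zeta>)"
  shows "w = ftvec p c \<zeta>"
proof
  fix D
  show "w D = ftvec p c \<zeta> D"
  proof (cases "D \<in> charts_at FA p")
    case True
    then obtain d where "d \<in> charts_at A (fst p)" "D = fc d" using frame_charts_at[OF p] by auto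
    then show ?thesis using assms(4) ftvec_component[OF p c] by simp
  next
    case False
    then show ?thesis using assms(3) by (simp add: tvec_of_def)
  qed
qed

lemma frame_tangent_component:
  assumes p: "p \<in> frames A" and c: "c \<in> charts_at A (fst p)" and d: "d \<in> charts_at A (fst p)"
    and v: "v \<in> tangent_space FA p"
  shows "v (fc d) = (jac c d (snd c (fst p)) *v fst (v (fc c)),
     hess c d (fst p) (fst (v (fc c))) ** fmat c p + jac c d (snd c (fst p)) ** snd (v (fc c)))"
  using ftvec_component[OF p c d, of "v (fc c)"] FA.tangent_eq_tvec_of[OF v frame_charts_atI[OF p c]] by simp

lemma fundamental_vector_eq:
  assumes p: "p \<in> frames A" and c: "c \<in> charts_at A (fst p)"
  shows "fundamental_vector A p a = ftvec p c (0, fmat c p ** a)"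
proof (rule ftvec_eqI[OF p c])
  fix d assume d: "d \<in> charts_at A (fst p)"
  have "((\<lambda>g. (snd d (fst p), fmat d p ** g)) has_derivative (\<lambda>g. (0, fmat d p ** g))) (at (mat 1))"
    by (intro has_derivative_Pair has_derivative_const bounded_linear_imp_has_derivative mm.bounded_linear_right)
  then have "FD (\<lambda>g. snd (fc d) (act p g)) (mat 1) a = (0, fmat d p ** a)"
    by (subst FD_eq) (simp_all add: snd_frame_chart fmat_act[OF p])
  then show "fundamental_vector A p a (fc d) = (jac c d (snd c (fst p)) *v fst (0, fmat c p ** a),
     hess c d (fst p) (fst (0, fmat c p ** a)) ** fmat c p + jac c d (snd c (fst p)) ** snd (0, fmat c p ** a))"
    using frame_charts_atI[OF p d] linear_0[OF linear_hess[OF c d]]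
    by (simp add: fundamental_vector_def fmat_change[OF p c d] matrix_mul_assoc)
qed (simp add: fundamental_vector_def)

lemma frame_nbhd:
  assumes p: "p \<in> frames A" and c: "c \<in> charts_at A (fst p)" and W: "openin (atlas_topology A) W" "fst p \<in> W"
  shows "open (snd c ` (fst c \<inter> W) \<times> {M :: real^'m^'m. invertible M})"
    "snd (fc c) p \<in> snd c ` (fst c \<inter> W) \<times> {M :: real^'m^'m. invertible M}"
  using openin_open[OF W(1)] c W(2) open_invertible fmat_invertible[OF p c]
  by (auto simp: snd_frame_chart charts_at_def intro!: open_Times)

text \<open>In every frame chart right translation is the linear map that sends (y, M) to (y, M
  g).\<close>

lemma pushforward_act:
  assumes p: "p \<in> frames A" and c: "c \<in> charts_at A (fst p)" and v: "v \<in> tangent_space FA p" and g: "invertible g"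
  shows "pushforward FA FA (\<lambda>q. act q g) p v = ftvec (act p g) c (fst (v (fc c)), snd (v (fc c)) ** g)"
proof (rule ftvec_eqI)
  show "act p g \<in> frames A" using act_frames[OF p g] .
  show "c \<in> charts_at A (fst (act p g))" using c by simp
  fix d assume "d \<in> charts_at A (fst (act p g))"
  then have d: "d \<in> charts_at A (fst p)" by simp
  let ?S = "snd d ` (fst d \<inter> carrier A) \<times> {M :: real^'m^'m. invertible M}"
  note S = frame_nbhd[OF p d openin_carrier framesD(1)[OF p]]
  have eq: "(snd (fc d) \<circ> (\<lambda>q. act q g) \<circ> chart_inv (fc d)) z = (fst z, snd z ** g)" if z: "z \<in> ?S" for z
  proof -
    obtain x N where x: "x \<in> fst d" "invertible N" "z = (snd d x, N)" using z by auto
    then have dx: "d \<in> charts_at A x" using d by (auto simp: charts_at_def)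
    show ?thesis
      using x frame_of_frame[OF dx x(2)]
      by (simp add: frame_chart_inv[OF dx] snd_frame_chart fmat_act)
  qed
  have hd: "((\<lambda>z. (fst z, snd z ** g)) has_derivative (\<lambda>z. (fst z, snd z ** g))) (at z)" for z :: "(real^'m) \<times> (real^'m^'m)"
    by (intro has_derivative_Pair bounded_linear_imp_has_derivative
        bounded_linear_fst bounded_linear_compose[OF mm.bounded_linear_left bounded_linear_snd])
  then have hd': "((snd (fc d) \<circ> (\<lambda>q. act q g) \<circ> chart_inv (fc d)) has_derivative (\<lambda>z. (fst z, snd z ** g)))
      (at (snd (fc d) p))"
    using has_derivative_cong_open[OF S, of "snd (fc d) \<circ> (\<lambda>q. act q g) \<circ> chart_inv (fc d)" "\<lambda>z. (fst z, snd z ** g)"] eq by simp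
  have "dir_deriv FA (snd (fc d) \<circ> (\<lambda>q. act q g)) p v = (fst (v (fc d)), snd (v (fc d)) ** g)"
    using FA.dir_deriv_chart[OF frame_charts_atI[OF p d] v, of "snd (fc d) \<circ> (\<lambda>q. act q g)"] hd'
    by (auto simp: differentiable_def FD_eq[OF hd'])
  then have "pushforward FA FA (\<lambda>q. act q g) p v (fc d) = (fst (v (fc d)), snd (v (fc d)) ** g)"
    using frame_charts_atI[OF act_frames[OF p g], of d] d by (simp add: pushforward_def)
  then show "pushforward FA FA (\<lambda>q. act q g) p v (fc d) =
      (jac c d (snd c (fst (act p g))) *v fst (fst (v (fc c)), snd (v (fc c)) ** g),
       hess c d (fst (act p g)) (fst (fst (v (fc c)), snd (v (fc c)) ** g)) ** fmat c (act p g) +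
       jac c d (snd c (fst (act p g))) ** snd (fst (v (fc c)), snd (v (fc c)) ** g))"
    by (simp add: frame_tangent_component[OF p c d v] fmat_act[OF p] mm_distrib matrix_mul_assoc)
qed (simp add: pushforward_def)

lemma pushforward_fst:
  assumes p: "p \<in> frames A" and c: "c \<in> charts_at A (fst p)" and v: "v \<in> tangent_space FA p"
  shows "pushforward FA A fst p v c = fst (v (fc c))"
proof -
  let ?S = "snd c ` (fst c \<inter> carrier A) \<times> {M :: real^'m^'m. invertible M}"
  note S = frame_nbhd[OF p c openin_carrier framesD(1)[OF p]]
  have eq: "(snd c \<circ> fst \<circ> chart_inv (fc c)) z = fst z" if z: "z \<in> ?S" for z
  proof -
    obtain x N where x: "x \<in> fst c" "invertible N" "z = (snd c x, N)" using z by auto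
    then have "c \<in> charts_at A x" using c by (auto simp: charts_at_def)
    then show ?thesis using x by (simp add: frame_chart_inv)
  qed
  have hd: "((snd c \<circ> fst \<circ> chart_inv (fc c)) has_derivative fst) (at (snd (fc c) p))"
    using has_derivative_cong_open[OF S, of "snd c \<circ> fst \<circ> chart_inv (fc c)" fst] eq
      bounded_linear_imp_has_derivative[OF bounded_linear_fst] by blast
  have "dir_deriv FA (snd c \<circ> fst) p v = fst (v (fc c))"
    using FA.dir_deriv_chart[OF frame_charts_atI[OF p c] v, of "snd c \<circ> fst"] hd
    by (auto simp: differentiable_def FD_eq[OF hd])
  then show ?thesis using c by (simp add: pushforward_def)
qed

section \<open>Linear connections and torsion\<close>

text \<open>The Christoffel form: the connection form on the vector that moves the base point along
  \<xi> while the frame matrix stays the identity in the chart.\<close>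

definition conn_coeff :: "(('a, 'm) frame \<Rightarrow> ('a, 'm) frame_tvec \<Rightarrow> real^'m^'m) \<Rightarrow>
    ('a, real^'m) chart \<Rightarrow> 'a \<Rightarrow> real^'m \<Rightarrow> real^'m^'m" where
  "conn_coeff \<omega> c x \<xi> = \<omega> (frame_of A c x (mat 1)) (ftvec (frame_of A c x (mat 1)) c (\<xi>, 0))"

lemma connection_linear:
  assumes "linear_connection A \<omega>" and p: "p \<in> frames A" and c: "c \<in> charts_at A (fst p)"
  shows "linear (\<lambda>\<zeta>. \<omega> p (ftvec p c \<zeta>))"
proof (rule linearI)
  note C = frame_charts_atI[OF p c]
  have lin: "\<omega> p (\<lambda>d. a *\<^sub>R v d + b *\<^sub>R w d) = a *\<^sub>R \<omega> p v + b *\<^sub>R \<omega> p w"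
    if "v \<in> tangent_space FA p" "w \<in> tangent_space FA p" for v w a b
    using assms(1) p that unfolding linear_connection_def by blast
  have tv: "ftvec p c (a *\<^sub>R \<zeta> + b *\<^sub>R \<zeta>') = (\<lambda>d. a *\<^sub>R ftvec p c \<zeta> d + b *\<^sub>R ftvec p c \<zeta>' d)" for a b \<zeta> \<zeta>'
    by (rule ext) (simp add: linear_add[OF FA.tvec_of_linear[OF C]] linear_cmul[OF FA.tvec_of_linear[OF C]])
  show "\<omega> p (ftvec p c (\<zeta> + \<zeta>')) = \<omega> p (ftvec p c \<zeta>) + \<omega> p (ftvec p c \<zeta>')" for \<zeta> \<zeta>'
    using tv[of 1 \<zeta> 1 \<zeta>'] lin[OF FA.tvec_of_tangent[OF C] FA.tvec_of_tangent[OF C], of 1 \<zeta> 1 \<zeta>'] by simp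
  show "\<omega> p (ftvec p c (a *\<^sub>R \<zeta>)) = a *\<^sub>R \<omega> p (ftvec p c \<zeta>)" for a \<zeta>
    using tv[of a \<zeta> 0 0] lin[OF FA.tvec_of_tangent[OF C] FA.tvec_of_tangent[OF C], of a \<zeta> 0 0] by simp
qed

text \<open>A vector (\<xi>, N) at a frame with matrix M splits into (\<xi>, 0), the right translate
  by M of the same vector at the coordinate frame, and (0, N), the fundamental vector of the inverse
  of M times N. Equivariance and the normalisation on fundamental vectors fix \<omega> on the two
  parts.\<close>

lemma connection_formula:
  assumes \<omega>: "linear_connection A \<omega>" and p: "p \<in> frames A" and c: "c \<in> charts_at A (fst p)"
    and v: "v \<in> tangent_space FA p"
  shows "\<omega> p v = matrix_inv (fmat c p) ** (snd (v (fc c)) + conn_coeff \<omega> c (fst p) (fst (v (fc c))) ** fmat c p)"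
proof -
  let ?M = "fmat c p" and ?q = "frame_of A c (fst p) (mat 1)"
  obtain \<xi> N where vc: "v (fc c) = (\<xi>, N)" by (cases "v (fc c)")
  note M = fmat_invertible[OF p c] and q = frame_of_frame[OF c invertible_mat_1]
  have cq: "c \<in> charts_at A (fst ?q)" using c by simp
  have "v = ftvec p c ((\<xi>, 0) + (0, ?M ** (matrix_inv ?M ** N)))"
    using FA.tangent_eq_tvec_of[OF v frame_charts_atI[OF p c]] by (simp add: vc matrix_inv_cancel[OF M])
  then have "\<omega> p v = \<omega> p (ftvec p c (\<xi>, 0)) + \<omega> p (fundamental_vector A p (matrix_inv ?M ** N))"
    using linear_add[OF connection_linear[OF \<omega> p c]] by (simp only: fundamental_vector_eq[OF p c])
  also have "\<omega> p (fundamental_vector A p (matrix_inv ?M ** N)) = matrix_inv ?M ** N"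
    using \<omega> p by (simp add: linear_connection_def)
  also have "\<omega> p (ftvec p c (\<xi>, 0)) = matrix_inv ?M ** conn_coeff \<omega> c (fst p) \<xi> ** ?M"
  proof -
    have act: "act ?q ?M = p"
      using frame_eqI[of "act ?q ?M" p c] act_frames[OF q(1) M] p c by (simp add: fmat_act[OF q(1)] q(2))
    have t: "ftvec ?q c (\<xi>, 0) \<in> tangent_space FA ?q"
      using FA.tvec_of_tangent[OF frame_charts_atI[OF q(1) cq]] .
    have "pushforward FA FA (\<lambda>q. act q ?M) ?q (ftvec ?q c (\<xi>, 0)) = ftvec p c (\<xi>, 0)"
      using pushforward_act[OF q(1) cq t M] FA.tvec_of_self[OF frame_charts_atI[OF q(1) cq]] by (simp add: act)
    moreover have "\<omega> (act ?q ?M) (pushforward FA FA (\<lambda>q. act q ?M) ?q (ftvec ?q c (\<xi>, 0)))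
        = matrix_inv ?M ** \<omega> ?q (ftvec ?q c (\<xi>, 0)) ** ?M"
      using \<omega> q(1) t M by (simp add: linear_connection_def)
    ultimately show ?thesis by (simp add: act conn_coeff_def)
  qed
  finally show ?thesis by (simp add: vc mm_distrib matrix_mul_assoc add.commute)
qed

lemma linear_conn_coeff:
  assumes "linear_connection A \<omega>" "c \<in> charts_at A x"
  shows "linear (conn_coeff \<omega> c x)"
proof -
  have "linear (\<lambda>\<zeta>. \<omega> (frame_of A c x (mat 1)) (ftvec (frame_of A c x (mat 1)) c \<zeta>))"
    using connection_linear[OF assms(1) frame_of_frame(1)[OF assms(2) invertible_mat_1]] assms(2) by simp
  moreover have "linear (\<lambda>\<xi> :: real^'m. (\<xi>, 0 :: real^'m^'m))" by (rule linearI) auto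
  ultimately show ?thesis
    using linear_compose unfolding conn_coeff_def[abs_def] o_def by fastforce
qed

text \<open>Seen from chart d, the coordinate frame of c has the Jacobian as its matrix, and the
  vector (\<xi>, 0) acquires the Hessian as its matrix part. Evaluating \<omega> there with
  \<open>connection_formula\<close> in d gives the law.\<close>

lemma conn_coeff_change:
  assumes \<omega>: "linear_connection A \<omega>" and c: "c \<in> charts_at A x" and d: "d \<in> charts_at A x"
  shows "jac c d (snd c x) ** conn_coeff \<omega> c x \<xi> =
    hess c d x \<xi> + conn_coeff \<omega> d x (jac c d (snd c x) *v \<xi>) ** jac c d (snd c x)"
proof -
  let ?q = "frame_of A c x (mat 1)" and ?j = "jac c d (snd c x)"
  note q = frame_of_frame[OF c invertible_mat_1]
  have cq: "c \<in> charts_at A (fst ?q)" "d \<in> charts_at A (fst ?q)" using c d by auto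
  have "conn_coeff \<omega> c x \<xi> = matrix_inv (fmat d ?q) **
      (snd (ftvec ?q c (\<xi>, 0) (fc d)) + conn_coeff \<omega> d x (fst (ftvec ?q c (\<xi>, 0) (fc d))) ** fmat d ?q)"
    using connection_formula[OF \<omega> q(1) cq(2) FA.tvec_of_tangent[OF frame_charts_atI[OF q(1) cq(1)]], of "(\<xi>, 0)"]
    by (simp add: conn_coeff_def)
  moreover have "fmat d ?q = ?j" using fmat_change[OF q(1) cq] by (simp add: q(2))
  ultimately show ?thesis
    using matrix_inv_cancel(1)[OF jac_invertible[OF c d]]
    by (simp add: ftvec_component[OF q(1) cq] q(2))
qed

section \<open>Connections from compatible coefficients\<close>

text \<open>The chart is an arbitrary choice, removed by \<open>connection_of_eq\<close> for
  coefficients that transform correctly. The value 0 off the tangent bundle is the normalisation in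
  \<open>linear_connection\<close>.\<close>

definition connection_of :: "(('a, real^'m) chart \<Rightarrow> 'a \<Rightarrow> real^'m \<Rightarrow> real^'m^'m) \<Rightarrow>
    ('a, 'm) frame \<Rightarrow> ('a, 'm) frame_tvec \<Rightarrow> real^'m^'m" where
  "connection_of \<Gamma> p v = (if p \<in> frames A \<and> v \<in> tangent_space FA p
     then let c = (SOME c. c \<in> charts_at A (fst p)) in
       matrix_inv (fmat c p) ** (snd (v (fc c)) + \<Gamma> c (fst p) (fst (v (fc c))) ** fmat c p)
     else 0)"

context
  fixes \<Gamma> :: "('a, real^'m) chart \<Rightarrow> 'a \<Rightarrow> real^'m \<Rightarrow> real^'m^'m"
  assumes lin: "\<And>c x. c \<in> charts_at A x \<Longrightarrow> linear (\<Gamma> c x)"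
    and change: "\<And>c d x \<xi>. c \<in> charts_at A x \<Longrightarrow> d \<in> charts_at A x \<Longrightarrow>
      jac c d (snd c x) ** \<Gamma> c x \<xi> = hess c d x \<xi> + \<Gamma> d x (jac c d (snd c x) *v \<xi>) ** jac c d (snd c x)"
begin

text \<open>The Hessian term acquired by the vector in chart d is the one absorbed by the law
  \<open>change\<close>; what is left carries a common Jacobian factor, which the inverse frame
  matrix cancels.\<close>

lemma connection_of_eq:
  assumes p: "p \<in> frames A" and c: "c \<in> charts_at A (fst p)" and v: "v \<in> tangent_space FA p"
  shows "connection_of \<Gamma> p v = matrix_inv (fmat c p) ** (snd (v (fc c)) + \<Gamma> c (fst p) (fst (v (fc c))) ** fmat c p)"
proof -
  define d where "d = (SOME c. c \<in> charts_at A (fst p))"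
  have d: "d \<in> charts_at A (fst p)" unfolding d_def using c by (rule someI)
  let ?j = "jac c d (snd c (fst p))" and ?M = "fmat c p" and ?\<xi> = "fst (v (fc c))" and ?N = "snd (v (fc c))"
  note j = jac_invertible[OF c d] and M = fmat_invertible[OF p c]
  have "connection_of \<Gamma> p v = matrix_inv (fmat d p) ** (snd (v (fc d)) + \<Gamma> d (fst p) (fst (v (fc d))) ** fmat d p)"
    using p v by (simp add: connection_of_def d_def Let_def)
  also have "\<dots> = matrix_inv ?M ** (matrix_inv ?j ** ((hess c d (fst p) ?\<xi> + \<Gamma> d (fst p) (?j *v ?\<xi>) ** ?j) ** ?M + ?j ** ?N))"
    by (simp add: frame_tangent_component[OF p c d v] fmat_change[OF p c d] matrix_inv_mult[OF j M]
        matrix_mul_assoc mm_distrib algebra_simps)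
  also have "\<dots> = matrix_inv ?M ** (\<Gamma> c (fst p) ?\<xi> ** ?M + ?N)"
    by (simp add: change[OF c d, symmetric] mm_distrib matrix_inv_cancel[OF j] matrix_mul_assoc[symmetric])
  finally show ?thesis by (simp add: add.commute)
qed

lemma linear_connection_of:
  assumes smooth: "\<And>c \<xi>. c \<in> A \<Longrightarrow> smooth_on (snd c ` fst c) (\<lambda>y. \<Gamma> c (chart_inv c y) \<xi>)"
  shows "linear_connection A (connection_of \<Gamma>)"
  unfolding linear_connection_def
proof (intro conjI allI impI ballI)
  fix p v assume "\<not> (p \<in> frames A \<and> v \<in> tangent_space FA p)"
  then show "connection_of \<Gamma> p v = 0" unfolding connection_of_def by (rule if_not_P)
next
  fix p v w a b
  assume p: "p \<in> frames A" and v: "v \<in> tangent_space FA p" and w: "w \<in> tangent_space FA p"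
  obtain c where c: "c \<in> charts_at A (fst p)" using charts_at_nonempty[OF framesD(1)[OF p]] by blast
  show "connection_of \<Gamma> p (\<lambda>d. a *\<^sub>R v d + b *\<^sub>R w d) = a *\<^sub>R connection_of \<Gamma> p v + b *\<^sub>R connection_of \<Gamma> p w"
    by (simp add: connection_of_eq[OF p c] v w FA.tangent_lincomb linear_add[OF lin[OF c]] linear_cmul[OF lin[OF c]]
        mm_distrib mm.scaleR_left mm.scaleR_right algebra_simps)
next
  fix p a assume p: "p \<in> frames A"
  obtain c where c: "c \<in> charts_at A (fst p)" using charts_at_nonempty[OF framesD(1)[OF p]] by blast
  note C = frame_charts_atI[OF p c]
  show "connection_of \<Gamma> p (fundamental_vector A p a) = a"
    by (simp add: connection_of_eq[OF p c] fundamental_vector_eq[OF p c] FA.tvec_of_tangent[OF C] FA.tvec_of_self[OF C]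
        linear_0[OF lin[OF c]] matrix_inv_cancel[OF fmat_invertible[OF p c]])
next
  fix p v and g :: "real^'m^'m"
  assume p: "p \<in> frames A" and v: "v \<in> tangent_space FA p" and g: "invertible g"
  obtain c where c: "c \<in> charts_at A (fst p)" using charts_at_nonempty[OF framesD(1)[OF p]] by blast
  have c': "c \<in> charts_at A (fst (act p g))" using c by simp
  note C = frame_charts_atI[OF act_frames[OF p g] c']
  show "connection_of \<Gamma> (act p g) (pushforward FA FA (\<lambda>q. act q g) p v) = matrix_inv g ** connection_of \<Gamma> p v ** g"
    by (simp add: pushforward_act[OF p c v g] connection_of_eq[OF p c v] connection_of_eq[OF act_frames[OF p g] c']
        FA.tvec_of_tangent[OF C] FA.tvec_of_self[OF C] fmat_act[OF p] matrix_inv_mult[OF fmat_invertible[OF p c] g]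
        mm_distrib matrix_mul_assoc)
next
  fix W Z assume Z: "smooth_vf FA W Z"
  show "smooth_fun FA W (\<lambda>p. connection_of \<Gamma> p (Z p))"
    unfolding smooth_fun_def
  proof (intro conjI ballI)
    show W: "openin (atlas_topology FA) W" using Z by (simp add: smooth_vf_def)
    fix C assume C: "C \<in> FA"
    then obtain c where c: "c \<in> A" "C = fc c" by (auto simp: frame_atlas_def)
    let ?S = "snd C ` (fst C \<inter> W)" and ?T = "snd c ` fst c"
    have S: "open ?S" using FA.openin_open[OF W C] .
    have T: "open ?T" using open_chart_image[OF c(1)] .
    have sub: "?S \<subseteq> ?T \<times> {M. invertible M}"
      using frame_chart_image[OF c(1), of UNIV] c(2) by (auto simp: fst_frame_chart)
    have Zs: "smooth_on ?S (\<lambda>q. Z (chart_inv C q) C)" using Z C by (simp add: smooth_vf_def)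
    have \<Gamma>s: "smooth_on ?S (\<lambda>q. \<Gamma> c (chart_inv c (fst q)) \<xi>)" for \<xi>
      by (rule smooth_on_compose[of _ _ fst "\<lambda>y. \<Gamma> c (chart_inv c y) \<xi>", OF S T _ smooth_on_fst_proj smooth[OF c(1)]])
        (use sub in auto)
    have \<Gamma>l: "linear (\<Gamma> c (chart_inv c (fst q)))" if q: "q \<in> ?S" for q
    proof -
      obtain x where x: "x \<in> fst c" "fst q = snd c x" using q sub by auto
      then show ?thesis using lin[of c x] c(1) chart_inv_left[OF c(1)] by (simp add: charts_at_def)
    qed
    have "smooth_on ?S (\<lambda>q. \<Gamma> c (chart_inv c (fst q)) (fst (Z (chart_inv C q) C)))"
      by (rule smooth_on_linear_field[of _ "\<lambda>q. \<Gamma> c (chart_inv c (fst q))", OF S \<Gamma>l \<Gamma>s smooth_on_fst[OF S Zs]])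
    then have "smooth_on ?S (\<lambda>q. matrix_inv (snd q) **
        (snd (Z (chart_inv C q) C) + \<Gamma> c (chart_inv c (fst q)) (fst (Z (chart_inv C q) C)) ** snd q))"
      using sub by (intro smooth_on_matrix_mult smooth_on_matrix_inv smooth_on_add smooth_on_snd[OF S Zs]
          smooth_on_snd_proj S) auto
    then show "smooth_on ?S ((\<lambda>p. connection_of \<Gamma> p (Z p)) \<circ> chart_inv C)"
    proof (subst smooth_on_cong[OF S])
      fix q assume "q \<in> ?S"
      then obtain p where p: "p \<in> fst C" "p \<in> W" "q = snd C p" by auto
      then have p': "p \<in> frames A" "c \<in> charts_at A (fst p)"
        using c by (auto simp: fst_frame_chart charts_at_def)
      have "chart_inv C q = p" using FA.chart_inv_left[OF C] p by simp
      moreover have "Z p \<in> tangent_space FA p" using Z p by (simp add: smooth_vf_def)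
      moreover have "q = (snd c (fst p), fmat c p)" "chart_inv c (snd c (fst p)) = fst p"
        using p c chart_inv_left[OF c(1)] by (auto simp: snd_frame_chart fst_frame_chart)
      ultimately show "((\<lambda>p. connection_of \<Gamma> p (Z p)) \<circ> chart_inv C) q = matrix_inv (snd q) **
        (snd (Z (chart_inv C q) C) + \<Gamma> c (chart_inv c (fst q)) (fst (Z (chart_inv C q) C)) ** snd q)"
        using connection_of_eq[OF p'] c(2) by simp
    qed
  qed
qed

lemma conn_coeff_connection_of:
  assumes c: "c \<in> charts_at A x"
  shows "conn_coeff (connection_of \<Gamma>) c x = \<Gamma> c x"
proof
  fix \<xi>
  note q = frame_of_frame[OF c invertible_mat_1]
  have cq: "c \<in> charts_at A (fst (frame_of A c x (mat 1)))" using c by simp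
  note C = frame_charts_atI[OF q(1) cq]
  show "conn_coeff (connection_of \<Gamma>) c x \<xi> = \<Gamma> c x \<xi>"
    by (simp add: conn_coeff_def connection_of_eq[OF q(1) cq] FA.tvec_of_tangent[OF C] FA.tvec_of_self[OF C] q(2)
        matrix_inv_mat_1)
qed

end

section \<open>Covariant derivative and torsion in coordinates\<close>

lemma horizontal_lift_eq:
  assumes \<omega>: "linear_connection A \<omega>" and p: "p \<in> frames A" and c: "c \<in> charts_at A (fst p)"
    and v: "v \<in> tangent_space A (fst p)"
  shows "horizontal_lift A \<omega> p v = ftvec p c (v c, - (conn_coeff \<omega> c (fst p) (v c) ** fmat c p))"
    (is "_ = ?h")
  unfolding horizontal_lift_def
proof (rule the_equality)
  note C = frame_charts_atI[OF p c]
  have push: "pushforward FA A fst p h = v" if h: "h \<in> tangent_space FA p" "fst (h (fc c)) = v c" for h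
  proof
    fix d
    show "pushforward FA A fst p h d = v d"
    proof (cases "d \<in> charts_at A (fst p)")
      case True
      then show ?thesis
        using pushforward_fst[OF p True h(1)] frame_tangent_component[OF p c True h(1)] h(2) tangent_jac[OF v c True]
        by simp
    next
      case False
      then show ?thesis using tangent_outside[OF v False] by (simp add: pushforward_def)
    qed
  qed
  show "?h \<in> tangent_space FA p \<and> \<omega> p ?h = 0 \<and> pushforward FA A fst p ?h = v"
    using push[OF FA.tvec_of_tangent[OF C]] FA.tvec_of_tangent[OF C]
    by (simp add: connection_formula[OF \<omega> p c] FA.tvec_of_self[OF C])
next
  note C = frame_charts_atI[OF p c]
  fix h assume h: "h \<in> tangent_space FA p \<and> \<omega> p h = 0 \<and> pushforward FA A fst p h = v"
  then have 1: "fst (h (fc c)) = v c" using pushforward_fst[OF p c] by metis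
  have "matrix_inv (fmat c p) ** (snd (h (fc c)) + conn_coeff \<omega> c (fst p) (v c) ** fmat c p) = 0"
    using h connection_formula[OF \<omega> p c, of h] 1 by metis
  then have "snd (h (fc c)) + conn_coeff \<omega> c (fst p) (v c) ** fmat c p = 0"
    by (metis matrix_inv_cancel(1)[OF fmat_invertible[OF p c]] mm.zero_right)
  then have "snd (h (fc c)) = - (conn_coeff \<omega> c (fst p) (v c) ** fmat c p)" by (simp add: eq_neg_iff_add_eq_0)
  then have "h (fc c) = (v c, - (conn_coeff \<omega> c (fst p) (v c) ** fmat c p))"
    using 1 by (simp add: prod_eq_iff)
  then show "h = ?h" using FA.tangent_eq_tvec_of[OF _ C] h by metis
qed

lemma frame_at:
  assumes "x \<in> carrier A"
  shows "frame_at A x \<in> frames A" "fst (frame_at A x) = x"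
proof -
  obtain c where c: "c \<in> charts_at A x" using charts_at_nonempty[OF assms] by blast
  have "\<exists>p. p \<in> frames A \<and> fst p = x" 
    by (intro exI[of _ "frame_of A c x (mat 1)"]) (simp add: frame_of_frame(1)[OF c invertible_mat_1])
  then have "frame_at A x \<in> frames A \<and> fst (frame_at A x) = x" unfolding frame_at_def by (rule someI_ex)
  then show "frame_at A x \<in> frames A" "fst (frame_at A x) = x" by auto
qed

text \<open>The function is the inverse frame matrix applied to Y. Differentiating the identity that
  M times this function equals Y avoids a formula for the derivative of matrix inversion.\<close>

lemma dir_deriv_equivariant:
  assumes p: "p \<in> frames A" and c: "c \<in> charts_at A (fst p)" and W: "fst p \<in> W" "smooth_vf A W Y"
    and h: "h \<in> tangent_space FA p"
  shows "fmat c p *v dir_deriv FA (\<lambda>q. inv (snd q) (Y (fst q))) p h =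
    FD (\<lambda>y. Y (chart_inv c y) c) (snd c (fst p)) (fst (h (fc c)))
      - snd (h (fc c)) *v (matrix_inv (fmat c p) *v Y (fst p) c)"
proof -
  let ?U = "snd c ` (fst c \<inter> W)" and ?f = "\<lambda>q. inv (snd q) (Y (fst q))" and ?Y = "\<lambda>y. Y (chart_inv c y) c"
  let ?S = "?U \<times> {M :: real^'m^'m. invertible M}" and ?F = "\<lambda>z. matrix_inv (snd z) *v ?Y (fst z)"
  let ?z = "snd (fc c) p"
  have cA: "c \<in> A" "fst p \<in> fst c" using charts_atD[OF c] by auto
  have Wo: "openin (atlas_topology A) W" using W by (simp add: smooth_vf_def)
  have U: "open ?U" using openin_open[OF Wo cA(1)] .
  note S = frame_nbhd[OF p c Wo W(1)]
  have Ys: "smooth_on ?U ?Y" using W cA by (simp add: smooth_vf_def)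
  have eq: "(?f \<circ> chart_inv (fc c)) z = ?F z" if z: "z \<in> ?S" for z
  proof -
    obtain x N where x: "x \<in> fst c" "x \<in> W" "invertible N" "z = (snd c x, N)" using z by auto
    then have cx: "c \<in> charts_at A x" using cA by (auto simp: charts_at_def)
    have "Y x \<in> tangent_space A x" using W x by (simp add: smooth_vf_def)
    then show ?thesis
      using x inv_frame(1)[OF frame_of_frame(1)[OF cx x(3)], of c "Y x"] cx
      by (simp add: frame_chart_inv[OF cx] frame_of_frame[OF cx] chart_inv_left[OF cA(1)])
  qed
  have Yf: "smooth_on ?S (\<lambda>z. ?Y (fst z))"
    by (rule smooth_on_compose[of _ _ fst ?Y, OF S(1) U _ smooth_on_fst_proj Ys]) auto
  have "smooth_on ?S ?F"
    by (intro smooth_on_matrix_vector_mult smooth_on_matrix_inv S(1) smooth_on_snd_proj Yf) auto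
  then have dF: "?F differentiable (at ?z)" using S(2) by (rule smooth_on_differentiable)
  define F' where "F' = FD ?F ?z (h (fc c))"
  have "(?f \<circ> chart_inv (fc c)) differentiable (at ?z)"
    using differentiable_cong[OF S, of "?f \<circ> chart_inv (fc c)" ?F] eq dF by simp
  then have "dir_deriv FA ?f p h = FD (?f \<circ> chart_inv (fc c)) ?z (h (fc c))"
    by (rule FA.dir_deriv_chart[OF frame_charts_atI[OF p c] h])
  also have "\<dots> = F'" using FD_cong[OF S, of "?f \<circ> chart_inv (fc c)" ?F] eq by (simp add: F'_def)
  finally have dd: "dir_deriv FA ?f p h = F'" .
  have "((\<lambda>z. snd z *v ?F z) has_derivative (\<lambda>\<zeta>. snd ?z *v FD ?F ?z \<zeta> + snd \<zeta> *v ?F ?z)) (at ?z)"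
    by (intro mv.FDERIV FD_works dF
        bounded_linear_imp_has_derivative bounded_linear_snd)
  moreover have "((\<lambda>z. ?Y (fst z)) has_derivative (\<lambda>\<zeta>. FD ?Y (fst ?z) (fst \<zeta>))) (at ?z)"
  proof -
    have "?Y differentiable (at (fst ?z))" using smooth_on_differentiable[OF Ys] S(2) by auto
    then show ?thesis
      using diff_chain_at[OF bounded_linear_imp_has_derivative[OF bounded_linear_fst] FD_works] by (simp add: o_def)
  qed
  moreover have "snd z *v ?F z = ?Y (fst z)" if "z \<in> ?S" for z
    using that by (auto simp: matrix_inv_vector_cancel)
  ultimately have "(\<lambda>\<zeta>. snd ?z *v FD ?F ?z \<zeta> + snd \<zeta> *v ?F ?z) = (\<lambda>\<zeta>. FD ?Y (fst ?z) (fst \<zeta>))"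
    using has_derivative_cong_open[OF S, of "\<lambda>z. snd z *v ?F z" "\<lambda>z. ?Y (fst z)"] has_derivative_unique by blast
  from fun_cong[OF this, of "h (fc c)"] show ?thesis
    unfolding dd F'_def by (simp add: snd_frame_chart chart_inv_left[OF cA] algebra_simps)
qed

text \<open>The matrix of the auxiliary frame cancels, which leaves the classical expression:
  derivative of the components plus the Christoffel term.\<close>

lemma cov_deriv_eq:
  assumes \<omega>: "linear_connection A \<omega>" and W: "x \<in> W" "smooth_vf A W Y" and v: "v \<in> tangent_space A x"
  shows "cov_deriv A \<omega> x v Y \<in> tangent_space A x"
    and "c \<in> charts_at A x \<Longrightarrow>
      cov_deriv A \<omega> x v Y c = FD (\<lambda>y. Y (chart_inv c y) c) (snd c x) (v c) + conn_coeff \<omega> c x (v c) *v Y x c"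
proof -
  have x: "x \<in> carrier A" using W by (auto simp: smooth_vf_def openin_atlas)
  define p where "p = frame_at A x"
  have p: "p \<in> frames A" "fst p = x" using frame_at[OF x] by (auto simp: p_def)
  have cd: "cov_deriv A \<omega> x v Y = snd p (dir_deriv FA (\<lambda>q. inv (snd q) (Y (fst q))) p (horizontal_lift A \<omega> p v))"
    by (simp add: cov_deriv_def p_def Let_def)
  show "cov_deriv A \<omega> x v Y \<in> tangent_space A x" using framesD(4)[OF p(1)] unfolding cd p(2) .
  assume "c \<in> charts_at A x"
  then have c: "c \<in> charts_at A (fst p)" using p by simp
  note C = frame_charts_atI[OF p(1) c]
  have hl: "horizontal_lift A \<omega> p v = ftvec p c (v c, - (conn_coeff \<omega> c x (v c) ** fmat c p))"
    using horizontal_lift_eq[OF \<omega> p(1) c] v p(2) by simp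
  have "cov_deriv A \<omega> x v Y c = fmat c p *v dir_deriv FA (\<lambda>q. inv (snd q) (Y (fst q))) p (horizontal_lift A \<omega> p v)"
    by (simp add: cd fmat_apply[OF p(1)])
  also have "\<dots> = FD (\<lambda>y. Y (chart_inv c y) c) (snd c x) (v c)
      - (- (conn_coeff \<omega> c x (v c) ** fmat c p)) *v (matrix_inv (fmat c p) *v Y x c)"
    unfolding hl using dir_deriv_equivariant[OF p(1) c _ W(2) FA.tvec_of_tangent[OF C]] W(1) p(2)
    by (simp add: FA.tvec_of_self[OF C])
  also have "\<dots> = FD (\<lambda>y. Y (chart_inv c y) c) (snd c x) (v c) + conn_coeff \<omega> c x (v c) *v Y x c"
    by (simp add: mv_distrib mm_distrib matrix_vector_mul_assoc matrix_inv_cancel[OF fmat_invertible[OF p(1) c]])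
  finally show "cov_deriv A \<omega> x v Y c = FD (\<lambda>y. Y (chart_inv c y) c) (snd c x) (v c) + conn_coeff \<omega> c x (v c) *v Y x c" .
qed

text \<open>The derivatives of X and Y cancel against the bracket, so all extensions give the same
  value. Extensions with constant components in one chart show that the condition in
  \<open>torsion\<close> is not vacuous.\<close>

lemma torsion_eq:
  assumes \<omega>: "linear_connection A \<omega>" and x: "x \<in> carrier A"
    and v: "v \<in> tangent_space A x" and w: "w \<in> tangent_space A x"
  shows "torsion A \<omega> x v w = (\<lambda>c. if c \<in> charts_at A x
    then conn_coeff \<omega> c x (v c) *v w c - conn_coeff \<omega> c x (w c) *v v c else 0)" (is "_ = ?t")
  unfolding torsion_def
proof (rule the_equality)
  have ext: "(\<lambda>c. cov_deriv A \<omega> x (X x) Y c - cov_deriv A \<omega> x (Y x) X c - lie_bracket A X Y x c) = ?t"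
    if *: "x \<in> W" "smooth_vf A W X" "smooth_vf A W Y" "X x = v" "Y x = w" for W X Y
  proof
    fix c
    show "cov_deriv A \<omega> x (X x) Y c - cov_deriv A \<omega> x (Y x) X c - lie_bracket A X Y x c = ?t c"
    proof (cases "c \<in> charts_at A x")
      case True
      then show ?thesis
        using cov_deriv_eq(2)[OF \<omega> *(1,3) v True] cov_deriv_eq(2)[OF \<omega> *(1,2) w True] *
        by (simp add: lie_bracket_def)
    next
      case False
      then show ?thesis
        using tangent_outside[OF cov_deriv_eq(1)[OF \<omega> *(1,3) v]] tangent_outside[OF cov_deriv_eq(1)[OF \<omega> *(1,2) w]] *
        by (simp add: lie_bracket_def)
    qed
  qed
  show "\<forall>W X Y. x \<in> W \<and> smooth_vf A W X \<and> smooth_vf A W Y \<and> X x = v \<and> Y x = w \<longrightarrow>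
     ?t = (\<lambda>c. cov_deriv A \<omega> x (X x) Y c - cov_deriv A \<omega> x (Y x) X c - lie_bracket A X Y x c)"
    by (intro allI impI, elim conjE) (rule ext[symmetric])
  fix t assume t: "\<forall>W X Y. x \<in> W \<and> smooth_vf A W X \<and> smooth_vf A W Y \<and> X x = v \<and> Y x = w \<longrightarrow>
     t = (\<lambda>c. cov_deriv A \<omega> x (X x) Y c - cov_deriv A \<omega> x (Y x) X c - lie_bracket A X Y x c)"
  obtain c where c: "c \<in> charts_at A x" using charts_at_nonempty[OF x] by blast
  note V = vf_extension[OF c v] and W = vf_extension[OF c w]
  have "t = (\<lambda>d. cov_deriv A \<omega> x (tvec_of A x c (v c)) (\<lambda>p. tvec_of A p c (w c)) d
      - cov_deriv A \<omega> x (tvec_of A x c (w c)) (\<lambda>p. tvec_of A p c (v c)) d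
      - lie_bracket A (\<lambda>p. tvec_of A p c (v c)) (\<lambda>p. tvec_of A p c (w c)) x d)"
    using t[rule_format, of "fst c" "\<lambda>p. tvec_of A p c (v c)" "\<lambda>p. tvec_of A p c (w c)"] V W charts_atD[OF c] by blast
  then show "t = ?t" using ext[OF charts_atD(2)[OF c] V(1) W(1) V(2) W(2)] by simp
qed

text \<open>Under a change of chart the coefficients pick up a Hessian term, which is symmetric in
  the two vectors and drops out of the difference.\<close>

lemma torsion_tangent:
  assumes \<omega>: "linear_connection A \<omega>" and x: "x \<in> carrier A"
    and v: "v \<in> tangent_space A x" and w: "w \<in> tangent_space A x"
  shows "torsion A \<omega> x v w \<in> tangent_space A x"
  unfolding tangent_space_def torsion_eq[OF assms]
proof (intro CollectI conjI ballI allI impI)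
  fix c d assume c: "c \<in> charts_at A x" and d: "d \<in> charts_at A x"
  let ?j = "jac c d (snd c x)"
  have *: "conn_coeff \<omega> d x (?j *v \<xi>) *v (?j *v \<eta>) = ?j *v (conn_coeff \<omega> c x \<xi> *v \<eta>) - hess c d x \<xi> *v \<eta>" for \<xi> \<eta>
    using arg_cong[OF conn_coeff_change[OF \<omega> c d, of \<xi>], of "\<lambda>m. m *v \<eta>"]
    by (simp add: mv_distrib matrix_vector_mul_assoc)
  show "(if d \<in> charts_at A x then conn_coeff \<omega> d x (v d) *v w d - conn_coeff \<omega> d x (w d) *v v d else 0) =
       FD (transition c d) (snd c x)
        (if c \<in> charts_at A x then conn_coeff \<omega> c x (v c) *v w c - conn_coeff \<omega> c x (w c) *v v c else 0)"
    using c d hess_symmetric[OF c d, of "v c" "w c"]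
    by (simp add: jac_apply[OF c d, symmetric] tangent_jac[OF v c d] tangent_jac[OF w c d] * mv_distrib)
qed simp

lemma end_trace_eq:
  assumes x: "x \<in> carrier A" and c: "c \<in> charts_at A x"
    and E: "\<And>v. v \<in> tangent_space A x \<Longrightarrow> E v \<in> tangent_space A x"
      "\<And>v. v \<in> tangent_space A x \<Longrightarrow> E v c = L *v v c"
  shows "end_trace A x E = trace L"
proof -
  define p where "p = frame_at A x"
  have p: "p \<in> frames A" "fst p = x" using frame_at[OF x] by (auto simp: p_def)
  have cp: "c \<in> charts_at A (fst p)" using c p by simp
  have t: "snd p \<xi> \<in> tangent_space A x" for \<xi> using framesD(4)[OF p(1)] unfolding p(2) .
  have "inv (snd p) (E (snd p \<xi>)) = (matrix_inv (fmat c p) ** L ** fmat c p) *v \<xi>" for \<xi>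
    using inv_frame(1)[OF p(1) cp, of "E (snd p \<xi>)"] E[OF t] p(2)
    by (simp add: fmat_apply[OF p(1), symmetric] matrix_vector_mul_assoc[symmetric])
  then have "end_trace A x E = trace (matrix_inv (fmat c p) ** L ** fmat c p)"
    by (simp add: end_trace_def p_def[symmetric] Let_def)
  then show ?thesis by (simp add: trace_conj[OF fmat_invertible[OF p(1) cp]])
qed

end

section \<open>Structures for the diagonal group\<close>

abbreviation real_atlas :: "(real, real) chart set" where
  "real_atlas \<equiv> {(UNIV, id)}"

lemma smooth_atlas_real: "smooth_atlas real_atlas"
proof -
  have "smooth_on UNIV (id :: real \<Rightarrow> real)" using smooth_on_ident by (simp add: id_def)
  then show ?thesis by unfold_locales auto
qed

lemma openin_real_atlas: "openin (atlas_topology real_atlas) W \<longleftrightarrow> open W"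
  unfolding smooth_atlas.openin_atlas[OF smooth_atlas_real] by (auto simp: carrier_def)

context smooth_atlas
begin

lemma smooth_curve_chart:
  assumes \<gamma>: "smooth_map real_atlas A I \<gamma>" and C: "C \<in> A" and t: "t \<in> I" "\<gamma> t \<in> fst C"
  obtains V where "open V" "t \<in> V" "V \<subseteq> I" "\<gamma> ` V \<subseteq> fst C" "smooth_on V (snd C \<circ> \<gamma>)"
proof
  let ?V = "I \<inter> \<gamma> -` fst C"
  have I: "open I" using \<gamma> by (simp add: smooth_map_def openin_real_atlas)
  have cont: "continuous_map (subtopology (atlas_topology real_atlas) I) (atlas_topology A) \<gamma>"
    using \<gamma> by (simp add: smooth_map_def)
  have "topspace (subtopology (atlas_topology real_atlas) I) = I"
    by (simp add: smooth_atlas.topspace_atlas[OF smooth_atlas_real] carrier_def)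
  then have "openin (subtopology (atlas_topology real_atlas) I) ?V"
    using openin_continuous_map_preimage[OF cont openin_chart[OF C]] by (simp add: Collect_conj_eq vimage_def)
  then show "open ?V"
    using I by (auto simp: openin_subtopology openin_real_atlas)
  show "t \<in> ?V" "?V \<subseteq> I" "\<gamma> ` ?V \<subseteq> fst C" using t by auto
  show "smooth_on ?V (snd C \<circ> \<gamma>)"
    using \<gamma> C unfolding smooth_map_def by (auto simp: inv_id)
qed

lemma curve_velocity_eq:
  assumes C: "C \<in> charts_at A (\<gamma> 0)" and V: "open V" "0 \<in> V" "\<gamma> ` V \<subseteq> fst C"
    and w: "((snd C \<circ> \<gamma>) has_vector_derivative w) (at 0)"
  shows "curve_velocity A \<gamma> 0 = tvec_of A (\<gamma> 0) C w"
proof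
  fix D
  show "curve_velocity A \<gamma> 0 D = tvec_of A (\<gamma> 0) C w D"
  proof (cases "D \<in> charts_at A (\<gamma> 0)")
    case True
    have td: "(transition C D has_derivative FD (transition C D) (snd C (\<gamma> 0))) (at ((snd C \<circ> \<gamma>) 0))"
      using FD_works[OF differentiable_transition[OF C True]] by simp
    have "((transition C D \<circ> (snd C \<circ> \<gamma>)) has_vector_derivative FD (transition C D) (snd C (\<gamma> 0)) w) (at 0)"
      using diff_chain_at[OF w[unfolded has_vector_derivative_def] td]
        linear_cmul[OF bounded_linear.linear[OF FD_linear[OF differentiable_transition[OF C True]]]]
      by (simp add: has_vector_derivative_def o_def)
    then have "((snd D \<circ> \<gamma>) has_vector_derivative FD (transition C D) (snd C (\<gamma> 0)) w) (at 0)"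
      unfolding has_vector_derivative_def
      by (rule has_derivative_transform_within_open[OF _ V(1,2)])
        (use V(3) chart_inv_left[OF charts_atD(1)[OF C]] in auto)
    then show ?thesis using True by (simp add: curve_velocity_def tvec_of_def vector_derivative_at)
  qed (simp add: curve_velocity_def tvec_of_def)
qed

end

section \<open>Structure tensors and local frame fields\<close>

text \<open>The endomorphism of the tangent space that has the matrix \<open>K\<close> in the frames of \<open>B\<close>, in the coordinates
  of the chart \<open>c\<close>; it depends only on \<open>B\<close> for \<open>K\<close> in the commutant.\<close>

definition structure_tensor ::
  "('a, 'm::finite) frame set \<Rightarrow> ('a, real^'m) chart \<Rightarrow> real^'m^'m \<Rightarrow> real^'m \<Rightarrow> real^'m^'m" where
  "structure_tensor B c K y = (let p = (SOME p. p \<in> B \<and> fst p = chart_inv c y)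
     in fmat c p ** K ** matrix_inv (fmat c p))"

locale diagonal_structure = smooth_atlas_vec A for A :: "('a, real^('n::finite + 'n)) chart set" +
  fixes B :: "('a, 'n + 'n) frame set"
  assumes G_structure: "G_structure A Delta_GL B"
begin

abbreviation "ten \<equiv> structure_tensor B"
abbreviation "dten c K x \<equiv> FD (ten c K) (snd c x)"
abbreviation "wa c x \<equiv> well_adapted_coeff (\<lambda>K. ten c K (snd c x)) (\<lambda>K. dten c K x)"

lemma B_frames: "p \<in> B \<Longrightarrow> p \<in> frames A"
  using G_structure by (auto simp: G_structure_def)

text \<open>A local trivialisation in matrix form: s is the matrix of a smooth local frame field,
  and over U the frames in B are those whose matrix lies in the coset of s by the group.\<close>

definition local_section ::
  "('a, real^('n + 'n)) chart \<Rightarrow> (real^('n + 'n)) set \<Rightarrow> (real^('n + 'n) \<Rightarrow> real^('n + 'n)^('n + 'n)) \<Rightarrow> bool" where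
  "local_section c U s \<longleftrightarrow> open U \<and> U \<subseteq> snd c ` fst c \<and> smooth_on U s \<and> (\<forall>y\<in>U. invertible (s y)) \<and>
     (\<forall>p. fst p \<in> fst c \<and> snd c (fst p) \<in> U \<longrightarrow>
        (p \<in> B \<longleftrightarrow> p \<in> frames A \<and> (\<exists>g\<in>Delta_GL. fmat c p = s (snd c (fst p)) ** g)))"

lemma local_sectionD:
  assumes "local_section c U s"
  shows "open U" "U \<subseteq> snd c ` fst c" "smooth_on U s" "\<And>y. y \<in> U \<Longrightarrow> invertible (s y)"
    "\<And>p. fst p \<in> fst c \<Longrightarrow> snd c (fst p) \<in> U \<Longrightarrow>
      p \<in> B \<longleftrightarrow> p \<in> frames A \<and> (\<exists>g\<in>Delta_GL. fmat c p = s (snd c (fst p)) ** g)"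
  using assms unfolding local_section_def by blast+

lemma local_section_exists:
  assumes c: "c \<in> charts_at A x"
  obtains U s where "local_section c U s" "snd c x \<in> U"
proof -
  have x: "x \<in> carrier A" using charts_atD[OF c] chart_subset_carrier by blast
  obtain W \<sigma> where W: "x \<in> W" "smooth_map A FA W \<sigma>"
    and \<sigma>: "\<And>y. y \<in> W \<Longrightarrow> fst (\<sigma> y) = y" "\<And>y. y \<in> W \<Longrightarrow> fibre B y = orbit Delta_GL (\<sigma> y)"
    using G_structure x unfolding G_structure_def by metis
  have cA: "c \<in> A" "x \<in> fst c" using charts_atD[OF c] by auto
  have \<sigma>B: "\<sigma> y \<in> B" if "y \<in> W" for y
  proof -
    have "act (\<sigma> y) (mat 1) \<in> fibre B y" using \<sigma>(2)[OF that] Delta_GL_one by (auto simp: orbit_def)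
    then show ?thesis by (simp add: act_one fibre_def)
  qed
  define U where "U = snd c ` (fst c \<inter> W)"
  define s where "s y = fmat c (\<sigma> (chart_inv c y))" for y
  have U: "open U" using W(2) openin_open[OF _ cA(1)] by (simp add: U_def smooth_map_def)
  have C: "fc c \<in> FA" using cA by (simp add: frame_atlas_def)
  have "fst c \<inter> W \<inter> \<sigma> -` fst (fc c) = fst c \<inter> W"
    using B_frames[OF \<sigma>B] \<sigma>(1) by (auto simp: fst_frame_chart)
  then have "smooth_on U (snd (fc c) \<circ> \<sigma> \<circ> chart_inv c)"
    using W(2) cA(1) C unfolding smooth_map_def U_def by metis
  then have s: "smooth_on U s"
    using smooth_on_snd[OF U] by (fastforce simp: s_def[abs_def] snd_frame_chart o_def)
  have mem: "chart_inv c y \<in> fst c" "chart_inv c y \<in> W" "snd c (chart_inv c y) = y" if "y \<in> U" for y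
    using that chart_inv_left[OF cA(1)] by (auto simp: U_def)
  have inv: "invertible (s y)" if "y \<in> U" for y
    using mem[OF that] \<sigma>B \<sigma>(1) cA(1) fmat_invertible[OF B_frames, of "\<sigma> (chart_inv c y)" c]
    by (simp add: s_def charts_at_def)
  have iff: "p \<in> B \<longleftrightarrow> p \<in> frames A \<and> (\<exists>g\<in>Delta_GL. fmat c p = s (snd c (fst p)) ** g)"
    if p: "fst p \<in> fst c" "snd c (fst p) \<in> U" for p
  proof -
    let ?q = "\<sigma> (fst p)"
    have ci: "chart_inv c (snd c (fst p)) = fst p" using chart_inv_left[OF cA(1) p(1)] .
    have W': "fst p \<in> W" using mem(2)[OF p(2)] ci by simp
    note q = B_frames[OF \<sigma>B[OF W']]
    have s: "s (snd c (fst p)) = fmat c ?q" by (simp add: s_def ci)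
    have cp: "c \<in> charts_at A (fst p)" using p cA by (simp add: charts_at_def)
    have "p \<in> B \<longleftrightarrow> p \<in> fibre B (fst p)" by (simp add: fibre_def)
    also have "\<dots> \<longleftrightarrow> (\<exists>g\<in>Delta_GL. p = act ?q g)" using \<sigma>(2)[OF W'] by (auto simp: orbit_def)
    also have "\<dots> \<longleftrightarrow> p \<in> frames A \<and> (\<exists>g\<in>Delta_GL. fmat c p = fmat c ?q ** g)"
    proof (intro iffI conjI)
      assume "\<exists>g\<in>Delta_GL. p = act ?q g"
      then show "p \<in> frames A" "\<exists>g\<in>Delta_GL. fmat c p = fmat c ?q ** g"
        using act_frames[OF q Delta_GL_invertible] fmat_act[OF q] by metis+
    next
      assume "p \<in> frames A \<and> (\<exists>g\<in>Delta_GL. fmat c p = fmat c ?q ** g)"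
      then obtain g where g: "p \<in> frames A" "g \<in> Delta_GL" "fmat c p = fmat c ?q ** g" by blast
      have "p = act ?q g"
        using g act_frames[OF q Delta_GL_invertible[OF g(2)]] \<sigma>(1)[OF W'] cp
        by (intro frame_eqI[of _ _ c]) (auto simp: fmat_act[OF q])
      then show "\<exists>g\<in>Delta_GL. p = act ?q g" using g(2) by blast
    qed
    finally show ?thesis by (simp add: s)
  qed
  have "snd c x \<in> U" "U \<subseteq> snd c ` fst c" using cA W(1) by (auto simp: U_def)
  then show ?thesis using that[of U s] U s inv iff unfolding local_section_def by blast
qed

lemma frame_exists:
  assumes "x \<in> carrier A"
  obtains p where "p \<in> B" "fst p = x"
proof -
  obtain c where c: "c \<in> charts_at A x" using charts_at_nonempty[OF assms] by blast
  obtain U s where S: "local_section c U s" and y: "snd c x \<in> U" by (rule local_section_exists[OF c])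
  note U = y local_sectionD(4,5)[OF S]
  have "fmat c (frame_of A c x (s (snd c x))) = s (snd c x) ** mat 1"
    by (simp add: frame_of_frame[OF c U(2)[OF U(1)]])
  then have "frame_of A c x (s (snd c x)) \<in> B"
    using U(1) U(3)[of "frame_of A c x (s (snd c x))"] frame_of_frame(1)[OF c U(2)[OF U(1)]] charts_atD(2)[OF c]
      Delta_GL_one by (auto simp del: matrix_mul_rid)
  then show ?thesis using that by simp
qed

text \<open>g commutes with K. Hence all frames of the structure at a point give the same tensor,
  and the choice in \<open>structure_tensor\<close> is harmless.\<close>

lemma conj_Delta_GL:
  fixes s :: "real^('k::finite + 'k)^('k + 'k)"
  assumes "invertible s" "g \<in> Delta_GL" "K \<in> commutant"
  shows "(s ** g) ** K ** matrix_inv (s ** g) = s ** K ** matrix_inv s"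
proof -
  have "(s ** g) ** K ** matrix_inv (s ** g) = s ** (g ** K ** matrix_inv g) ** matrix_inv s"
    by (simp add: matrix_inv_mult[OF assms(1) Delta_GL_invertible[OF assms(2)]] matrix_mul_assoc)
  also have "g ** K ** matrix_inv g = K"
    by (simp add: commutant_commutes(2)[OF assms(3,2), symmetric] matrix_inv_cancel[OF Delta_GL_invertible[OF assms(2)]])
  finally show ?thesis .
qed

lemma tensor_section:
  assumes S: "local_section c U s" and c: "c \<in> A" and y: "y \<in> U" and K: "K \<in> commutant"
  shows "ten c K y = s y ** K ** matrix_inv (s y)"
proof -
  note U = local_sectionD(2)[OF S] and s = local_sectionD(4)[OF S] and iff = local_sectionD(5)[OF S]
  define x where "x = chart_inv c y"
  have x: "x \<in> fst c" "snd c x = y" using U y chart_inv_left[OF c] by (auto simp: x_def)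
  define p where "p = (SOME p. p \<in> B \<and> fst p = x)"
  have "\<exists>p. p \<in> B \<and> fst p = x" using frame_exists[of x] x chart_subset_carrier[OF c] by blast
  then have p: "p \<in> B" "fst p = x" unfolding p_def
    using someI_ex[of "\<lambda>p. p \<in> B \<and> fst p = x"] by auto
  then obtain g where g: "g \<in> Delta_GL" "fmat c p = s y ** g" using iff[of p] x y by auto
  have "ten c K y = fmat c p ** K ** matrix_inv (fmat c p)"
    by (simp add: structure_tensor_def p_def x_def Let_def)
  then show ?thesis using conj_Delta_GL[OF s[OF y] g(1) K] g(2) by simp
qed

lemma tensor_eq:
  assumes p: "p \<in> B" and c: "c \<in> charts_at A (fst p)" and K: "K \<in> commutant"
  shows "ten c K (snd c (fst p)) = fmat c p ** K ** matrix_inv (fmat c p)"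
proof -
  obtain U s where S: "local_section c U s" and y: "snd c (fst p) \<in> U" by (rule local_section_exists[OF c])
  then obtain g where g: "g \<in> Delta_GL" "fmat c p = s (snd c (fst p)) ** g"
    using p charts_atD[OF c] local_sectionD(5)[OF S] by blast
  show ?thesis
    using tensor_section[OF S charts_atD(1)[OF c] y K] conj_Delta_GL[OF local_sectionD(4)[OF S y] g(1) K] g(2) by simp
qed

lemma smooth_tensor:
  assumes c: "c \<in> A" and K: "K \<in> commutant"
  shows "smooth_on (snd c ` fst c) (ten c K)"
proof (rule smooth_on_local)
  fix z assume "z \<in> snd c ` fst c"
  then obtain x where x: "x \<in> fst c" "z = snd c x" by auto
  have cx: "c \<in> charts_at A x" using x c by (simp add: charts_at_def)
  obtain U s where S: "local_section c U s" and xU: "snd c x \<in> U" by (rule local_section_exists[OF cx])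
  note U = local_sectionD(1,3,4,2)[OF S]
  have "smooth_on U (\<lambda>y. s y ** K ** matrix_inv (s y))" by (intro smooth_intros U(1-3))
  then have "smooth_on U (ten c K)"
    by (subst smooth_on_cong[OF U(1) tensor_section[OF S c _ K]])
  then show "\<exists>T. open T \<and> z \<in> T \<and> smooth_on T (ten c K)" using U(1) xU x by blast
qed

lemma tensor_has_derivative:
  assumes "c \<in> charts_at A x" "K \<in> commutant"
  shows "(ten c K has_derivative dten c K x) (at (snd c x))"
  using smooth_on_differentiable[OF smooth_tensor[OF _ assms(2), of c]] assms(1)
  by (intro FD_works) (auto simp: charts_at_def)

lemma tensor_change:
  assumes "c \<in> charts_at A x" "d \<in> charts_at A x" "K \<in> commutant"
  shows "ten d K (snd d x) ** jac c d (snd c x) = jac c d (snd c x) ** ten c K (snd c x)"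
proof -
  have "x \<in> carrier A" using charts_atD[OF assms(1)] chart_subset_carrier by blast
  then obtain p where p: "p \<in> B" "fst p = x" by (rule frame_exists)
  have c: "c \<in> charts_at A (fst p)" and d: "d \<in> charts_at A (fst p)" using assms p by auto
  let ?j = "jac c d (snd c (fst p))" and ?M = "fmat c p"
  have "ten d K (snd d (fst p)) ** ?j = ?j ** ten c K (snd c (fst p))"
    by (simp add: tensor_eq[OF p(1) c assms(3)] tensor_eq[OF p(1) d assms(3)] fmat_change[OF B_frames[OF p(1)] c d]
        matrix_inv_mult[OF jac_invertible[OF c d] fmat_invertible[OF B_frames[OF p(1)] c]] matrix_mul_assoc
        matrix_inv_cancel[OF jac_invertible[OF c d]])
  then show ?thesis using p by simp
qed

text \<open>The product rule applied to both sides of \<open>tensor_change\<close>, which holds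
  throughout the overlap of the charts.\<close>

lemma tensor_deriv_change:
  assumes c: "c \<in> charts_at A x" and d: "d \<in> charts_at A x" and K: "K \<in> commutant"
  defines "j \<equiv> jac c d (snd c x)"
  shows "dten d K x (j *v \<xi>) ** j + ten d K (snd d x) ** hess c d x \<xi>
    = hess c d x \<xi> ** ten c K (snd c x) + j ** dten c K x \<xi>"
proof -
  note S = overlap_point[OF c d]
  have td: "(transition c d has_derivative (\<lambda>\<xi>. j *v \<xi>)) (at (snd c x))"
    using FD_works[OF differentiable_transition[OF c d]] jac_apply[OF c d] unfolding j_def by simp
  have pt: "transition c d (snd c x) = snd d x" using chart_inv_left charts_atD[OF c] by simp
  have "((\<lambda>y. ten d K (transition c d y)) has_derivative (\<lambda>\<xi>. dten d K x (j *v \<xi>))) (at (snd c x))"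
    using diff_chain_at[OF td] tensor_has_derivative[OF d K] pt by (simp add: o_def)
  then have 1: "((\<lambda>y. ten d K (transition c d y) ** jac c d y) has_derivative
      (\<lambda>\<xi>. ten d K (transition c d (snd c x)) ** hess c d x \<xi> + dten d K x (j *v \<xi>) ** jac c d (snd c x))) (at (snd c x))"
    by (rule mm.FDERIV[OF _ jac_has_derivative[OF c d]])
  have 2: "((\<lambda>y. jac c d y ** ten c K y) has_derivative
      (\<lambda>\<xi>. jac c d (snd c x) ** dten c K x \<xi> + hess c d x \<xi> ** ten c K (snd c x))) (at (snd c x))"
    by (rule mm.FDERIV[OF jac_has_derivative[OF c d] tensor_has_derivative[OF c K]])
  have "ten d K (transition c d y) ** jac c d y = jac c d y ** ten c K y" if y: "y \<in> snd c ` (fst c \<inter> fst d)" for y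
  proof -
    obtain q where q: "q \<in> fst c" "q \<in> fst d" "y = snd c q" using y by auto
    then have "c \<in> charts_at A q" "d \<in> charts_at A q" using c d by (auto simp: charts_at_def)
    then show ?thesis using tensor_change[of c q d K] K q chart_inv_left charts_atD by simp
  qed
  then have "((\<lambda>y. jac c d y ** ten c K y) has_derivative
      (\<lambda>\<xi>. ten d K (transition c d (snd c x)) ** hess c d x \<xi> + dten d K x (j *v \<xi>) ** jac c d (snd c x))) (at (snd c x))"
    using has_derivative_cong_open[OF S, of "\<lambda>y. ten d K (transition c d y) ** jac c d y" "\<lambda>y. jac c d y ** ten c K y"] 1
    by blast
  from fun_cong[OF has_derivative_unique[OF this 2], of \<xi>] show ?thesis
    unfolding pt j_def by (simp add: add.commute)
qed

text \<open>Differentiating \<open>ten c K y ** s y = s y ** K\<close> avoids the derivative of the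
  inverse of s.\<close>

lemma tensor_deriv_section:
  assumes S: "local_section c U s" and c: "c \<in> A" and y: "y \<in> U" and K: "K \<in> commutant"
  defines "D \<equiv> \<lambda>\<xi>. matrix_inv (s y) ** FD s y \<xi>"
  shows "FD (ten c K) y \<xi> = s y ** (D \<xi> ** K - K ** D \<xi>) ** matrix_inv (s y)"
proof -
  note U = local_sectionD(1,2)[OF S] and s = local_sectionD(3,4)[OF S]
  have ds: "(s has_derivative FD s y) (at y)"
    by (rule FD_works[OF smooth_on_differentiable[OF s(1) y]])
  have dt: "(ten c K has_derivative FD (ten c K) y) (at y)"
    by (rule FD_works[OF smooth_on_differentiable[OF smooth_tensor[OF c K]]]) (use U y in auto)
  have "((\<lambda>y. ten c K y ** s y) has_derivative (\<lambda>\<xi>. ten c K y ** FD s y \<xi> + FD (ten c K) y \<xi> ** s y)) (at y)"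
    by (rule mm.FDERIV[OF dt ds])
  moreover have "((\<lambda>y. s y ** K) has_derivative (\<lambda>\<xi>. FD s y \<xi> ** K)) (at y)"
    by (rule bounded_linear.has_derivative[OF mm.bounded_linear_left ds])
  moreover have "ten c K y ** s y = s y ** K" if "y \<in> U" for y
    by (simp add: tensor_section[OF S c that K] matrix_inv_cancel[OF s(2)[OF that]])
  ultimately have "(\<lambda>\<xi>. ten c K y ** FD s y \<xi> + FD (ten c K) y \<xi> ** s y) = (\<lambda>\<xi>. FD s y \<xi> ** K)"
    using has_derivative_cong_open[OF U(1) y, of "\<lambda>y. ten c K y ** s y" "\<lambda>y. s y ** K"] has_derivative_unique by blast
  from fun_cong[OF this, of \<xi>]
  have "FD (ten c K) y \<xi> ** s y = FD s y \<xi> ** K - ten c K y ** FD s y \<xi>" by (simp add: algebra_simps)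
  then have "FD (ten c K) y \<xi> ** s y ** matrix_inv (s y) = (FD s y \<xi> ** K - ten c K y ** FD s y \<xi>) ** matrix_inv (s y)"
    by simp
  then show ?thesis
    by (simp add: D_def tensor_section[OF S c y K] matrix_inv_cancel[OF s(2)[OF y]] mm_distrib matrix_mul_assoc)
      (simp add: matrix_inv[OF s(2)[OF y]])
qed

section \<open>The local solution and its behaviour under changes of charts\<close>

lemma wa_section_iff:
  assumes S: "local_section c U s" and c: "c \<in> A" and y: "y \<in> U"
  shows "well_adapted_coeff (\<lambda>K. ten c K y) (\<lambda>K. FD (ten c K) y) \<Gamma>
    \<longleftrightarrow> \<Gamma> = coeff_solution (s y) (\<lambda>\<xi>. matrix_inv (s y) ** FD s y \<xi>)"
proof (rule well_adapted_coeff_iff[OF local_sectionD(4)[OF S y]])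
  have "linear (FD s y)" using FD_linear[OF smooth_on_differentiable[OF local_sectionD(3)[OF S] y]] by (rule bounded_linear.linear)
  then show "linear (\<lambda>\<xi>. matrix_inv (s y) ** FD s y \<xi>)"
    by (intro linearI) (simp_all add: linear_add linear_cmul mm_distrib mm.scaleR_right)
qed (rule tensor_section[OF S c y] tensor_deriv_section[OF S c y]; assumption)+

lemma wa_unique:
  assumes "c \<in> charts_at A x" shows "\<exists>!\<Gamma>. wa c x \<Gamma>"
proof -
  obtain U s where S: "local_section c U s" and y: "snd c x \<in> U" by (rule local_section_exists[OF assms])
  show ?thesis using wa_section_iff[OF S charts_atD(1)[OF assms] y] by auto
qed

text \<open>Characterised by the system in the chart alone; local frame fields enter only through
  the proofs of existence, uniqueness and smoothness.\<close>

definition wa_coeff :: "('a, real^('n + 'n)) chart \<Rightarrow> 'a \<Rightarrow> real^('n + 'n) \<Rightarrow> real^('n + 'n)^('n + 'n)" where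
  "wa_coeff c x = (THE \<Gamma>. wa c x \<Gamma>)"

lemma wa_wa_coeff: "c \<in> charts_at A x \<Longrightarrow> wa c x (wa_coeff c x)"
  unfolding wa_coeff_def by (rule theI'[OF wa_unique])

lemma wa_coeff_eqI: "c \<in> charts_at A x \<Longrightarrow> wa c x \<Gamma> \<Longrightarrow> wa_coeff c x = \<Gamma>"
  using wa_unique wa_wa_coeff by blast

lemma linear_wa_coeff: "c \<in> charts_at A x \<Longrightarrow> linear (wa_coeff c x)"
  using wa_wa_coeff[of c x] by (simp add: well_adapted_coeff_def)

lemma smooth_wa_coeff:
  assumes c: "c \<in> A"
  shows "smooth_on (snd c ` fst c) (\<lambda>y. wa_coeff c (chart_inv c y) \<xi>)"
proof (rule smooth_on_local)
  fix z assume "z \<in> snd c ` fst c"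
  then obtain x where x: "x \<in> fst c" "z = snd c x" by auto
  have cx: "c \<in> charts_at A x" using x c by (simp add: charts_at_def)
  obtain U s where S: "local_section c U s" and xU: "snd c x \<in> U" by (rule local_section_exists[OF cx])
  note U = local_sectionD(1,3,4,2)[OF S]
  let ?D = "\<lambda>y \<xi>. matrix_inv (s y) ** FD s y \<xi>"
  have lin: "linear (?D y)" if "y \<in> U" for y
    using bounded_linear.linear[OF FD_linear[OF smooth_on_differentiable[OF U(2) that]]]
    by (intro linearI) (simp_all add: linear_add linear_cmul mm_distrib mm.scaleR_right)
  have "smooth_on U (\<lambda>y. coeff_solution (s y) (?D y) \<xi>)"
  proof (rule smooth_on_coeff_solution[OF U(1-3) lin])
    show "smooth_on U (\<lambda>y. ?D y \<xi>)" for \<xi>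
      by (intro smooth_on_matrix_mult smooth_on_matrix_inv smooth_on_FD_const U(1-3))
  qed
  moreover have "wa_coeff c (chart_inv c y) = coeff_solution (s y) (?D y)" if y: "y \<in> U" for y
  proof (rule wa_coeff_eqI)
    obtain p where p: "p \<in> fst c" "y = snd c p" using U(4) y by auto
    then show "c \<in> charts_at A (chart_inv c y)" using c chart_inv_left[OF c] by (simp add: charts_at_def)
    have "snd c (chart_inv c y) = y" using p chart_inv_left[OF c] by simp
    then show "wa c (chart_inv c y) (coeff_solution (s y) (?D y))"
      using wa_section_iff[OF S c y] by simp
  qed
  ultimately have "smooth_on U (\<lambda>y. wa_coeff c (chart_inv c y) \<xi>)"
    by (subst smooth_on_cong[OF U(1)]) auto
  then show "\<exists>T. open T \<and> z \<in> T \<and> smooth_on T (\<lambda>y. wa_coeff c (chart_inv c y) \<xi>)" using U(1) xU x by blast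
qed

text \<open>A solution in d, transported by the law of Christoffel symbols, solves the system in c.
  Parallelism survives by \<open>tensor_deriv_change\<close>; in the trace condition the symmetric
  Hessian disappears from the antisymmetrisation.\<close>

lemma wa_change:
  assumes c: "c \<in> charts_at A x" and d: "d \<in> charts_at A x" and wa: "wa d x \<Gamma>"
  defines "j \<equiv> jac c d (snd c x)"
  shows "wa c x (\<lambda>\<xi>. matrix_inv j ** (hess c d x \<xi> + \<Gamma> (j *v \<xi>) ** j))" (is "wa c x ?\<Gamma>'")
proof -
  have j: "invertible j" unfolding j_def by (rule jac_invertible[OF c d])
  have lin: "linear \<Gamma>" using wa by (simp add: well_adapted_coeff_def)
  have j\<Gamma>: "j ** ?\<Gamma>' \<xi> = hess c d x \<xi> + \<Gamma> (j *v \<xi>) ** j" for \<xi>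
    by (simp add: matrix_inv_cancel[OF j])
  have lin': "linear ?\<Gamma>'"
    by (rule linearI) (simp_all add: linear_add[OF lin] linear_cmul[OF lin] linear_add[OF linear_hess[OF c d]]
        linear_cmul[OF linear_hess[OF c d]] mv_distrib mm_distrib mv.scaleR_right mm.scaleR_left mm.scaleR_right algebra_simps)
  have par: "dten c K x \<xi> + ?\<Gamma>' \<xi> ** ten c K (snd c x) = ten c K (snd c x) ** ?\<Gamma>' \<xi>" if K: "K \<in> commutant" for K \<xi>
  proof -
    let ?Jc = "ten c K (snd c x)" and ?Jd = "ten d K (snd d x)"
    have J: "?Jd ** j = j ** ?Jc" unfolding j_def by (rule tensor_change[OF c d K])
    have L: "dten d K x (j *v \<xi>) ** j + ?Jd ** hess c d x \<xi> = hess c d x \<xi> ** ?Jc + j ** dten c K x \<xi>"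
      unfolding j_def by (rule tensor_deriv_change[OF c d K])
    have P: "(dten d K x (j *v \<xi>) + \<Gamma> (j *v \<xi>) ** ?Jd) ** j = ?Jd ** \<Gamma> (j *v \<xi>) ** j"
      using wa K by (simp add: well_adapted_coeff_def)
    \<comment> \<open>The equation is verified after left multiplication by the invertible j, which
      clears the inverse in the transported form.\<close>
    have "j ** (dten c K x \<xi> + ?\<Gamma>' \<xi> ** ?Jc) = j ** dten c K x \<xi> + (j ** ?\<Gamma>' \<xi>) ** ?Jc"
      by (simp add: mm_distrib matrix_mul_assoc)
    also have "\<dots> = (hess c d x \<xi> ** ?Jc + j ** dten c K x \<xi>) + \<Gamma> (j *v \<xi>) ** (j ** ?Jc)"
      unfolding j\<Gamma> by (simp add: mm_distrib matrix_mul_assoc)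
    also have "\<dots> = ?Jd ** hess c d x \<xi> + (dten d K x (j *v \<xi>) + \<Gamma> (j *v \<xi>) ** ?Jd) ** j"
      unfolding L[symmetric] J[symmetric] by (simp add: mm_distrib matrix_mul_assoc)
    also have "\<dots> = ?Jd ** (j ** ?\<Gamma>' \<xi>)"
      unfolding P j\<Gamma> by (simp add: mm_distrib matrix_mul_assoc)
    also have "\<dots> = j ** (?Jc ** ?\<Gamma>' \<xi>)"
      by (simp only: matrix_mul_assoc J)
    finally show ?thesis by (metis matrix_inv_cancel(2)[OF j])
  qed
  have tr: "trace (E ** (?\<Gamma>' \<xi> - flip ?\<Gamma>' \<xi>)) = 0"
    if E: "\<And>K. K \<in> commutant \<Longrightarrow> E ** ten c K (snd c x) = ten c K (snd c x) ** E" for E \<xi>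
  proof -
    let ?E = "j ** E ** matrix_inv j" and ?X = "\<Gamma> (j *v \<xi>) - flip \<Gamma> (j *v \<xi>)"
    have "?E ** ten d K (snd d x) = ten d K (snd d x) ** ?E" if K: "K \<in> commutant" for K
    proof -
      have "ten d K (snd d x) = j ** ten c K (snd c x) ** matrix_inv j"
        using tensor_change[OF c d K] unfolding j_def[symmetric] by (metis matrix_inv_cancel(3)[OF j])
      then show ?thesis using E[OF K] commutes_conj_iff[OF j] by simp
    qed
    then have t: "trace (?E ** ?X) = 0" using wa by (simp add: well_adapted_coeff_def)
    have "?\<Gamma>' \<xi> - flip ?\<Gamma>' \<xi> = matrix_inv j ** ?X ** j"
    proof (rule matrix_ext)
      fix \<eta>
      show "(?\<Gamma>' \<xi> - flip ?\<Gamma>' \<xi>) *v \<eta> = (matrix_inv j ** ?X ** j) *v \<eta>"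
        unfolding mv.diff_left flip_apply[OF lin']
        using hess_symmetric[OF c d, of \<xi> \<eta>]
        by (simp add: matrix_vector_mul_assoc[symmetric] mv_distrib flip_apply[OF lin])
    qed
    then have "trace (E ** (?\<Gamma>' \<xi> - flip ?\<Gamma>' \<xi>)) = trace ((E ** matrix_inv j ** ?X) ** j)"
      by (simp add: matrix_mul_assoc)
    also have "\<dots> = trace (j ** (E ** matrix_inv j ** ?X))" by (rule trace_mul_sym)
    also have "\<dots> = 0" using t by (simp add: matrix_mul_assoc)
    finally show ?thesis .
  qed
  show ?thesis using lin' par tr unfolding well_adapted_coeff_def by blast
qed

lemma wa_coeff_change:
  assumes c: "c \<in> charts_at A x" and d: "d \<in> charts_at A x"
  shows "jac c d (snd c x) ** wa_coeff c x \<xi> =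
    hess c d x \<xi> + wa_coeff d x (jac c d (snd c x) *v \<xi>) ** jac c d (snd c x)"
  unfolding wa_coeff_eqI[OF c wa_change[OF c d wa_wa_coeff[OF d]]]
  by (simp add: matrix_inv_cancel[OF jac_invertible[OF c d]])

end

section \<open>Well-adapted connections\<close>

lemma (in smooth_atlas_vec) end_trace_torsion:
  assumes \<omega>: "linear_connection A \<omega>" and c: "c \<in> charts_at A x" and X: "X \<in> tangent_space A x"
    and S: "\<And>v. v \<in> tangent_space A x \<Longrightarrow> S v \<in> tangent_space A x" "\<And>v. v \<in> tangent_space A x \<Longrightarrow> S v c = L *v v c"
  shows "end_trace A x (\<lambda>v. S (torsion A \<omega> x X v))
    = trace (L ** (conn_coeff \<omega> c x (X c) - flip (conn_coeff \<omega> c x) (X c)))"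
proof -
  have x: "x \<in> carrier A" using charts_atD[OF c] chart_subset_carrier by blast
  show ?thesis
  proof (rule end_trace_eq[OF x c])
    fix v assume v: "v \<in> tangent_space A x"
    note t = torsion_tangent[OF \<omega> x X v]
    show "S (torsion A \<omega> x X v) \<in> tangent_space A x" using S(1)[OF t] .
    show "S (torsion A \<omega> x X v) c = (L ** (conn_coeff \<omega> c x (X c) - flip (conn_coeff \<omega> c x) (X c))) *v v c"
      unfolding S(2)[OF t]
      by (simp add: torsion_eq[OF \<omega> x X v] c matrix_vector_mul_assoc[symmetric] mv_distrib
          flip_apply[OF linear_conn_coeff[OF \<omega> c]])
  qed
qed

context diagonal_structure
begin

text \<open>A horizontal vector over \<xi> is the velocity of a curve in B. Along the curve the
  frame matrix M satisfies \<open>ten c K\<close> times M = M times K; differentiating at 0, where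
  M' is minus the coefficient at \<xi> times M, gives the equation.\<close>

lemma adapted_imp_parallel:
  assumes \<omega>: "linear_connection A \<omega>" and ad: "adapted A B \<omega>" and c: "c \<in> charts_at A x" and K: "K \<in> commutant"
  shows "dten c K x \<xi> + conn_coeff \<omega> c x \<xi> ** ten c K (snd c x) = ten c K (snd c x) ** conn_coeff \<omega> c x \<xi>"
proof -
  have "x \<in> carrier A" using charts_atD[OF c] chart_subset_carrier by blast
  then obtain p where p: "p \<in> B" "fst p = x" by (rule frame_exists)
  note pF = B_frames[OF p(1)]
  have cp: "c \<in> charts_at A (fst p)" using c p by simp
  note C = frame_charts_atI[OF pF cp] and M = fmat_invertible[OF pF cp]
  let ?M = "fmat c p" and ?G = "conn_coeff \<omega> c x \<xi>" and ?T = "ten c K (snd c x)"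
  define h where "h = ftvec p c (\<xi>, - (?G ** ?M))"
  have hT: "h \<in> tangent_space FA p" unfolding h_def by (rule FA.tvec_of_tangent[OF C])
  have hC: "h (fc c) = (\<xi>, - (?G ** ?M))" unfolding h_def by (rule FA.tvec_of_self[OF C])
  have "\<omega> p h = 0" using connection_formula[OF \<omega> pF cp hT] p(2) by (simp add: hC)
  then have "h \<in> tangent_of A B p" using ad p(1) hT unfolding adapted_def by blast
  then obtain \<gamma> \<epsilon> where \<gamma>: "h = curve_velocity FA \<gamma> 0" "\<epsilon> > 0" "smooth_map real_atlas FA {-\<epsilon><..<\<epsilon>} \<gamma>"
    "\<gamma> ` {-\<epsilon><..<\<epsilon>} \<subseteq> B" "\<gamma> 0 = p"
    unfolding tangent_of_def by blast
  have "fc c \<in> FA" "\<gamma> 0 \<in> fst (fc c)" using FA.charts_atD[OF C] \<gamma>(5) by auto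
  moreover have "0 \<in> {-\<epsilon><..<\<epsilon>}" using \<gamma>(2) by simp
  ultimately obtain V where V: "open V" "0 \<in> V" "V \<subseteq> {-\<epsilon><..<\<epsilon>}" "\<gamma> ` V \<subseteq> fst (fc c)" "smooth_on V (snd (fc c) \<circ> \<gamma>)"
    using FA.smooth_curve_chart[OF \<gamma>(3)] by metis
  define z where "z = snd (fc c) \<circ> \<gamma>"
  have z0: "z 0 = (snd c x, ?M)" using \<gamma>(5) p(2) by (simp add: z_def snd_frame_chart)
  have zd: "(z has_vector_derivative h (fc c)) (at 0)"
  proof -
    have "z differentiable (at 0)" unfolding z_def using V by (intro smooth_on_differentiable[OF V(5)])
    then have "(z has_vector_derivative vector_derivative z (at 0)) (at 0)" using vector_derivative_works by blast
    moreover have "h (fc c) = vector_derivative z (at 0)"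
      using C \<gamma>(1,5) by (simp add: curve_velocity_def z_def)
    ultimately show ?thesis by simp
  qed
  then have zd': "(z has_derivative (\<lambda>t. t *\<^sub>R h (fc c))) (at 0)" by (simp add: has_vector_derivative_def)
  have y: "((\<lambda>t. fst (z t)) has_derivative (\<lambda>t. t *\<^sub>R \<xi>)) (at 0)"
    using has_derivative_fst[OF zd'] by (simp add: hC)
  have m: "((\<lambda>t. snd (z t)) has_derivative (\<lambda>t. t *\<^sub>R (- (?G ** ?M)))) (at 0)"
    using has_derivative_snd[OF zd'] by (simp add: hC)
  have "((\<lambda>t. ten c K (fst (z t))) has_derivative (\<lambda>t. dten c K x (t *\<^sub>R \<xi>))) (at 0)"
    using diff_chain_at[OF y, of "ten c K" "dten c K x"] tensor_has_derivative[OF c K] z0 by (simp add: o_def)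
  from mm.FDERIV[OF this m]
  have 1: "((\<lambda>t. ten c K (fst (z t)) ** snd (z t)) has_derivative
      (\<lambda>t. ?T ** (t *\<^sub>R (- (?G ** ?M))) + dten c K x (t *\<^sub>R \<xi>) ** ?M)) (at 0)"
    by (simp add: z0)
  have 2: "((\<lambda>t. snd (z t) ** K) has_derivative (\<lambda>t. (t *\<^sub>R (- (?G ** ?M))) ** K)) (at 0)"
    by (rule bounded_linear.has_derivative[OF mm.bounded_linear_left m])
  have "ten c K (fst (z t)) ** snd (z t) = snd (z t) ** K" if t: "t \<in> V" for t
  proof -
    have q: "\<gamma> t \<in> B" "fst (\<gamma> t) \<in> fst c" using V(3,4) \<gamma>(4) t by (auto simp: fst_frame_chart image_subset_iff)
    then have cq: "c \<in> charts_at A (fst (\<gamma> t))" using charts_atD[OF c] by (simp add: charts_at_def)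
    show ?thesis
      using tensor_eq[OF q(1) cq K] matrix_inv_cancel[OF fmat_invertible[OF B_frames[OF q(1)] cq]]
      by (simp add: z_def snd_frame_chart)
  qed
  then have "((\<lambda>t. snd (z t) ** K) has_derivative
      (\<lambda>t. ?T ** (t *\<^sub>R (- (?G ** ?M))) + dten c K x (t *\<^sub>R \<xi>) ** ?M)) (at 0)"
    using has_derivative_cong_open[OF V(1,2), of "\<lambda>t. ten c K (fst (z t)) ** snd (z t)" "\<lambda>t. snd (z t) ** K"] 1 by blast
  from fun_cong[OF has_derivative_unique[OF this 2], of 1]
  have "dten c K x \<xi> ** ?M = ?T ** ?G ** ?M - ?G ** (?M ** K)"
    by (simp add: mm_distrib matrix_mul_assoc algebra_simps)
  also have "?M ** K = ?T ** ?M"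
    using tensor_eq[OF p(1) cp K] p(2) by (simp add: matrix_inv_cancel[OF M])
  finally have "dten c K x \<xi> ** ?M ** matrix_inv ?M = (?T ** ?G - ?G ** ?T) ** ?M ** matrix_inv ?M"
    by (simp add: mm_distrib matrix_mul_assoc)
  then show ?thesis by (simp add: matrix_inv_cancel[OF M])
qed

text \<open>Conjugated into the frame s, the parallelism equation says that the coefficient plus the
  logarithmic derivative commutes with the commutant; the bicommutant property does the
  rest.\<close>

lemma parallel_section:
  assumes S: "local_section c U s" and c: "c \<in> A" and y: "y \<in> U"
    and par: "\<And>K. K \<in> commutant \<Longrightarrow> FD (ten c K) y \<xi> + G ** ten c K y = ten c K y ** G"
  shows "matrix_inv (s y) ** G ** s y + matrix_inv (s y) ** FD s y \<xi> \<in> Delta_gl" (is "?a \<in> _")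
  unfolding Delta_gl_iff
proof
  note inv = local_sectionD(4)[OF S y]
  fix K :: "real^('n + 'n)^('n + 'n)" assume K: "K \<in> commutant"
  let ?c = "\<lambda>a. s y ** a ** matrix_inv (s y)" and ?D = "matrix_inv (s y) ** FD s y \<xi>"
  have T: "ten c K y = ?c K" by (rule tensor_section[OF S c y K])
  have "FD (ten c K) y \<xi> = ?c ?D ** ?c K - ?c K ** ?c ?D"
    using tensor_deriv_section[OF S c y K, of \<xi>]
    by (simp add: mm_distrib matrix_mul_assoc matrix_inv_cancel[OF inv])
  moreover have "?c ?a = G + ?c ?D"
    by (simp add: mm_distrib matrix_mul_assoc matrix_inv_cancel[OF inv] matrix_inv[OF inv])
  moreover have "(G + Y) ** Z = Z ** (G + Y)" if "L = Y ** Z - Z ** Y" "L + G ** Z = Z ** G"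
    for L Y Z :: "real^('n + 'n)^('n + 'n)"
  proof -
    have "(G + Y) ** Z = (L + G ** Z) + Z ** Y" unfolding that(1) by (simp add: mm_distrib)
    then show ?thesis unfolding that(2) by (simp add: mm_distrib)
  qed
  ultimately have "?c ?a ** ?c K = ?c K ** ?c ?a"
    using par[OF K] unfolding T by metis
  then show "?a ** K = K ** ?a" by (simp only: commutes_conj_iff[OF inv])
qed

text \<open>Each horizontal vector has to be realised by a curve in B. The base point moves along a
  coordinate line, and the frame is s along that line times a path in the group whose initial
  velocity corrects the derivative of s.\<close>

lemma parallel_imp_adapted:
  assumes \<omega>: "linear_connection A \<omega>"
    and par: "\<And>c x K \<xi>. c \<in> charts_at A x \<Longrightarrow> K \<in> commutant \<Longrightarrow>
      dten c K x \<xi> + conn_coeff \<omega> c x \<xi> ** ten c K (snd c x) = ten c K (snd c x) ** conn_coeff \<omega> c x \<xi>"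
  shows "adapted A B \<omega>"
  unfolding adapted_def
proof (intro ballI subsetI)
  fix p h assume p: "p \<in> B" and "h \<in> {h \<in> tangent_space FA p. \<omega> p h = 0}"
  then have h: "h \<in> tangent_space FA p" "\<omega> p h = 0" by auto
  note pF = B_frames[OF p]
  define x where "x = fst p"
  obtain c where c: "c \<in> charts_at A (fst p)" using charts_at_nonempty[OF framesD(1)[OF pF]] by blast
  have cx: "c \<in> charts_at A x" using c by (simp add: x_def)
  have cA: "c \<in> A" "x \<in> fst c" using charts_atD[OF cx] by auto
  note C = frame_charts_atI[OF pF c] and M = fmat_invertible[OF pF c]
  have CA: "fc c \<in> FA" using FA.charts_atD[OF C] by auto
  obtain U s where S: "local_section c U s" and y: "snd c x \<in> U" by (rule local_section_exists[OF cx])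
  note U = local_sectionD(1,2)[OF S] and s = local_sectionD(3,4)[OF S]
  define y0 where "y0 = snd c x"
  have y0: "y0 \<in> U" using y by (simp add: y0_def)
  let ?M = "fmat c p"
  obtain g where g: "g \<in> Delta_GL" "?M = s y0 ** g"
    using local_sectionD(5)[OF S, of p] p cA(2) y by (auto simp: x_def y0_def)
  define \<xi> where "\<xi> = fst (h (fc c))"
  define G where "G = conn_coeff \<omega> c x \<xi>"
  have H: "snd (h (fc c)) = - (G ** ?M)"
  proof -
    have "matrix_inv ?M ** (snd (h (fc c)) + G ** ?M) = 0"
      using connection_formula[OF \<omega> pF c h(1)] h(2) by (simp add: G_def \<xi>_def x_def)
    then have "snd (h (fc c)) + G ** ?M = 0" by (metis matrix_inv_cancel(1)[OF M] mm.zero_right)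
    then show ?thesis by (simp add: eq_neg_iff_add_eq_0)
  qed
  define \<theta> where "\<theta> = matrix_inv (s y0) ** G ** s y0 + matrix_inv (s y0) ** FD s y0 \<xi>"
  have "\<theta> \<in> Delta_gl"
    unfolding \<theta>_def using par[OF cx] by (intro parallel_section[OF S cA(1) y0]) (simp add: G_def y0_def)
  then obtain b where b: "\<theta> = block_diag b" by (auto simp: Delta_gl_def)
  obtain a where a: "g = block_diag a" "invertible a" using g(1) by (auto simp: Delta_GL_def)
  \<comment> \<open>Since s \<theta> = G s + ds(\<xi>), the path
    \<open>g - t *\<^sub>R (\<theta> ** g)\<close> gives s(y0 + t \<xi>) times it the derivative
    ds(\<xi>) g - s \<theta> g = - G s g at 0, which is the matrix part of h.\<close>
  define N where "N t = a - t *\<^sub>R (b ** a)" for t :: real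
  have N: "block_diag (N t) = g - t *\<^sub>R (\<theta> ** g)" for t
    by (simp add: N_def linear_diff[OF linear_block_diag] linear_cmul[OF linear_block_diag] a b block_diag_mult)
  \<comment> \<open>Both U and the invertible matrices are open, so a short piece of the affine path
    stays over U and inside the group.\<close>
  have "open ((\<lambda>t. y0 + t *\<^sub>R \<xi>) -` U \<inter> N -` {A. invertible A})"
    unfolding N_def by (intro open_Int open_vimage U(1) open_invertible continuous_intros)
  moreover have "0 \<in> (\<lambda>t. y0 + t *\<^sub>R \<xi>) -` U \<inter> N -` {A. invertible A}" using y0 a by (simp add: N_def)
  ultimately obtain \<epsilon> where \<epsilon>: "\<epsilon> > 0" "ball 0 \<epsilon> \<subseteq> (\<lambda>t. y0 + t *\<^sub>R \<xi>) -` U \<inter> N -` {A. invertible A}"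
    using open_contains_ball by blast
  let ?I = "{-\<epsilon><..<\<epsilon>}"
  have I: "y0 + t *\<^sub>R \<xi> \<in> U" "invertible (N t)" if "t \<in> ?I" for t
    using that \<epsilon>(2) by (auto simp: dist_real_def subset_iff)
  define \<gamma> where "\<gamma> t = frame_of A c (chart_inv c (y0 + t *\<^sub>R \<xi>)) (s (y0 + t *\<^sub>R \<xi>) ** block_diag (N t))" for t
  have pt: "chart_inv c (y0 + t *\<^sub>R \<xi>) \<in> fst c" "snd c (chart_inv c (y0 + t *\<^sub>R \<xi>)) = y0 + t *\<^sub>R \<xi>"
    "c \<in> charts_at A (chart_inv c (y0 + t *\<^sub>R \<xi>))" "invertible (s (y0 + t *\<^sub>R \<xi>) ** block_diag (N t))"
    if t: "t \<in> ?I" for t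
  proof -
    obtain q where "q \<in> fst c" "y0 + t *\<^sub>R \<xi> = snd c q" using I(1)[OF t] U(2) by auto
    then show "chart_inv c (y0 + t *\<^sub>R \<xi>) \<in> fst c" "snd c (chart_inv c (y0 + t *\<^sub>R \<xi>)) = y0 + t *\<^sub>R \<xi>"
      "c \<in> charts_at A (chart_inv c (y0 + t *\<^sub>R \<xi>))"
      using chart_inv_left[OF cA(1)] cA(1) by (auto simp: charts_at_def)
    show "invertible (s (y0 + t *\<^sub>R \<xi>) ** block_diag (N t))"
      using s(2)[OF I(1)[OF t]] block_diag_inverse(1)[OF I(2)[OF t]] by (rule invertible_mult)
  qed
  note fr = frame_of_frame[OF pt(3,4)]
  have \<gamma>B: "\<gamma> t \<in> B" if t: "t \<in> ?I" for t
  proof -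
    have "block_diag (N t) \<in> Delta_GL" using I(2)[OF t] by (auto simp: Delta_GL_def)
    then show ?thesis
      using local_sectionD(5)[OF S, of "\<gamma> t"] fr[OF t t] pt(1,2)[OF t] I(1)[OF t] by (auto simp: \<gamma>_def)
  qed
  have \<gamma>C: "\<gamma> t \<in> fst (fc c)" "snd (fc c) (\<gamma> t) = (y0 + t *\<^sub>R \<xi>, s (y0 + t *\<^sub>R \<xi>) ** block_diag (N t))"
    if t: "t \<in> ?I" for t
    using fr[OF t t] pt(1,2)[OF t] by (auto simp: \<gamma>_def fst_frame_chart snd_frame_chart)
  have "?M = s y0 ** block_diag (N 0)" by (simp add: g a N_def)
  moreover have "chart_inv c y0 = x" using chart_inv_left[OF cA] by (simp add: y0_def)
  ultimately have \<gamma>0: "\<gamma> 0 = p" using frame_of_fmat[OF pF c] by (simp add: \<gamma>_def x_def)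
  let ?z = "\<lambda>t. (y0 + t *\<^sub>R \<xi>, s (y0 + t *\<^sub>R \<xi>) ** (g - t *\<^sub>R (\<theta> ** g)))"
  have smooth: "smooth_map real_atlas FA ?I \<gamma>"
  proof (rule smooth_map_into_chart[OF smooth_atlas_real smooth_atlas_frame CA])
    show "openin (atlas_topology real_atlas) ?I" by (simp add: openin_real_atlas)
    show "\<gamma> ` ?I \<subseteq> fst (fc c)" using \<gamma>C(1) by blast
    fix e assume "e \<in> real_atlas"
    then have e: "snd e ` (fst e \<inter> ?I) = ?I" "snd (fc c) \<circ> \<gamma> \<circ> chart_inv e = snd (fc c) \<circ> \<gamma>" by auto
    have "smooth_on ?I (\<lambda>t. y0 + t *\<^sub>R \<xi>)" by (intro smooth_intros open_greaterThanLessThan)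
    moreover have "smooth_on ?I (\<lambda>t. s (y0 + t *\<^sub>R \<xi>))"
      by (rule smooth_on_compose[of _ _ "\<lambda>t. y0 + t *\<^sub>R \<xi>" s, OF open_greaterThanLessThan U(1) _ calculation s(1)])
        (use I(1) in auto)
    ultimately have "smooth_on ?I ?z" by (intro smooth_intros open_greaterThanLessThan)
    then show "smooth_on (snd e ` (fst e \<inter> ?I)) (snd (fc c) \<circ> \<gamma> \<circ> chart_inv e)"
      unfolding e by (subst smooth_on_cong[OF open_greaterThanLessThan]) (auto simp: \<gamma>C(2) N)
  qed
  have ds: "(s has_derivative FD s y0) (at (y0 + 0 *\<^sub>R \<xi>))"
    using FD_works[OF smooth_on_differentiable[OF s(1) y0]] by simp
  have yd: "((\<lambda>t. y0 + t *\<^sub>R \<xi>) has_derivative (\<lambda>t. t *\<^sub>R \<xi>)) (at 0)"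
    by (auto intro!: derivative_eq_intros)
  have sd: "((\<lambda>t. s (y0 + t *\<^sub>R \<xi>)) has_derivative (\<lambda>t. FD s y0 (t *\<^sub>R \<xi>))) (at 0)"
    using diff_chain_at[OF yd ds] by (simp add: o_def)
  have nd: "((\<lambda>t. g - t *\<^sub>R (\<theta> ** g)) has_derivative (\<lambda>t. - (t *\<^sub>R (\<theta> ** g)))) (at 0)"
    by (auto intro!: derivative_eq_intros)
  have "(?z has_derivative (\<lambda>t. (t *\<^sub>R \<xi>, s (y0 + 0 *\<^sub>R \<xi>) ** (- (t *\<^sub>R (\<theta> ** g))) + FD s y0 (t *\<^sub>R \<xi>) ** (g - 0 *\<^sub>R (\<theta> ** g))))) (at 0)"
    by (intro has_derivative_Pair yd mm.FDERIV[OF sd nd])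
  moreover have "(\<lambda>t. (t *\<^sub>R \<xi>, s (y0 + 0 *\<^sub>R \<xi>) ** (- (t *\<^sub>R (\<theta> ** g))) + FD s y0 (t *\<^sub>R \<xi>) ** (g - 0 *\<^sub>R (\<theta> ** g))))
      = (\<lambda>t. t *\<^sub>R h (fc c))"
  proof
    fix t :: real
    have "linear (FD s y0)" using has_derivative_linear[OF ds] by simp
    moreover have "s y0 ** (\<theta> ** g) = G ** ?M + FD s y0 \<xi> ** g"
      by (simp add: \<theta>_def g(2) mm_distrib matrix_mul_assoc matrix_inv[OF s(2)[OF y0]])
    ultimately have "s y0 ** (- (t *\<^sub>R (\<theta> ** g))) + FD s y0 (t *\<^sub>R \<xi>) ** g = t *\<^sub>R snd (h (fc c))"
      by (simp add: H linear_cmul mm_distrib mm.scaleR_left mm.scaleR_right algebra_simps)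
    then show "(t *\<^sub>R \<xi>, s (y0 + 0 *\<^sub>R \<xi>) ** (- (t *\<^sub>R (\<theta> ** g))) + FD s y0 (t *\<^sub>R \<xi>) ** (g - 0 *\<^sub>R (\<theta> ** g)))
        = t *\<^sub>R h (fc c)"
      by (simp add: \<xi>_def prod_eq_iff)
  qed
  ultimately have "(?z has_vector_derivative h (fc c)) (at 0)" by (simp add: has_vector_derivative_def)
  then have "((snd (fc c) \<circ> \<gamma>) has_vector_derivative h (fc c)) (at 0)"
    unfolding has_vector_derivative_def
    by (rule has_derivative_transform_within_open[of _ _ _ _ ?I]) (use \<epsilon>(1) \<gamma>C(2) N in auto)
  then have "curve_velocity FA \<gamma> 0 = ftvec p c (h (fc c))"
    using FA.curve_velocity_eq[of "fc c" \<gamma> ?I "h (fc c)"] C \<gamma>0 \<gamma>C(1) \<epsilon>(1) by (auto simp: image_subset_iff)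
  then have "curve_velocity FA \<gamma> 0 = h" using FA.tangent_eq_tvec_of[OF h(1) C] by simp
  then show "h \<in> tangent_of A B p"
    unfolding tangent_of_def using \<epsilon>(1) smooth \<gamma>B \<gamma>0 by blast
qed

section \<open>The trace condition, pointwise and for global sections\<close>

text \<open>At each point a section of the adjoint bundle is a conjugate of an element of the
  algebra by a frame of B; it commutes with the structure tensors and is thus among the test
  endomorphisms of the pointwise system.\<close>

lemma trace_condition:
  assumes \<omega>: "linear_connection A \<omega>" and wa: "\<And>c x. c \<in> charts_at A x \<Longrightarrow> wa c x (conn_coeff \<omega> c x)"
    and S: "adjoint_section A B Delta_gl S" and X: "smooth_vf A (carrier A) X" and x: "x \<in> carrier A"
  shows "end_trace A x (\<lambda>v. S x (torsion A \<omega> x (X x) v)) = 0"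
proof -
  obtain u a where ua: "(x, u) \<in> B" "a \<in> Delta_gl" "\<And>v. v \<in> tangent_space A x \<Longrightarrow> S x v = u (a *v inv u v)"
    using bspec[OF conjunct1[OF S[unfolded adjoint_section_def]] x] by blast
  define p where "p = (x, u)"
  have p: "p \<in> B" "fst p = x" "snd p = u" using ua by (auto simp: p_def)
  note pF = B_frames[OF p(1)]
  obtain c where c: "c \<in> charts_at A x" using charts_at_nonempty[OF x] by blast
  have cp: "c \<in> charts_at A (fst p)" using c p by simp
  let ?L = "fmat c p ** a ** matrix_inv (fmat c p)"
  have Xx: "X x \<in> tangent_space A x" using X x by (simp add: smooth_vf_def)
  have St: "S x v \<in> tangent_space A x" "S x v c = ?L *v v c" if v: "v \<in> tangent_space A x" for v
  proof -
    have "S x v = snd p (a *v inv (snd p) v)" using ua(3)[OF v] p(3) by simp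
    moreover have "inv (snd p) v = matrix_inv (fmat c p) *v v c" using inv_frame(1)[OF pF cp] v p(2) by simp
    ultimately show "S x v \<in> tangent_space A x" "S x v c = ?L *v v c"
      using framesD(4)[OF pF] p(2)
      by (simp_all add: fmat_apply[OF pF, symmetric] matrix_vector_mul_assoc matrix_mul_assoc)
  qed
  have "?L ** ten c K (snd c x) = ten c K (snd c x) ** ?L" if "K \<in> commutant" for K
    using tensor_eq[OF p(1) cp that] p(2) commutes_conj_iff[OF fmat_invertible[OF pF cp], of a K]
      commutant_commutes(1)[OF that ua(2)] by simp
  then have "trace (?L ** (conn_coeff \<omega> c x (X x c) - flip (conn_coeff \<omega> c x) (X x c))) = 0"
    using wa[OF c] unfolding well_adapted_coeff_def by blast
  moreover have "end_trace A x (\<lambda>v. S x (torsion A \<omega> x (X x) v))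
      = trace (?L ** (conn_coeff \<omega> c x (X x c) - flip (conn_coeff \<omega> c x) (X x c)))"
    by (rule end_trace_torsion[OF \<omega> c Xx]) (fact St)+
  ultimately show ?thesis by simp
qed

text \<open>E and \<xi> must be extended to global fields. In the local frame s, E at x has a matrix
  a in the algebra; a is kept fixed while s moves, and a bump function cuts the result off. The
  values stay in the adjoint bundle because the algebra is a linear subspace.\<close>

lemma trace_condition_pointwise:
  assumes haus: "Hausdorff_space (atlas_topology A)" and \<omega>: "linear_connection A \<omega>"
    and tr: "\<And>S X. adjoint_section A B Delta_gl S \<Longrightarrow> smooth_vf A (carrier A) X \<Longrightarrow>
        end_trace A x (\<lambda>v. S x (torsion A \<omega> x (X x) v)) = 0"
    and c: "c \<in> charts_at A x" and E: "\<And>K. K \<in> commutant \<Longrightarrow> E ** ten c K (snd c x) = ten c K (snd c x) ** E"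
  shows "trace (E ** (conn_coeff \<omega> c x \<xi> - flip (conn_coeff \<omega> c x) \<xi>)) = 0"
proof -
  have cA: "c \<in> A" "x \<in> fst c" using charts_atD[OF c] by auto
  obtain U s where S: "local_section c U s" and y: "snd c x \<in> U" by (rule local_section_exists[OF c])
  note U = local_sectionD(1,2)[OF S] and s = local_sectionD(3,4)[OF S]
  note sx = s(2)[OF y]
  define a where "a = matrix_inv (s (snd c x)) ** E ** s (snd c x)"
  have Ea: "E = s (snd c x) ** a ** matrix_inv (s (snd c x))"
    by (simp add: a_def matrix_mul_assoc matrix_inv[OF sx] matrix_inv_cancel[OF sx])
  have a: "a \<in> Delta_gl"
    unfolding Delta_gl_iff
  proof
    fix K :: "real^('n + 'n)^('n + 'n)" assume K: "K \<in> commutant"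
    show "a ** K = K ** a"
      using E[OF K] unfolding tensor_section[OF S cA(1) y K] Ea commutes_conj_iff[OF sx] .
  qed
  define W where "W = {z \<in> fst c. snd c z \<in> U}"
  have W: "openin (atlas_topology A) W" "W \<subseteq> fst c" "x \<in> W"
    using openin_coords[OF cA(1) U(1)] cA y by (auto simp: W_def)
  have cz: "c \<in> charts_at A z" if "z \<in> W" for z using that W(2) cA by (auto simp: charts_at_def)
  obtain \<beta> :: "'a \<Rightarrow> real" and K where \<beta>: "K \<subseteq> W" "openin (atlas_topology A) (carrier A - K)" "\<beta> x = 1"
    "\<And>y. y \<notin> K \<Longrightarrow> \<beta> y = 0" "smooth_fun A (carrier A) \<beta>"
    using bump_function[OF haus W(1,3)] by metis
  let ?L = "\<lambda>z. s (snd c z) ** a ** matrix_inv (s (snd c z))"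
  define S0 where "S0 z v = tvec_of A z c (?L z *v v c)" for z v
  define S1 where "S1 z v = (if z \<in> W then (\<lambda>d. \<beta> z *\<^sub>R S0 z v d) else (\<lambda>_. 0))" for z v
  define X where "X z = (if z \<in> W then (\<lambda>d. \<beta> z *\<^sub>R tvec_of A z c \<xi> d) else (\<lambda>_. 0))" for z
  have S0: "S0 z v \<in> tangent_space A z" "S0 z v c = ?L z *v v c" if "z \<in> W" for z v
    unfolding S0_def using tvec_of_tangent[OF cz[OF that]] tvec_of_self[OF cz[OF that]] by auto
  have "adjoint_section A B Delta_gl S1"
    unfolding adjoint_section_def
  proof (intro conjI ballI allI impI)
    fix z assume z: "z \<in> carrier A"
    show "\<exists>u b. (z, u) \<in> B \<and> b \<in> Delta_gl \<and> (\<forall>v\<in>tangent_space A z. S1 z v = u (b *v inv u v))"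
    proof (cases "z \<in> W")
      case True
      note c' = cz[OF True]
      have yz: "snd c z \<in> U" using True by (simp add: W_def)
      define p where "p = frame_of A c z (s (snd c z))"
      have p: "p \<in> frames A" "fst p = z" "fmat c p = s (snd c z)"
        using frame_of_frame[OF c' s(2)[OF yz]] by (auto simp: p_def)
      have cp: "c \<in> charts_at A (fst p)" using c' p by simp
      have "fmat c p = s (snd c z) ** mat 1" using p by simp
      then have pB: "p \<in> B"
        using local_sectionD(5)[OF S, of p] p(1,2) yz True W(2) Delta_GL_one by (auto simp del: matrix_mul_rid)
      have b: "\<beta> z *\<^sub>R a \<in> Delta_gl"
        using a linear_cmul[OF linear_block_diag, symmetric] by (auto simp: Delta_gl_def)
      have "S1 z v = snd p ((\<beta> z *\<^sub>R a) *v inv (snd p) v)" if v: "v \<in> tangent_space A z" for v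
      proof (rule tangent_eqI[OF _ _ c'])
        show "S1 z v \<in> tangent_space A z" using tangent_scaleR[OF S0(1)[OF True]] True by (simp add: S1_def)
        show "snd p ((\<beta> z *\<^sub>R a) *v inv (snd p) v) \<in> tangent_space A z" using framesD(4)[OF p(1)] p(2) by simp
        have "inv (snd p) v = matrix_inv (s (snd c z)) *v v c" using inv_frame(1)[OF p(1) cp] v p(2,3) by simp
        then show "S1 z v c = snd p ((\<beta> z *\<^sub>R a) *v inv (snd p) v) c"
          using True by (simp add: S1_def S0(2) fmat_apply[OF p(1), symmetric] p(3) matrix_vector_mul_assoc
              mm.scaleR_left mm.scaleR_right mv.scaleR_left mv.scaleR_right matrix_mul_assoc)
      qed
      then show ?thesis using pB b p(2) by (intro exI[of _ "snd p"] exI[of _ "\<beta> z *\<^sub>R a"]) auto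
    next
      case False
      \<comment> \<open>Off W the field is the zero endomorphism, represented by the zero matrix in
        any frame of B.\<close>
      obtain p where p: "p \<in> B" "fst p = z" using frame_exists[OF z] .
      have "snd p 0 = (\<lambda>_. 0)" using linear_0[OF framesD(2)[OF B_frames[OF p(1)]]] by blast
      moreover have "0 \<in> Delta_gl" using linear_0[OF linear_block_diag] by (auto simp: Delta_gl_def image_iff)
      ultimately show ?thesis
        using p False by (intro exI[of _ "snd p"] exI[of _ 0]) (auto simp: S1_def)
    qed
  next
    fix W' Y assume Y: "smooth_vf A W' Y"
    have W': "openin (atlas_topology A) W'" using Y by (simp add: smooth_vf_def)
    have WW: "openin (atlas_topology A) (W \<inter> W')" using W(1) W' by (rule openin_Int)
    have "smooth_vf A (W \<inter> W') (\<lambda>z. S0 z (Y z))"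
    proof (rule smooth_vf_from_chart[OF cA(1) WW])
      let ?V = "snd c ` (W \<inter> W')"
      have V: "open ?V" using openin_open[OF WW cA(1)] W(2) by (simp add: Int_absorb1 le_infI1)
      have VU: "?V \<subseteq> U" by (auto simp: W_def)
      have "smooth_on ?V (\<lambda>y. Y (chart_inv c y) c)"
      proof (rule smooth_on_mono)
        show "smooth_on (snd c ` (fst c \<inter> W')) (\<lambda>y. Y (chart_inv c y) c)"
          using Y cA(1) by (simp add: smooth_vf_def)
        show "?V \<subseteq> snd c ` (fst c \<inter> W')" using W(2) by blast
      qed
      then have "smooth_on ?V (\<lambda>y. (s y ** a ** matrix_inv (s y)) *v Y (chart_inv c y) c)"
        using VU by (intro smooth_intros V smooth_on_mono[OF s(1)] s(2)) auto
      then show "smooth_on ?V (\<lambda>y. S0 (chart_inv c y) (Y (chart_inv c y)) c)"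
        by (subst smooth_on_cong[OF V]) (use W(2) chart_inv_left[OF cA(1)] S0(2) in auto)
    qed (use W(2) S0(1) in auto)
    from smooth_vf_cutoff[OF W(1) W' \<beta>(1,2,4,5) this]
    show "smooth_vf A W' (\<lambda>z. S1 z (Y z))" by (simp add: S1_def)
  qed
  moreover have "smooth_vf A (carrier A) X"
  proof -
    have WC: "W \<inter> carrier A = W" using W(2) chart_subset_carrier[OF cA(1)] by auto
    have "smooth_vf A (W \<inter> carrier A) (\<lambda>z. tvec_of A z c \<xi>)"
      unfolding WC
    proof (rule smooth_vf_from_chart[OF cA(1) W(1,2) tvec_of_tangent[OF cz]])
      have V: "open (snd c ` W)" using openin_open[OF W(1) cA(1)] W(2) by (simp add: Int_absorb1)
      have "smooth_on (snd c ` W) (\<lambda>y. \<xi>)" by (rule smooth_on_const)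
      then show "smooth_on (snd c ` W) (\<lambda>y. tvec_of A (chart_inv c y) c \<xi> c)"
        by (subst smooth_on_cong[OF V]) (use W(2) chart_inv_left[OF cA(1)] tvec_of_self[OF cz] in auto)
    qed
    from smooth_vf_cutoff[OF W(1) openin_carrier \<beta>(1,2,4,5) this] show ?thesis by (simp add: X_def[abs_def])
  qed
  ultimately have t: "end_trace A x (\<lambda>v. S1 x (torsion A \<omega> x (X x) v)) = 0" by (rule tr)
  have Xx: "X x = tvec_of A x c \<xi>" and S1x: "S1 x v = S0 x v" for v
    using W(3) \<beta>(3) by (simp_all add: X_def S1_def)
  have "end_trace A x (\<lambda>v. S1 x (torsion A \<omega> x (X x) v))
      = trace (E ** (conn_coeff \<omega> c x (X x c) - flip (conn_coeff \<omega> c x) (X x c)))"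
    by (rule end_trace_torsion[OF \<omega> c]) (use S0[OF W(3)] tvec_of_tangent[OF c] Xx S1x Ea in auto)
  then show ?thesis using t tvec_of_self[OF c] by (simp add: Xx)
qed

text \<open>The hinge of the argument: existence, uniqueness and dependence on the jet become
  statements about the system at a single point.\<close>

lemma well_adapted_iff:
  assumes haus: "Hausdorff_space (atlas_topology A)" and \<omega>: "linear_connection A \<omega>"
  shows "well_adapted A Delta_gl B \<omega> \<longleftrightarrow> (\<forall>x. \<forall>c\<in>charts_at A x. wa c x (conn_coeff \<omega> c x))"
proof
  assume w: "well_adapted A Delta_gl B \<omega>"
  show "\<forall>x. \<forall>c\<in>charts_at A x. wa c x (conn_coeff \<omega> c x)"
  proof (intro allI ballI)
    fix x c assume c: "c \<in> charts_at A x"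
    have x: "x \<in> carrier A" using charts_atD[OF c] chart_subset_carrier by blast
    have ad: "adapted A B \<omega>" and tr: "\<And>S X. adjoint_section A B Delta_gl S \<Longrightarrow> smooth_vf A (carrier A) X \<Longrightarrow>
        end_trace A x (\<lambda>v. S x (torsion A \<omega> x (X x) v)) = 0"
      using w x by (auto simp: well_adapted_def)
    have "trace (E ** (conn_coeff \<omega> c x \<xi> - flip (conn_coeff \<omega> c x) \<xi>)) = 0"
      if "\<And>K. K \<in> commutant \<Longrightarrow> E ** ten c K (snd c x) = ten c K (snd c x) ** E" for E \<xi>
      by (rule trace_condition_pointwise[OF haus \<omega> _ c that]) (fact tr)+
    then show "wa c x (conn_coeff \<omega> c x)"
      unfolding well_adapted_coeff_def
      using linear_conn_coeff[OF \<omega> c] adapted_imp_parallel[OF \<omega> ad c] by blast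
  qed
next
  assume *: "\<forall>x. \<forall>c\<in>charts_at A x. wa c x (conn_coeff \<omega> c x)"
  then have wa: "wa c x (conn_coeff \<omega> c x)" if "c \<in> charts_at A x" for c x using that by blast
  then have "adapted A B \<omega>"
    by (intro parallel_imp_adapted[OF \<omega>]) (simp add: well_adapted_coeff_def)
  then show "well_adapted A Delta_gl B \<omega>"
    using trace_condition[OF \<omega> wa] \<omega> by (simp add: well_adapted_def)
qed

end

section \<open>Dependence on the first jet\<close>

text \<open>The entries of the structure tensors are the functions on the quotient of the frame bundle that detect the
  1-jet of a structure.\<close>

definition tensor_entry ::
  "('a, real^('n + 'n)) chart \<Rightarrow> real^('n + 'n)^('n + 'n) \<Rightarrow> 'n + 'n \<Rightarrow> 'n + 'n
    \<Rightarrow> ('a, 'n::finite + 'n) frame set \<Rightarrow> real" where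
  "tensor_entry c K i j P = (let p = (SOME p. p \<in> P) in (fmat c p ** K ** matrix_inv (fmat c p)) $ i $ j)"

context diagonal_structure
begin

lemma tensor_entry_orbit:
  assumes p: "p \<in> frames A" and c: "c \<in> charts_at A (fst p)" and K: "K \<in> commutant"
  shows "tensor_entry c K i j (orbit Delta_GL p) = (fmat c p ** K ** matrix_inv (fmat c p)) $ i $ j"
proof -
  have "\<exists>q. q \<in> orbit Delta_GL p" using Delta_GL_one by (auto simp: orbit_def)
  then have "(SOME q. q \<in> orbit Delta_GL p) \<in> orbit Delta_GL p" by (rule someI_ex)
  then obtain g where g: "g \<in> Delta_GL" "(SOME q. q \<in> orbit Delta_GL p) = act p g" by (auto simp: orbit_def)
  show ?thesis
    unfolding tensor_entry_def Let_def g(2) fmat_act[OF p] conj_Delta_GL[OF fmat_invertible[OF p c] g(1) K] ..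
qed

lemma tensor_entry_fibre:
  assumes c: "c \<in> charts_at A x" and K: "K \<in> commutant"
  shows "tensor_entry c K i j (fibre B x) = ten c K (snd c x) $ i $ j"
proof -
  have "x \<in> carrier A" using charts_atD[OF c] chart_subset_carrier by blast
  then obtain p where "p \<in> B" "fst p = x" by (rule frame_exists)
  then have "p \<in> fibre B x" by (simp add: fibre_def)
  then have "(SOME q. q \<in> fibre B x) \<in> fibre B x" by (rule someI)
  then have q: "(SOME q. q \<in> fibre B x) \<in> B" "fst (SOME q. q \<in> fibre B x) = x" by (auto simp: fibre_def)
  show ?thesis
    using tensor_eq[OF q(1) _ K, of c] c unfolding q(2) tensor_entry_def Let_def by simp
qed

lemma fibre_orbit:
  assumes "x \<in> carrier A"
  obtains p where "p \<in> frames A" "fst p = x" "fibre B x = orbit Delta_GL p"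
proof -
  obtain W \<sigma> where "x \<in> W" "\<And>y. y \<in> W \<Longrightarrow> fst (\<sigma> y) = y \<and> fibre B y = orbit Delta_GL (\<sigma> y)"
    using G_structure assms unfolding G_structure_def by metis
  then have \<sigma>: "fst (\<sigma> x) = x" "fibre B x = orbit Delta_GL (\<sigma> x)" by auto
  then have "\<sigma> x \<in> fibre B x" using Delta_GL_one act_one[of "\<sigma> x"] by (force simp: orbit_def)
  then have "\<sigma> x \<in> frames A" using B_frames by (simp add: fibre_def)
  then show ?thesis using that \<sigma> by blast
qed

text \<open>In the coordinates (y, M) of the frame bundle the pull-back is an entry of M K times the
  inverse of M, which is smooth. An orbit determines its base point, so the domain pulls back to a
  full frame chart.\<close>

lemma quotient_smooth_tensor_entry:
  assumes c: "c \<in> A" and K: "K \<in> commutant"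
  shows "quotient_smooth_fun A Delta_GL (orbit Delta_GL ` {p \<in> frames A. fst p \<in> fst c}) (tensor_entry c K i j)"
  unfolding quotient_smooth_fun_def
proof
  let ?V = "orbit Delta_GL ` {p \<in> frames A. fst p \<in> fst c}"
  have C: "fc c \<in> FA" using c by (simp add: frame_atlas_def)
  have base: "fst p = fst q" if "orbit Delta_GL p = orbit Delta_GL q" for p q :: "('a, 'n + 'n) frame"
  proof -
    have "act p (mat 1) \<in> orbit Delta_GL q" using Delta_GL_one that[symmetric] by (auto simp: orbit_def)
    then obtain g where g: "act p (mat 1) = act q g" unfolding orbit_def by blast
    from arg_cong[OF g, of fst] show ?thesis by simp
  qed
  have dom: "{p \<in> frames A. orbit Delta_GL p \<in> ?V} = fst (fc c)"
  proof (intro equalityI subsetI)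
    fix p assume "p \<in> {p \<in> frames A. orbit Delta_GL p \<in> ?V}"
    then obtain q where q: "p \<in> frames A" "fst q \<in> fst c" "orbit Delta_GL p = orbit Delta_GL q" by blast
    then show "p \<in> fst (fc c)" using base[OF q(3)] by (simp add: fst_frame_chart)
  qed (auto simp: fst_frame_chart)
  show "?V \<subseteq> orbit Delta_GL ` frames A" by blast
  show "smooth_fun FA {p \<in> frames A. orbit Delta_GL p \<in> ?V} (tensor_entry c K i j \<circ> orbit Delta_GL)"
    unfolding dom
  proof (rule FA.smooth_fun_from_chart[OF C FA.openin_chart[OF C] order_refl])
    let ?S = "snd (fc c) ` fst (fc c)"
    have S: "open ?S" by (rule FA.open_chart_image[OF C])
    have inv: "invertible (snd z)" if z: "z \<in> ?S" for z
    proof -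
      obtain p where "p \<in> frames A" "fst p \<in> fst c" "z = snd (fc c) p" using z by (auto simp: fst_frame_chart)
      then show ?thesis using fmat_invertible[of p c] c by (simp add: snd_frame_chart charts_at_def)
    qed
    have "smooth_on ?S (\<lambda>z. (snd z ** K ** matrix_inv (snd z)) $ i $ j)"
      by (intro smooth_on_nth smooth_on_matrix_mult smooth_on_matrix_inv smooth_on_snd_proj smooth_on_const S inv)
    then show "smooth_on ?S (tensor_entry c K i j \<circ> orbit Delta_GL \<circ> chart_inv (fc c))"
    proof (subst smooth_on_cong[OF S])
      fix z assume "z \<in> ?S"
      then obtain p where p: "p \<in> fst (fc c)" "z = snd (fc c) p" by auto
      then have "p \<in> frames A" "c \<in> charts_at A (fst p)" using c by (auto simp: fst_frame_chart charts_at_def)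
      then show "(tensor_entry c K i j \<circ> orbit Delta_GL \<circ> chart_inv (fc c)) z
          = (snd z ** K ** matrix_inv (snd z)) $ i $ j"
        using FA.chart_inv_left[OF C p(1)] tensor_entry_orbit[OF _ _ K] p(2) by (simp add: snd_frame_chart)
    qed
  qed
qed

lemma dir_deriv_tensor_entry:
  assumes c: "c \<in> charts_at A x" and K: "K \<in> commutant" and v: "v \<in> tangent_space A x"
  shows "dir_deriv A (tensor_entry c K i j \<circ> fibre B) x v = dten c K x (v c) $ i $ j"
proof -
  let ?f = "tensor_entry c K i j \<circ> fibre B" and ?S = "snd c ` fst c"
  have cA: "c \<in> A" "x \<in> fst c" using charts_atD[OF c] by auto
  have S: "open ?S" "snd c x \<in> ?S" using open_chart_image[OF cA(1)] cA(2) by auto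
  have eq: "(?f \<circ> chart_inv c) y = ten c K y $ i $ j" if y: "y \<in> ?S" for y
  proof -
    obtain z where z: "z \<in> fst c" "y = snd c z" using y by auto
    then have "c \<in> charts_at A z" using cA by (simp add: charts_at_def)
    then show ?thesis using tensor_entry_fibre[OF _ K] z chart_inv_left[OF cA(1)] by simp
  qed
  have "((\<lambda>y. ten c K y $ i $ j) has_derivative (\<lambda>\<xi>. dten c K x \<xi> $ i $ j)) (at (snd c x))"
    by (intro bounded_linear.has_derivative[OF bounded_linear_vec_nth] tensor_has_derivative[OF c K])
  then have hd: "((?f \<circ> chart_inv c) has_derivative (\<lambda>\<xi>. dten c K x \<xi> $ i $ j)) (at (snd c x))"
    using has_derivative_cong_open[OF S, of "?f \<circ> chart_inv c" "\<lambda>y. ten c K y $ i $ j"] eq by simp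
  show ?thesis
    using dir_deriv_chart[OF c v, of ?f] hd by (auto simp: differentiable_def FD_eq[OF hd])
qed

text \<open>Equal orbits at x give equal tensors there, and the tensor entries used as test
  functions give equal first derivatives. The system at x reads nothing else.\<close>

lemma well_adapted_coeff_1jet:
  assumes B': "G_structure A Delta_GL B'" and jet: "same_1jet A Delta_GL (fibre B) (fibre B') x"
    and c: "c \<in> charts_at A x"
  shows "wa c x \<Gamma> \<longleftrightarrow> well_adapted_coeff (\<lambda>K. structure_tensor B' c K (snd c x))
      (\<lambda>K. FD (structure_tensor B' c K) (snd c x)) \<Gamma>"
proof -
  interpret B': diagonal_structure A B' by unfold_locales (rule B')
  have cA: "c \<in> A" "x \<in> fst c" using charts_atD[OF c] by auto
  have x: "x \<in> carrier A" using cA chart_subset_carrier by blast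
  have eq: "fibre B x = fibre B' x" using jet by (simp add: same_1jet_def)
  obtain p where p: "p \<in> frames A" "fst p = x" "fibre B x = orbit Delta_GL p" using fibre_orbit[OF x] .
  have V: "fibre B x \<in> orbit Delta_GL ` {p \<in> frames A. fst p \<in> fst c}" using p cA(2) by auto
  have "ten c K (snd c x) = structure_tensor B' c K (snd c x)" if K: "K \<in> commutant" for K
    using tensor_entry_fibre[OF c K] B'.tensor_entry_fibre[OF c K] eq by (simp add: vec_eq_iff)
  moreover have "dten c K x \<xi> = FD (structure_tensor B' c K) (snd c x) \<xi>" if K: "K \<in> commutant" for K \<xi>
  proof -
    note t = tvec_of_tangent[OF c, of \<xi>]
    have "dir_deriv A (tensor_entry c K i j \<circ> fibre B) x (tvec_of A x c \<xi>)
        = dir_deriv A (tensor_entry c K i j \<circ> fibre B') x (tvec_of A x c \<xi>)" for i j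
      using jet quotient_smooth_tensor_entry[OF cA(1) K, of i j] V t unfolding same_1jet_def by blast
    then show ?thesis
      by (simp add: dir_deriv_tensor_entry[OF c K t] B'.dir_deriv_tensor_entry[OF c K t] tvec_of_self[OF c] vec_eq_iff)
  qed
  ultimately show ?thesis by (simp add: well_adapted_coeff_def)
qed

lemma well_adapted_exists:
  assumes haus: "Hausdorff_space (atlas_topology A)"
  shows "well_adapted A Delta_gl B (connection_of wa_coeff)"
proof -
  have "linear_connection A (connection_of wa_coeff)"
    by (rule linear_connection_of[OF linear_wa_coeff wa_coeff_change smooth_wa_coeff])
  moreover have "conn_coeff (connection_of wa_coeff) c x = wa_coeff c x" if "c \<in> charts_at A x" for c x
    by (rule conn_coeff_connection_of[OF linear_wa_coeff wa_coeff_change that])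
  ultimately show ?thesis using well_adapted_iff[OF haus] wa_wa_coeff by simp
qed

end

section \<open>Existence, uniqueness and first contact for the global connection\<close>

lemma connection_eqI:
  fixes A :: "('a, real^'m::finite) chart set"
  assumes A: "smooth_atlas A" and \<omega>: "linear_connection A \<omega>" "linear_connection A \<omega>'"
    and p: "p \<in> frames A" and v: "v \<in> tangent_space (frame_atlas A) p" and c: "c \<in> charts_at A (fst p)"
    and eq: "smooth_atlas_vec.conn_coeff A \<omega> c (fst p) = smooth_atlas_vec.conn_coeff A \<omega>' c (fst p)"
  shows "\<omega> p v = \<omega>' p v"
proof -
  interpret smooth_atlas_vec A by (simp add: smooth_atlas_vec_def A)
  show ?thesis using connection_formula[OF \<omega>(1) p c v] connection_formula[OF \<omega>(2) p c v] eq by simp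
qed

lemma well_adapted_ex1:
  fixes A :: "('a, real^('n::finite + 'n)) chart set"
  assumes A: "smooth_manifold A" and B: "G_structure A Delta_GL B"
  shows "\<exists>!\<omega>. well_adapted A Delta_gl B \<omega>"
proof -
  have atlas: "smooth_atlas A" and haus: "Hausdorff_space (atlas_topology A)"
    using A smooth_manifold_atlas by (auto simp: smooth_manifold_def)
  interpret diagonal_structure A B
    using atlas B by (simp add: diagonal_structure_def diagonal_structure_axioms_def smooth_atlas_vec_def)
  show ?thesis
  proof (rule ex_ex1I)
    show "\<exists>\<omega>. well_adapted A Delta_gl B \<omega>" using well_adapted_exists[OF haus] by blast
    fix \<omega> \<omega>' assume w: "well_adapted A Delta_gl B \<omega>" "well_adapted A Delta_gl B \<omega>'"
    then have \<omega>: "linear_connection A \<omega>" "linear_connection A \<omega>'" by (auto simp: well_adapted_def)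
    show "\<omega> = \<omega>'"
    proof (intro ext)
      fix p v
      show "\<omega> p v = \<omega>' p v"
      proof (cases "p \<in> frames A \<and> v \<in> tangent_space FA p")
        case True
        then obtain c where c: "c \<in> charts_at A (fst p)" using charts_at_nonempty framesD(1) by blast
        have "conn_coeff \<omega> c (fst p) = conn_coeff \<omega>' c (fst p)"
          using w c wa_coeff_eqI[OF c] unfolding well_adapted_iff[OF haus \<omega>(1)] well_adapted_iff[OF haus \<omega>(2)] by metis
        then show ?thesis using connection_eqI[OF atlas \<omega> _ _ c] True by blast
      next
        case False
        \<comment> \<open>Off the tangent bundle both forms vanish by normalisation, which makes
          uniqueness a true equality of functions.\<close>
        then have "\<omega> p v = 0" "\<omega>' p v = 0"
          using conjunct1[OF \<omega>(1)[unfolded linear_connection_def]] conjunct1[OF \<omega>(2)[unfolded linear_connection_def]]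
          by blast+
        then show ?thesis by simp
      qed
    qed
  qed
qed

lemma well_adapted_first_contact:
  fixes A :: "('a, real^('n::finite + 'n)) chart set"
  assumes A: "smooth_manifold A" and B: "G_structure A Delta_GL B" and B': "G_structure A Delta_GL B'"
    and w: "well_adapted A Delta_gl B \<omega>" "well_adapted A Delta_gl B' \<omega>'"
    and jet: "same_1jet A Delta_GL (fibre B) (fibre B') (fst p)"
    and p: "p \<in> frames A" and v: "v \<in> tangent_space (frame_atlas A) p"
  shows "\<omega> p v = \<omega>' p v"
proof -
  have atlas: "smooth_atlas A" and haus: "Hausdorff_space (atlas_topology A)"
    using A smooth_manifold_atlas by (auto simp: smooth_manifold_def)
  interpret diagonal_structure A B
    using atlas B by (simp add: diagonal_structure_def diagonal_structure_axioms_def smooth_atlas_vec_def)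
  interpret B': diagonal_structure A B' by unfold_locales (rule B')
  have \<omega>: "linear_connection A \<omega>" "linear_connection A \<omega>'" using w by (auto simp: well_adapted_def)
  obtain c where c: "c \<in> charts_at A (fst p)" using charts_at_nonempty[OF framesD(1)[OF p]] by blast
  have "wa c (fst p) (conn_coeff \<omega> c (fst p))"
    using w(1) c unfolding well_adapted_iff[OF haus \<omega>(1)] by blast
  moreover have "wa c (fst p) (conn_coeff \<omega>' c (fst p))"
    using w(2) c unfolding B'.well_adapted_iff[OF haus \<omega>(2)] well_adapted_coeff_1jet[OF B' jet c] by blast
  ultimately have "conn_coeff \<omega> c (fst p) = conn_coeff \<omega>' c (fst p)" using wa_coeff_eqI[OF c] by metis
  then show ?thesis by (rule connection_eqI[OF atlas \<omega> p v c])
qed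

section \<open>Prolongation, transposition and Lie algebra of the diagonal group\<close>

text \<open>For an argument in one copy of R^n, read the repeated block in the other copy. Symmetry
  of T turns that entry into an off-diagonal one, which vanishes.\<close>

lemma first_prolongation_Delta_gl: "first_prolongation Delta_gl = {\<lambda>_. 0}"
proof
  show "first_prolongation (Delta_gl :: (real^('n::finite + 'n)^('n + 'n)) set) \<subseteq> {\<lambda>_. 0}"
  proof
    fix T :: "real^('n + 'n) \<Rightarrow> real^('n + 'n)^('n + 'n)"
    assume T: "T \<in> first_prolongation Delta_gl"
    then have lin: "linear T" and sym: "\<And>u v. T u *v v = T v *v u" and r: "\<And>u. T u \<in> Delta_gl"
      by (auto simp: first_prolongation_def)
    define D where "D u = (1/2) *\<^sub>R block_trace (T u)" for u
    have TD: "T u = block_diag (D u)" for u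
      using r[of u] by (auto simp: D_def Delta_gl_def block_trace_block_diag)
    have e: "T u $ i $ j = (T u *v axis j 1) $ i" for u i j
      by (simp add: matrix_vector_mul_component inner_axis)
    have "D (axis (Inl k) 1) $ a $ b = 0" for k a b
    proof -
      have "D (axis (Inl k) 1) $ a $ b = T (axis (Inl k) 1) $ Inr a $ Inr b"
        by (simp add: TD)
      also have "\<dots> = (T (axis (Inl k) 1) *v axis (Inr b) 1) $ Inr a" by (rule e)
      also have "\<dots> = (T (axis (Inr b) 1) *v axis (Inl k) 1) $ Inr a"
        by (rule arg_cong[OF sym])
      also have "\<dots> = T (axis (Inr b) 1) $ Inr a $ Inl k" by (rule e[symmetric])
      finally show ?thesis by (simp add: TD)
    qed
    moreover have "D (axis (Inr k) 1) $ a $ b = 0" for k a b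
    proof -
      have "D (axis (Inr k) 1) $ a $ b = T (axis (Inr k) 1) $ Inl a $ Inl b"
        by (simp add: TD)
      also have "\<dots> = (T (axis (Inr k) 1) *v axis (Inl b) 1) $ Inl a" by (rule e)
      also have "\<dots> = (T (axis (Inl b) 1) *v axis (Inr k) 1) $ Inl a"
        by (rule arg_cong[OF sym])
      also have "\<dots> = T (axis (Inl b) 1) $ Inl a $ Inr k" by (rule e[symmetric])
      finally show ?thesis by (simp add: TD)
    qed
    ultimately have "T (axis i 1) = 0" for i
      unfolding TD by (cases i) (auto intro!: plus_mat_eqI)
    then have "T u = 0" for u using linear_expand_axis[OF lin, of u] by simp
    then show "T \<in> {\<lambda>_. 0}" by auto
  qed
  show "{\<lambda>_. 0} \<subseteq> first_prolongation (Delta_gl :: (real^('n::finite + 'n)^('n + 'n)) set)"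
    using linear_0[OF linear_block_diag]
    by (auto simp: first_prolongation_def Delta_gl_def linear_zero image_iff intro!: exI[of _ 0])
qed

lemma transpose_Delta_gl: "transpose ` Delta_gl = Delta_gl"
proof -
  have tr: "transpose (block_diag a) = block_diag (transpose a)" for a :: "real^'n::finite^'n"
    by (rule plus_mat_eqI) (simp_all add: transpose_def)
  have "transpose ` Delta_gl \<subseteq> (Delta_gl :: (real^('n::finite + 'n)^('n + 'n)) set)"
    using tr by (auto simp: Delta_gl_def)
  moreover have "a \<in> transpose ` Delta_gl" if "a \<in> Delta_gl" for a :: "real^('n::finite + 'n)^('n + 'n)"
    using that tr by (intro image_eqI[of _ _ "transpose a"]) (auto simp: Delta_gl_def transpose_transpose)
  ultimately show ?thesis by blast
qed

text \<open>Differentiating the commutation of a curve with the commutant places its velocity in the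
  algebra. Conversely X is the velocity of the affine curve 1 + t X, which is invertible for small
  t.\<close>

lemma lie_algebra_of_Delta_GL: "lie_algebra_of Delta_GL = Delta_gl"
proof
  show "lie_algebra_of Delta_GL \<subseteq> (Delta_gl :: (real^('n::finite + 'n)^('n + 'n)) set)"
  proof
    fix X :: "real^('n + 'n)^('n + 'n)" assume "X \<in> lie_algebra_of Delta_GL"
    then obtain \<gamma> \<epsilon> where \<gamma>: "X = vector_derivative \<gamma> (at 0)" "\<epsilon> > 0" "smooth_on {-\<epsilon><..<\<epsilon>} \<gamma>"
      "\<gamma> ` {-\<epsilon><..<\<epsilon>} \<subseteq> Delta_GL"
      unfolding lie_algebra_of_def by blast
    have zero: "0 \<in> {-\<epsilon><..<\<epsilon>}" using \<gamma>(2) by simp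
    have d: "(\<gamma> has_derivative (\<lambda>t. t *\<^sub>R X)) (at 0)"
      using vector_derivative_works smooth_on_differentiable[OF \<gamma>(3) zero]
      unfolding \<gamma>(1) has_vector_derivative_def by blast
    show "X \<in> Delta_gl"
      unfolding Delta_gl_iff
    proof
      fix K :: "real^('n + 'n)^('n + 'n)" assume K: "K \<in> commutant"
      have l: "((\<lambda>t. \<gamma> t ** K) has_derivative (\<lambda>t. (t *\<^sub>R X) ** K)) (at 0)"
        by (rule bounded_linear.has_derivative[OF mm.bounded_linear_left d])
      have r: "((\<lambda>t. K ** \<gamma> t) has_derivative (\<lambda>t. K ** (t *\<^sub>R X))) (at 0)"
        by (rule bounded_linear.has_derivative[OF mm.bounded_linear_right d])
      have "\<gamma> t ** K = K ** \<gamma> t" if "t \<in> {-\<epsilon><..<\<epsilon>}" for t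
        using commutant_commutes(2)[OF K] \<gamma>(4) that by (metis image_subset_iff)
      then have "((\<lambda>t. K ** \<gamma> t) has_derivative (\<lambda>t. (t *\<^sub>R X) ** K)) (at 0)"
        using has_derivative_cong_open[OF open_greaterThanLessThan zero, of "\<lambda>t. \<gamma> t ** K" "\<lambda>t. K ** \<gamma> t"] l by blast
      from fun_cong[OF has_derivative_unique[OF this r], of 1] show "X ** K = K ** X" by simp
    qed
  qed
  show "(Delta_gl :: (real^('n::finite + 'n)^('n + 'n)) set) \<subseteq> lie_algebra_of Delta_GL"
  proof
    fix X :: "real^('n + 'n)^('n + 'n)" assume "X \<in> Delta_gl"
    then obtain a where a: "X = block_diag a" by (auto simp: Delta_gl_def)
    define \<gamma> where "\<gamma> t = mat 1 + t *\<^sub>R X" for t :: real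
    have \<gamma>: "\<gamma> t = block_diag (mat 1 + t *\<^sub>R a)" for t
      by (simp add: \<gamma>_def a linear_add[OF linear_block_diag] linear_cmul[OF linear_block_diag] block_diag_mat_1)
    have "open ((\<lambda>t. mat 1 + t *\<^sub>R a) -` {A. invertible A})"
      by (intro open_vimage open_invertible continuous_intros)
    moreover have "0 \<in> (\<lambda>t. mat 1 + t *\<^sub>R a) -` {A. invertible A}"
      by (simp add: invertible_mat_1)
    ultimately obtain \<epsilon> where \<epsilon>: "\<epsilon> > 0" "ball 0 \<epsilon> \<subseteq> (\<lambda>t. mat 1 + t *\<^sub>R a) -` {A. invertible A}"
      using open_contains_ball by blast
    have "\<gamma> ` {-\<epsilon><..<\<epsilon>} \<subseteq> Delta_GL"
    proof
      fix m assume "m \<in> \<gamma> ` {-\<epsilon><..<\<epsilon>}"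
      then obtain t where t: "t \<in> {-\<epsilon><..<\<epsilon>}" "m = \<gamma> t" by blast
      then have "invertible (mat 1 + t *\<^sub>R a)" using \<epsilon>(2) by (auto simp: dist_real_def subset_iff)
      then show "m \<in> Delta_GL" unfolding t(2) \<gamma> Delta_GL_def by blast
    qed
    moreover have "smooth_on {-\<epsilon><..<\<epsilon>} \<gamma>"
      unfolding \<gamma>_def by (intro smooth_intros open_greaterThanLessThan)
    moreover have "(\<gamma> has_vector_derivative X) (at 0)"
      unfolding \<gamma>_def has_vector_derivative_def by (auto intro!: derivative_eq_intros)
    moreover have "\<gamma> 0 = mat 1" by (simp add: \<gamma>_def)
    ultimately show "X \<in> lie_algebra_of Delta_GL"
      unfolding lie_algebra_of_def using \<epsilon>(1) vector_derivative_at[of \<gamma> X 0] by blast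
  qed
qed

text \<open>First contact is expressed by comparison: two structures with the same 1-jet at x have
  well-adapted connections whose forms agree at all frames over x.\<close>

theorem proposition13:
  shows "lie_algebra_of (Delta_GL :: (real^('n::finite + 'n)^('n + 'n)) set) = Delta_gl
    \<and> first_prolongation (Delta_gl :: (real^('n + 'n)^('n + 'n)) set) = {\<lambda>_. 0}
    \<and> transpose ` (Delta_gl :: (real^('n + 'n)^('n + 'n)) set) = Delta_gl
    \<and> (\<forall>A :: ('a, real^('n + 'n)) chart set. smooth_manifold A \<longrightarrow>
        (\<forall>B. G_structure A Delta_GL B \<longrightarrow> (\<exists>!\<omega>. well_adapted A Delta_gl B \<omega>))
      \<and> (\<forall>B B' \<omega> \<omega>'. G_structure A Delta_GL B \<and> G_structure A Delta_GL B'
            \<and> well_adapted A Delta_gl B \<omega> \<and> well_adapted A Delta_gl B' \<omega>' \<longrightarrow>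
          (\<forall>x\<in>carrier A. same_1jet A Delta_GL (fibre B) (fibre B') x \<longrightarrow>
            (\<forall>p\<in>frames A. fst p = x \<longrightarrow>
              (\<forall>v\<in>tangent_space (frame_atlas A) p. \<omega> p v = \<omega>' p v)))))"
  by (intro conjI allI impI ballI lie_algebra_of_Delta_GL first_prolongation_Delta_gl transpose_Delta_gl
      well_adapted_ex1 well_adapted_first_contact; (elim conjE)?; assumption?) simp_all

end
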